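(* Let $n\ge m$ be positive integers, $\kappa=(k_1,\dots,k_m)\in\mathbb{R}^m$, $\tau=(t_1,\dots,t_m)\in\mathbb{R}^m$, and $\nu$ real with $\nu\beta/2>(m-1)\beta/2-k_m$ and $n\beta/2>(m-1)\beta/2-t_m$. Let $\mathbf{U}_1\sim\mathcal{R}^{\beta,I}_m(\nu\beta/2,\kappa,\mathbf{I}_m)$ and $\mathbf{X}\sim\mathcal{KR}^{\beta,I}_{n\times m}(\tau,\mathbf{0},\mathbf{I}_n,\mathbf{I}_m)$ be independent. Put $\mathbf{U}=\mathbf{U}_1+\mathbf{X}^*\mathbf{X}$, let $\mathbf{U}=\mathbf{L}^*\mathbf{L}$ be its Cholesky decomposition with $\mathbf{L}\in\mathfrak{T}^\beta_U(m)$, and define $\mathbf{R}=\mathbf{X}\mathbf{L}^{-1}\in\mathfrak{A}^{n\times m}$. Then $\mathbf{U}\sim\mathcal{R}^{\beta,I}_m((\nu+n)\beta/2,\kappa+\tau,\mathbf{I}_m)$, $\mathbf{U}$ is independent of $\mathbf{R}$, and $\mathbf{R}$ has density $$\frac{\Gamma^\beta_m[n\beta/2]\,|\mathbf{I}_m-\mathbf{R}^*\mathbf{R}|^{(\nu-m+1)\beta/2-1}}{\pi^{mn\beta/2}\,\mathcal{B}^\beta_m[\nu\beta/2,\kappa;n\beta/2,\tau]}\;q_\kappa(\mathbf{I}_m-\mathbf{R}^*\mathbf{R})\,q_\tau(\mathbf{R}^*\mathbf{R})\,(d\mathbf{R})$$ on the set $\{\mathbf{R}:\mathbf{I}_m-\mathbf{R}^*\mathbf{R}\in\mathfrak{P}^\beta_m\}$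 (this is called the matricvariate Pearson type II-Riesz distribution type I).
   Context: $\mathfrak{A}$ is a real normed division algebra $\mathbb{R},\mathbb{C}$ or $\mathbb{H}$ (the paper formally also includes the octonions), and $\beta=\dim_{\mathbb{R}}\mathfrak{A}\in\{1,2,4\}$. For a matrix $\mathbf{A}$ over $\mathfrak{A}$, $\mathbf{A}^*$ is the conjugate transpose. $\mathfrak{P}^\beta_m$ is the cone of $m\times m$ positive definite Hermitian matrices over $\mathfrak{A}$; $\mathfrak{T}^\beta_U(m)$ is the group of $m\times m$ upper triangular matrices over $\mathfrak{A}$ with positive real diagonal; every $\mathbf{A}\in\mathfrak{P}^\beta_m$ has a unique Cholesky decomposition $\mathbf{A}=\mathbf{T}^*\mathbf{T}$ with $\mathbf{T}\in\mathfrak{T}^\beta_U(m)$. $(d\mathbf{X})$ is Lebesgue measure on $\mathfrak{A}^{n\times m}\cong\mathbb{R}^{\beta mn}$, and $(d\mathbf{S})$ Lebesgue measure on Hermitian $m\times m$ matrices (in the $m$ real diagonal entries and the $\beta$ real components of each strictly off-diagonal entry above the diagonal). $|\cdot|$ is the determinant (product of eigenvalues) of a Hermitian matrix; $\operatorname{etr}(\cdot)=\exp(\operatorname{tr}(\cdot))$. For $\kappa=(k_1,\dots,k_m)\in\mathbb{R}^m$ and $\mathbf{A}\in\mathfrak{P}^\beta_m$, $q_\kappa(\mathbf{A})=|\mathbf{A}_m|^{k_m}\prod_{i=1}^{m-1}|\mathbf{A}_i|^{k_i-k_{i+1}}$, where $\mathbf{A}_p$ is the leading $p\times p$ principal submatrix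 (equivalently $q_\kappa(\mathbf{A})=\prod_i t_{ii}^{2k_i}$ if $\mathbf{A}=\mathbf{T}^*\mathbf{T}$ is the Cholesky decomposition). Generalised gamma functions: $\Gamma^\beta_m[a,\kappa]=\pi^{m(m-1)\beta/4}\prod_{i=1}^m\Gamma[a+k_i-(i-1)\beta/2]$, $\Gamma^\beta_m[a]=\Gamma^\beta_m[a,(0,\dots,0)]$. Generalised c-beta function: $\mathcal{B}^\beta_m[a,\kappa;b,\tau]=\Gamma^\beta_m[a,\kappa]\Gamma^\beta_m[b,\tau]/\Gamma^\beta_m[a+b,\kappa+\tau]$. Riesz distribution type I: $\mathbf{V}\sim\mathcal{R}^{\beta,I}_m(a,\kappa,\mathbf{I}_m)$ means $\mathbf{V}\in\mathfrak{P}^\beta_m$ has density $\frac{\beta^{am+\sum_i k_i}}{\Gamma^\beta_m[a,\kappa]}\operatorname{etr}\{-\beta\mathbf{V}\}|\mathbf{V}|^{a-(m-1)\beta/2-1}q_\kappa(\mathbf{V})(d\mathbf{V})$, for $a>(m-1)\beta/2-k_m$. Kotz-Riesz distribution type I: $\mathbf{X}\sim\mathcal{KR}^{\beta,I}_{n\times m}(\tau,\mathbf{0},\mathbf{I}_n,\mathbf{I}_m)$ means $\mathbf{X}\in\mathfrak{A}^{n\times m}$ has density $\frac{\beta^{mn\beta/2+\sum_i t_i}\Gamma^\beta_m[n\beta/2]}{\pi^{mn\beta/2}\Gamma^\beta_m[n\beta/2,\tau]}\exp\{-\beta\operatorname{tr}(\mathbf{X}^*\mathbf{X})\}q_\tau(\mathbf{X}^*\mathbf{X})(d\mathbf{X})$,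 for $n\beta/2>(m-1)\beta/2-t_m$. *)

theory Defs
  imports "HOL-Probability.Probability"
begin

section \<open>The division algebra: quaternions as real^4; R and C are the subalgebras
  of beta-dimensional elements (components 0..beta-1, i.e. 1, i, j, k)\<close>

type_synonym quat = "real^4"

definition qmk :: "real \<Rightarrow> real \<Rightarrow> real \<Rightarrow> real \<Rightarrow> quat" where
  "qmk a b c d = (\<chi> t. if t = 0 then a else if t = 1 then b else if t = 2 then c else d)"

definition qmul :: "quat \<Rightarrow> quat \<Rightarrow> quat" where
  "qmul p q = qmk
     (p$0*q$0 - p$1*q$1 - p$2*q$2 - p$3*q$3)
     (p$0*q$1 + p$1*q$0 + p$2*q$3 - p$3*q$2)
     (p$0*q$2 - p$1*q$3 + p$2*q$0 + p$3*q$1)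
     (p$0*q$3 + p$1*q$2 - p$2*q$1 + p$3*q$0)"

definition qcnj :: "quat \<Rightarrow> quat" where
  "qcnj p = qmk (p$0) (- p$1) (- p$2) (- p$3)"

definition qre :: "quat \<Rightarrow> real" where
  "qre p = p$0"

definition qof_real :: "real \<Rightarrow> quat" where
  "qof_real r = qmk r 0 0 0"

definition in_alg :: "nat \<Rightarrow> quat \<Rightarrow> bool" where
  "in_alg \<beta> q \<longleftrightarrow> (\<beta> \<le> 1 \<longrightarrow> q$1 = 0) \<and> (\<beta> \<le> 2 \<longrightarrow> q$2 = 0 \<and> q$3 = 0)"

type_synonym qmat = "nat \<Rightarrow> nat \<Rightarrow> quat"

definition mats :: "nat \<Rightarrow> nat \<Rightarrow> nat \<Rightarrow> qmat set" where
  "mats \<beta> r c = {A. (\<forall>i j. i < r \<and> j < c \<longrightarrow> in_alg \<beta> (A i j)) \<and>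
                      (\<forall>i j. \<not> (i < r \<and> j < c) \<longrightarrow> A i j = 0)}"

definition mmul :: "nat \<Rightarrow> qmat \<Rightarrow> qmat \<Rightarrow> qmat" where
  "mmul k A B = (\<lambda>i j. \<Sum>l<k. qmul (A i l) (B l j))"

definition ctr :: "qmat \<Rightarrow> qmat" where
  "ctr A = (\<lambda>i j. qcnj (A j i))"

definition madd :: "qmat \<Rightarrow> qmat \<Rightarrow> qmat" where
  "madd A B = (\<lambda>i j. A i j + B i j)"

definition msub :: "qmat \<Rightarrow> qmat \<Rightarrow> qmat" where
  "msub A B = (\<lambda>i j. A i j - B i j)"

definition idm :: "nat \<Rightarrow> qmat" where
  "idm m = (\<lambda>i j. if i = j \<and> i < m then qof_real 1 else 0)"

definition mtr :: "nat \<Rightarrow> qmat \<Rightarrow> real" where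
  "mtr m A = (\<Sum>i<m. qre (A i i))"

definition pd :: "nat \<Rightarrow> nat \<Rightarrow> qmat \<Rightarrow> bool" where
  "pd \<beta> m A \<longleftrightarrow> A \<in> mats \<beta> m m \<and> ctr A = A \<and>
     (\<forall>x :: nat \<Rightarrow> quat. (\<forall>i<m. in_alg \<beta> (x i)) \<and> (\<exists>i<m. x i \<noteq> 0) \<longrightarrow>
        qre (\<Sum>i<m. \<Sum>j<m. qmul (qcnj (x i)) (qmul (A i j) (x j))) > 0)"

definition upper_pos :: "nat \<Rightarrow> nat \<Rightarrow> qmat \<Rightarrow> bool" where
  "upper_pos \<beta> m T \<longleftrightarrow> T \<in> mats \<beta> m m \<and> (\<forall>i j. j < i \<longrightarrow> T i j = 0) \<and>
     (\<forall>i<m. T i i = qof_real (qre (T i i)) \<and> qre (T i i) > 0)"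

definition chol :: "nat \<Rightarrow> nat \<Rightarrow> qmat \<Rightarrow> qmat" where
  "chol \<beta> m A = (THE T. upper_pos \<beta> m T \<and> mmul m (ctr T) T = A)"

definition minv :: "nat \<Rightarrow> nat \<Rightarrow> qmat \<Rightarrow> qmat" where
  "minv \<beta> m A = (THE B. B \<in> mats \<beta> m m \<and> mmul m A B = idm m \<and> mmul m B A = idm m)"

text \<open>determinant of a positive definite Hermitian matrix (product of the eigenvalues,
  equal to the product of the squared Cholesky diagonal)\<close>
definition hdet :: "nat \<Rightarrow> nat \<Rightarrow> qmat \<Rightarrow> real" where
  "hdet \<beta> m A = (\<Prod>i<m. (qre (chol \<beta> m A i i))^2)"

definition qpow :: "nat \<Rightarrow> nat \<Rightarrow> (nat \<Rightarrow> real) \<Rightarrow> qmat \<Rightarrow> real" where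
  "qpow \<beta> m \<kappa> A = (\<Prod>i<m. qre (chol \<beta> m A i i) powr (2 * \<kappa> i))"

definition gammam :: "nat \<Rightarrow> nat \<Rightarrow> real \<Rightarrow> (nat \<Rightarrow> real) \<Rightarrow> real" where
  "gammam \<beta> m a \<kappa> = pi powr (real m * (real m - 1) * real \<beta> / 4) *
      (\<Prod>i<m. Gamma (a + \<kappa> i - real i * real \<beta> / 2))"

definition cbeta :: "nat \<Rightarrow> nat \<Rightarrow> real \<Rightarrow> (nat \<Rightarrow> real) \<Rightarrow> real \<Rightarrow> (nat \<Rightarrow> real) \<Rightarrow> real" where
  "cbeta \<beta> m a \<kappa> b \<tau> = gammam \<beta> m a \<kappa> * gammam \<beta> m b \<tau> / gammam \<beta> m (a + b) (\<lambda>i. \<kappa> i + \<tau> i)"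

definition mat_space :: "qmat measure" where
  "mat_space = PiM UNIV (\<lambda>_. PiM UNIV (\<lambda>_. (borel :: quat measure)))"

definition coord_entry :: "nat \<Rightarrow> (nat \<times> nat \<times> nat \<Rightarrow> real) \<Rightarrow> nat \<Rightarrow> nat \<Rightarrow> quat" where
  "coord_entry \<beta> x i j = qmk (x (i, j, 0)) (if 2 \<le> \<beta> then x (i, j, 1) else 0)
      (if 4 \<le> \<beta> then x (i, j, 2) else 0) (if 4 \<le> \<beta> then x (i, j, 3) else 0)"

definition mat_idx :: "nat \<Rightarrow> nat \<Rightarrow> nat \<Rightarrow> (nat \<times> nat \<times> nat) set" where
  "mat_idx \<beta> n m = {(i, j, c). i < n \<and> j < m \<and> c < \<beta>}"

definition mat_decode :: "nat \<Rightarrow> nat \<Rightarrow> nat \<Rightarrow> (nat \<times> nat \<times> nat \<Rightarrow> real) \<Rightarrow> qmat" where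
  "mat_decode \<beta> n m x = (\<lambda>i j. if i < n \<and> j < m then coord_entry \<beta> x i j else 0)"

definition lebM :: "nat \<Rightarrow> nat \<Rightarrow> nat \<Rightarrow> qmat measure" where
  "lebM \<beta> n m = distr (PiM (mat_idx \<beta> n m) (\<lambda>_. lborel)) mat_space (mat_decode \<beta> n m)"

definition herm_idx :: "nat \<Rightarrow> nat \<Rightarrow> (nat \<times> nat \<times> nat) set" where
  "herm_idx \<beta> m = {(i, j, c). i < j \<and> j < m \<and> c < \<beta>} \<union> {(i, i, 0) | i. i < m}"

definition herm_decode :: "nat \<Rightarrow> nat \<Rightarrow> (nat \<times> nat \<times> nat \<Rightarrow> real) \<Rightarrow> qmat" where
  "herm_decode \<beta> m x = (\<lambda>i j. if i < m \<and> j < m then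
      (if i = j then qof_real (x (i, i, 0))
       else if i < j then coord_entry \<beta> x i j else qcnj (coord_entry \<beta> x j i))
     else 0)"

definition lebH :: "nat \<Rightarrow> nat \<Rightarrow> qmat measure" where
  "lebH \<beta> m = distr (PiM (herm_idx \<beta> m) (\<lambda>_. lborel)) mat_space (herm_decode \<beta> m)"

definition riesz_pdf :: "nat \<Rightarrow> nat \<Rightarrow> real \<Rightarrow> (nat \<Rightarrow> real) \<Rightarrow> qmat \<Rightarrow> real" where
  "riesz_pdf \<beta> m a \<kappa> V = (if pd \<beta> m V then
      real \<beta> powr (a * real m + (\<Sum>i<m. \<kappa> i)) / gammam \<beta> m a \<kappa> *
      exp (- real \<beta> * mtr m V) *
      hdet \<beta> m V powr (a - (real m - 1) * real \<beta> / 2 - 1) * qpow \<beta> m \<kappa> V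
    else 0)"

text \<open>Kotz-Riesz distribution type I, KR^{beta,I}_{n x m}(tau, 0, I_n, I_m).
  (q_tau(X*X) is only defined for X*X positive definite, which holds a.e. as n >= m.)\<close>
definition kotz_riesz_pdf :: "nat \<Rightarrow> nat \<Rightarrow> nat \<Rightarrow> (nat \<Rightarrow> real) \<Rightarrow> qmat \<Rightarrow> real" where
  "kotz_riesz_pdf \<beta> n m \<tau> X = (let S = mmul n (ctr X) X in
    if pd \<beta> m S then
      real \<beta> powr (real m * real n * real \<beta> / 2 + (\<Sum>i<m. \<tau> i)) *
        gammam \<beta> m (real n * real \<beta> / 2) (\<lambda>_. 0) /
        (pi powr (real m * real n * real \<beta> / 2) * gammam \<beta> m (real n * real \<beta> / 2) \<tau>) *
        exp (- real \<beta> * mtr m S) * qpow \<beta> m \<tau> S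
    else 0)"

definition pearson_riesz_pdf :: "nat \<Rightarrow> nat \<Rightarrow> nat \<Rightarrow> real \<Rightarrow> (nat \<Rightarrow> real) \<Rightarrow> (nat \<Rightarrow> real) \<Rightarrow> qmat \<Rightarrow> real" where
  "pearson_riesz_pdf \<beta> n m \<nu> \<kappa> \<tau> R = (let S = mmul n (ctr R) R; D = msub (idm m) S in
    if pd \<beta> m D then
      gammam \<beta> m (real n * real \<beta> / 2) (\<lambda>_. 0) *
        hdet \<beta> m D powr ((\<nu> - real m + 1) * real \<beta> / 2 - 1) /
        (pi powr (real m * real n * real \<beta> / 2) *
         cbeta \<beta> m (\<nu> * real \<beta> / 2) \<kappa> (real n * real \<beta> / 2) \<tau>) *
        qpow \<beta> m \<kappa> D * qpow \<beta> m \<tau> S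
    else 0)"

end

theory Submission
  imports Defs
begin

text \<open>For fixed \<open>X\<close> the shift \<open>U\<^sub>1 \<mapsto> U\<^sub>1 + X\<^sup>* X\<close> preserves Lebesgue measure, and for fixed
  \<open>U = L\<^sup>* L\<close> the map \<open>R \<mapsto> R L\<close> is triangular in the columns with Jacobian \<open>\<Prod> l\<^sub>i\<^sub>i\<^bsup>n\<beta>\<^esup>\<close>. Since
  \<open>U - X\<^sup>* X = L\<^sup>* (I - R\<^sup>* R) L\<close> and power functions are multiplicative along Cholesky factors, the joint
  density splits into a function of \<open>U\<close> times a function of \<open>R\<close>. Only the constant of the \<open>U\<close>-factor has
  to be computed, by substituting \<open>U = T\<^sup>* T\<close>; the constant of \<open>R\<close> follows because the total mass is one.
  Finiteness of that mass also yields the positivity of all gamma arguments, which the hypotheses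
  on \<open>\<kappa>\<close> and \<open>\<tau>\<close> alone do not give for non-monotone exponents.\<close>

section \<open>Quaternions\<close>

text \<open>Two definite descriptions, \<open>chol\<close> and \<open>minv\<close>, and a
  definiteness condition over uncountably many vectors stand between the definitions and measure
  theory. They are replaced by explicit recursions: elimination (\<open>cfac\<close>), whose pivots
  are all positive exactly for positive definite matrices among the Hermitian ones, and forward
  substitution (\<open>rsolve\<close>). Quaternion entries do not commute, so no polynomial
  determinant is at hand and every density is expressed through the real diagonal of the Cholesky
  factor alone. The factor in \<open>R\<close> produced by the substitution carries the condition
  that \<open>R* R\<close> be positive definite, which the claimed density does not; the discrepancy
  is a null set because \<open>m \<le> n\<close>. The signs of the constants in the two given laws
  are not known beforehand and are read off from the fact that these laws have mass one.\<close>

lemma quat_eq_iff: "(p::quat) = q \<longleftrightarrow> p$0 = q$0 \<and> p$1 = q$1 \<and> p$2 = q$2 \<and> p$3 = q$3"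
proof -
  \<comment> \<open>The index type counts modulo four and \<open>forall_4\<close> runs over 1, 2, 3,
    4, so its last index is component 0.\<close>
  have "(4::4) = 0" by simp
  then show ?thesis unfolding vec_eq_iff forall_4 by metis
qed

lemma qmk_nth [simp]:
  "qmk a b c d $ 0 = a" "qmk a b c d $ 1 = b" "qmk a b c d $ 2 = c" "qmk a b c d $ 3 = d"
  by (simp_all add: qmk_def)

lemma qmk_eq: "qmk a b c d = a *\<^sub>R axis 0 1 + b *\<^sub>R axis 1 1 + c *\<^sub>R axis 2 1 + d *\<^sub>R axis 3 1"
  by (simp add: quat_eq_iff axis_def)

lemma qmul_nth [simp]:
  "qmul p q $ 0 = p$0*q$0 - p$1*q$1 - p$2*q$2 - p$3*q$3"
  "qmul p q $ 1 = p$0*q$1 + p$1*q$0 + p$2*q$3 - p$3*q$2"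
  "qmul p q $ 2 = p$0*q$2 - p$1*q$3 + p$2*q$0 + p$3*q$1"
  "qmul p q $ 3 = p$0*q$3 + p$1*q$2 - p$2*q$1 + p$3*q$0"
  by (simp_all add: qmul_def)

lemma qcnj_nth [simp]:
  "qcnj p $ 0 = p$0" "qcnj p $ 1 = - p$1" "qcnj p $ 2 = - p$2" "qcnj p $ 3 = - p$3"
  by (simp_all add: qcnj_def)

lemma qof_real_nth [simp]:
  "qof_real r $ 0 = r" "qof_real r $ 1 = 0" "qof_real r $ 2 = 0" "qof_real r $ 3 = 0"
  by (simp_all add: qof_real_def)

lemma bounded_bilinear_qmul: "bounded_bilinear qmul"
  by (subst bilinear_conv_bounded_bilinear [symmetric], unfold bilinear_def, safe; rule linearI)
    (simp_all add: quat_eq_iff algebra_simps)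

interpretation qmul: bounded_bilinear qmul
  by (rule bounded_bilinear_qmul)

lemma bounded_linear_qcnj: "bounded_linear qcnj"
  unfolding linear_conv_bounded_linear [symmetric]
  by (rule linearI) (simp_all add: quat_eq_iff)

lemmas qcnj_linear = linear_add[OF bounded_linear.linear[OF bounded_linear_qcnj]]
  linear_diff[OF bounded_linear.linear[OF bounded_linear_qcnj]]
  linear_scale[OF bounded_linear.linear[OF bounded_linear_qcnj]]
  linear_0[OF bounded_linear.linear[OF bounded_linear_qcnj]]
  linear_sum[OF bounded_linear.linear[OF bounded_linear_qcnj]]

lemma bounded_linear_qre: "bounded_linear qre"
  unfolding linear_conv_bounded_linear [symmetric]
  by (rule linearI) (simp_all add: qre_def)

lemmas qre_linear = linear_add[OF bounded_linear.linear[OF bounded_linear_qre]]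
  linear_diff[OF bounded_linear.linear[OF bounded_linear_qre]]
  linear_scale[OF bounded_linear.linear[OF bounded_linear_qre]]
  linear_0[OF bounded_linear.linear[OF bounded_linear_qre]]
  linear_sum[OF bounded_linear.linear[OF bounded_linear_qre]]

lemma qmul_assoc: "qmul (qmul p q) r = qmul p (qmul q r)"
  by (simp add: quat_eq_iff algebra_simps)

lemma qmul_qof_real [simp]: "qmul (qof_real r) q = r *\<^sub>R q" "qmul q (qof_real r) = r *\<^sub>R q"
  by (simp_all add: quat_eq_iff)

lemma qcnj_qmul: "qcnj (qmul p q) = qmul (qcnj q) (qcnj p)"
  by (simp add: quat_eq_iff algebra_simps)

lemma qcnj_qcnj [simp]: "qcnj (qcnj p) = p"
  by (simp add: quat_eq_iff)

lemma qcnj_qof_real [simp]: "qcnj (qof_real r) = qof_real r"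
  by (simp add: quat_eq_iff)

lemma qre_qof_real [simp]: "qre (qof_real r) = r"
  by (simp add: qre_def)

lemma qof_real_0 [simp]: "qof_real 0 = 0"
  by (simp add: quat_eq_iff)

lemma qof_real_eq_0_iff [simp]: "qof_real r = 0 \<longleftrightarrow> r = 0"
  by (simp add: quat_eq_iff)

lemma scaleR_qof_real [simp]: "r *\<^sub>R qof_real s = qof_real (r * s)"
  by (simp add: quat_eq_iff)

lemma qof_real_add: "qof_real (r + s) = qof_real r + qof_real s"
  by (simp add: quat_eq_iff)

lemma qof_real_sum: "qof_real (sum f A) = (\<Sum>i\<in>A. qof_real (f i))"
  by (induction A rule: infinite_finite_induct) (auto simp: qof_real_add)

definition qnsq :: "quat \<Rightarrow> real" where
  "qnsq q = (q$0)\<^sup>2 + (q$1)\<^sup>2 + (q$2)\<^sup>2 + (q$3)\<^sup>2"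

lemma qnsq_nonneg [simp]: "0 \<le> qnsq q"
  by (simp add: qnsq_def)

lemma qnsq_eq_0_iff [simp]: "qnsq q = 0 \<longleftrightarrow> q = 0"
  by (simp add: qnsq_def quat_eq_iff add_nonneg_eq_0_iff)

lemma qmul_qcnj_self [simp]: "qmul (qcnj q) q = qof_real (qnsq q)" "qmul q (qcnj q) = qof_real (qnsq q)"
  by (simp_all add: quat_eq_iff qnsq_def power2_eq_square algebra_simps)

lemma qnsq_qof_real [simp]: "qnsq (qof_real r) = r\<^sup>2"
  by (simp add: qnsq_def)

text \<open>Components are numbered by naturals to match the third entry of the index triples in
  \<open>mat_idx\<close> and \<open>herm_idx\<close>. Every number above 2 selects the last
  component, so statements about it restrict to \<open>c < 4\<close>.\<close>

definition qcomp :: "nat \<Rightarrow> quat \<Rightarrow> real" where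
  "qcomp c q = (if c = 0 then q$0 else if c = 1 then q$1 else if c = 2 then q$2 else q$3)"

lemma bounded_linear_qcomp: "bounded_linear (qcomp c)"
  unfolding linear_conv_bounded_linear [symmetric]
  by (rule linearI) (simp_all add: qcomp_def)

lemmas qcomp_linear = linear_add[OF bounded_linear.linear[OF bounded_linear_qcomp]]
  linear_diff[OF bounded_linear.linear[OF bounded_linear_qcomp]]
  linear_scale[OF bounded_linear.linear[OF bounded_linear_qcomp]]
  linear_0[OF bounded_linear.linear[OF bounded_linear_qcomp]]
  linear_sum[OF bounded_linear.linear[OF bounded_linear_qcomp]]

lemma lessThan_4: "{..<4::nat} = {0,1,2,3}"
  by auto

lemma qcomp_eqI:
  assumes "\<And>c. c < 4 \<Longrightarrow> qcomp c p = qcomp c q"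
  shows "p = q"
  using assms[of 0] assms[of 1] assms[of 2] assms[of 3]
  unfolding quat_eq_iff by (simp add: qcomp_def)

text \<open>For each of the three values of \<open>\<beta>\<close> both sides list the same
  vanishing components. The right-hand form is uniform in \<open>\<beta>\<close>, which lets later
  arguments run over components without distinguishing the algebras.\<close>

lemma in_alg_iff:
  assumes "\<beta> \<in> {1,2,4}"
  shows "in_alg \<beta> q \<longleftrightarrow> (\<forall>c. \<beta> \<le> c \<and> c < 4 \<longrightarrow> qcomp c q = 0)"
proof -
  have *: "(\<forall>c. \<beta> \<le> c \<and> c < 4 \<longrightarrow> P c) \<longleftrightarrow> (\<forall>c\<in>{\<beta>..<4}. P c)" for P by auto
  have "{1..<4} = {1,2,3::nat}" "{2..<4} = {2,3::nat}" by auto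
  with assms show ?thesis
    unfolding * by (auto simp: in_alg_def qcomp_def)
qed

lemma in_alg_qmul: "\<beta> \<in> {1,2,4} \<Longrightarrow> in_alg \<beta> p \<Longrightarrow> in_alg \<beta> q \<Longrightarrow> in_alg \<beta> (qmul p q)"
  by (auto simp: in_alg_def)

lemma in_alg_add: "in_alg \<beta> p \<Longrightarrow> in_alg \<beta> q \<Longrightarrow> in_alg \<beta> (p + q)"
  and in_alg_diff: "in_alg \<beta> p \<Longrightarrow> in_alg \<beta> q \<Longrightarrow> in_alg \<beta> (p - q)"
  and in_alg_minus: "in_alg \<beta> p \<Longrightarrow> in_alg \<beta> (- p)"
  and in_alg_scaleR: "in_alg \<beta> p \<Longrightarrow> in_alg \<beta> (r *\<^sub>R p)"
  and in_alg_qcnj: "in_alg \<beta> p \<Longrightarrow> in_alg \<beta> (qcnj p)"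
  and in_alg_0 [simp]: "in_alg \<beta> 0"
  and in_alg_qof_real [simp]: "in_alg \<beta> (qof_real r)"
  by (auto simp: in_alg_def)

lemma in_alg_sum: "(\<And>i. i \<in> A \<Longrightarrow> in_alg \<beta> (f i)) \<Longrightarrow> in_alg \<beta> (sum f A)"
  by (induction A rule: infinite_finite_induct) (auto intro: in_alg_add)

lemma qcomp_coord_entry:
  assumes "\<beta> \<in> {1,2,4}" "c < 4"
  shows "qcomp c (coord_entry \<beta> x i j) = (if c < \<beta> then x (i,j,c) else 0)"
proof -
  have "c = 0 \<or> c = 1 \<or> c = 2 \<or> c = 3" using assms by auto
  with assms show ?thesis by (auto simp: qcomp_def coord_entry_def)
qed

lemma in_alg_coord_entry: "\<beta> \<in> {1,2,4} \<Longrightarrow> in_alg \<beta> (coord_entry \<beta> x i j)"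
  by (auto simp: in_alg_def coord_entry_def)

lemma qnsq_coord_entry:
  assumes "\<beta> \<in> {1,2,4}"
  shows "qnsq (coord_entry \<beta> x i j) = (\<Sum>c<\<beta>. (x (i,j,c))\<^sup>2)"
proof -
  have *: "{..<Suc 0} = {0}" "{..<2} = {0,1::nat}" by auto
  show ?thesis
    using assms by (auto simp: qnsq_def coord_entry_def * lessThan_4 lessThan_Suc)
qed

section \<open>Measurability of the quaternion operations\<close>

lemma borel_measurable_qmk [measurable (raw)]:
  "a \<in> borel_measurable M \<Longrightarrow> b \<in> borel_measurable M \<Longrightarrow> c \<in> borel_measurable M \<Longrightarrow> d \<in> borel_measurable M
   \<Longrightarrow> (\<lambda>x. qmk (a x) (b x) (c x) (d x)) \<in> borel_measurable M"
  unfolding qmk_eq by (intro borel_measurable_add borel_measurable_scaleR borel_measurable_const)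

lemma borel_measurable_bounded_linear:
  assumes "bounded_linear h" "f \<in> borel_measurable M"
  shows "(\<lambda>x. h (f x)) \<in> borel_measurable M"
  using borel_measurable_continuous_onI[OF linear_continuous_on[OF assms(1)]] assms(2)
  by (rule measurable_compose_rev)

lemmas borel_measurable_qcnj [measurable (raw)] = borel_measurable_bounded_linear[OF bounded_linear_qcnj]
lemmas borel_measurable_qre [measurable (raw)] = borel_measurable_bounded_linear[OF bounded_linear_qre]
lemmas borel_measurable_qcomp [measurable (raw)] = borel_measurable_bounded_linear[OF bounded_linear_qcomp]

lemma borel_measurable_qof_real [measurable (raw)]:
  "f \<in> borel_measurable M \<Longrightarrow> (\<lambda>x. qof_real (f x)) \<in> borel_measurable M"
  unfolding qof_real_def by (intro borel_measurable_qmk borel_measurable_const)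

lemma borel_measurable_qmul [measurable (raw)]:
  "f \<in> borel_measurable M \<Longrightarrow> g \<in> borel_measurable M \<Longrightarrow> (\<lambda>x. qmul (f x) (g x)) \<in> borel_measurable M"
  by (rule borel_measurable_continuous_Pair)
    (auto intro!: qmul.continuous_on continuous_intros)

lemma borel_measurable_qnsq [measurable (raw)]:
  "f \<in> borel_measurable M \<Longrightarrow> (\<lambda>x. qnsq (f x)) \<in> borel_measurable M"
proof -
  assume "f \<in> borel_measurable M"
  then have "(\<lambda>x. qre (qmul (qcnj (f x)) (f x))) \<in> borel_measurable M" by measurable
  then show ?thesis by simp
qed

section \<open>Matrices and the Cholesky decomposition\<close>

lemma matsI:
  "(\<And>i j. i < r \<Longrightarrow> j < c \<Longrightarrow> in_alg \<beta> (A i j)) \<Longrightarrow> (\<And>i j. \<not> (i < r \<and> j < c) \<Longrightarrow> A i j = 0) \<Longrightarrow> A \<in> mats \<beta> r c"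
  by (auto simp: mats_def)

lemma mats_in_alg [intro]: "A \<in> mats \<beta> r c \<Longrightarrow> in_alg \<beta> (A i j)"
  by (cases "i < r \<and> j < c") (auto simp: mats_def)

lemma mats_zero: "A \<in> mats \<beta> r c \<Longrightarrow> \<not> (i < r \<and> j < c) \<Longrightarrow> A i j = 0"
  by (auto simp: mats_def)

lemma mats_eqI:
  "A \<in> mats \<beta> r c \<Longrightarrow> B \<in> mats \<beta> r c \<Longrightarrow> (\<And>i j. i < r \<Longrightarrow> j < c \<Longrightarrow> A i j = B i j) \<Longrightarrow> A = B"
  by (intro ext, metis mats_zero)

lemma mmul_mats:
  "\<beta> \<in> {1,2,4} \<Longrightarrow> A \<in> mats \<beta> r k \<Longrightarrow> B \<in> mats \<beta> k c \<Longrightarrow> mmul k A B \<in> mats \<beta> r c"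
  unfolding mmul_def
  by (rule matsI) (auto intro!: in_alg_sum in_alg_qmul sum.neutral simp: mats_zero qmul.zero_left qmul.zero_right)

lemma ctr_mats: "A \<in> mats \<beta> r c \<Longrightarrow> ctr A \<in> mats \<beta> c r"
  unfolding ctr_def by (rule matsI) (auto intro!: in_alg_qcnj simp: mats_zero qcnj_linear)

lemma madd_mats: "A \<in> mats \<beta> r c \<Longrightarrow> B \<in> mats \<beta> r c \<Longrightarrow> madd A B \<in> mats \<beta> r c"
  unfolding madd_def by (rule matsI) (auto intro!: in_alg_add simp: mats_zero)

lemma msub_mats: "A \<in> mats \<beta> r c \<Longrightarrow> B \<in> mats \<beta> r c \<Longrightarrow> msub A B \<in> mats \<beta> r c"
  unfolding msub_def by (rule matsI) (auto intro!: in_alg_diff simp: mats_zero)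

lemma idm_mats: "idm m \<in> mats \<beta> m m"
  unfolding idm_def by (rule matsI) auto

lemma mmul_assoc: "mmul k (mmul l A B) C = mmul l A (mmul k B C)"
  unfolding mmul_def
  by (intro ext) (simp add: qmul.sum_left qmul.sum_right qmul_assoc, rule sum.swap)

lemma mmul_idm_right: "A \<in> mats \<beta> r m \<Longrightarrow> mmul m A (idm m) = A"
  by (intro ext) (auto simp: mmul_def idm_def mats_zero if_distrib[of "qmul _"] qmul.zero_right cong: if_cong)

lemma mmul_idm_left: "A \<in> mats \<beta> m c \<Longrightarrow> mmul m (idm m) A = A"
proof (intro ext)
  fix i j assume "A \<in> mats \<beta> m c"
  then show "mmul m (idm m) A i j = A i j"
    by (cases "i < m")
      (auto simp: mmul_def idm_def mats_zero if_distrib[of "\<lambda>x. qmul x _"] qmul.zero_left cong: if_cong)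
qed

lemma ctr_ctr [simp]: "ctr (ctr A) = A"
  by (simp add: ctr_def)

lemma ctr_mmul: "ctr (mmul k A B) = mmul k (ctr B) (ctr A)"
  by (intro ext) (simp add: ctr_def mmul_def qcnj_linear qcnj_qmul)

lemma ctr_gram: "ctr (mmul k (ctr A) A) = mmul k (ctr A) A"
  by (simp add: ctr_mmul)

lemma ctr_idm [simp]: "ctr (idm m) = idm m"
  by (intro ext) (auto simp: ctr_def idm_def qcnj_linear)

lemma ctr_madd: "ctr (madd A B) = madd (ctr A) (ctr B)"
  by (intro ext) (simp add: ctr_def madd_def qcnj_linear)

lemma mmul_msub_left: "mmul k (msub A B) C = msub (mmul k A C) (mmul k B C)"
  by (intro ext) (simp add: mmul_def msub_def qmul.diff_left sum_subtractf)

lemma mmul_msub_right: "mmul k A (msub B C) = msub (mmul k A B) (mmul k A C)"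
  by (intro ext) (simp add: mmul_def msub_def qmul.diff_right sum_subtractf)

section \<open>Quadratic forms and positive definiteness\<close>

definition mvec :: "nat \<Rightarrow> qmat \<Rightarrow> (nat \<Rightarrow> quat) \<Rightarrow> nat \<Rightarrow> quat" where
  "mvec m A x = (\<lambda>i. \<Sum>j<m. qmul (A i j) (x j))"

definition qform :: "nat \<Rightarrow> qmat \<Rightarrow> (nat \<Rightarrow> quat) \<Rightarrow> real" where
  "qform m A x = qre (\<Sum>i<m. \<Sum>j<m. qmul (qcnj (x i)) (qmul (A i j) (x j)))"

lemma pd_qform: "pd \<beta> m A \<longleftrightarrow> A \<in> mats \<beta> m m \<and> ctr A = A \<and>
     (\<forall>x. (\<forall>i<m. in_alg \<beta> (x i)) \<and> (\<exists>i<m. x i \<noteq> 0) \<longrightarrow> qform m A x > 0)"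
  by (simp add: pd_def qform_def)

lemma mvec_mmul: "mvec m (mmul k A B) x = mvec k A (mvec m B x)"
  unfolding mvec_def mmul_def
  by (intro ext) (simp add: qmul.sum_left qmul.sum_right qmul_assoc, rule sum.swap)

lemma mvec_idm: "i < m \<Longrightarrow> mvec m (idm m) x i = x i"
  by (simp add: mvec_def idm_def if_distrib[of "\<lambda>x. qmul x _"] qmul.zero_left cong: if_cong)

lemma qform_madd: "qform m (madd A B) x = qform m A x + qform m B x"
  by (simp add: qform_def madd_def qmul.add_left qmul.add_right sum.distrib qre_linear)

text \<open>Moving \<open>B\<close> to the other side by conjugation turns the form into the squared
  length of \<open>B x\<close>; the changes of summation order collect the terms that belong to one
  row \<open>l\<close>.\<close>

lemma qform_gram: "qform m (mmul k (ctr B) B) x = (\<Sum>l<k. qnsq (mvec m B x l))"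
proof -
  have "(\<Sum>i<m. \<Sum>j<m. qmul (qcnj (x i)) (qmul (mmul k (ctr B) B i j) (x j)))
      = (\<Sum>i<m. \<Sum>j<m. \<Sum>l<k. qmul (qcnj (qmul (B l i) (x i))) (qmul (B l j) (x j)))"
    by (simp add: mmul_def ctr_def qmul.sum_left qmul.sum_right qmul_assoc qcnj_qmul)
  also have "\<dots> = (\<Sum>i<m. \<Sum>l<k. \<Sum>j<m. qmul (qcnj (qmul (B l i) (x i))) (qmul (B l j) (x j)))"
    by (intro sum.cong refl sum.swap)
  also have "\<dots> = (\<Sum>l<k. \<Sum>i<m. \<Sum>j<m. qmul (qcnj (qmul (B l i) (x i))) (qmul (B l j) (x j)))"
    by (rule sum.swap)
  also have "\<dots> = (\<Sum>l<k. qmul (qcnj (mvec m B x l)) (mvec m B x l))"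
    by (simp add: mvec_def qmul.sum_left qmul.sum_right qcnj_linear) (intro sum.cong refl sum.swap)
  finally show ?thesis
    by (simp add: qform_def qre_linear)
qed

lemma pd_add_gram:
  assumes "\<beta> \<in> {1,2,4}" "pd \<beta> m V" "X \<in> mats \<beta> n m"
  shows "pd \<beta> m (madd V (mmul n (ctr X) X))"
proof -
  have "mmul n (ctr X) X \<in> mats \<beta> m m"
    using assms by (intro mmul_mats ctr_mats) auto
  moreover have "0 \<le> qform m (mmul n (ctr X) X) x" for x
    unfolding qform_gram by (rule sum_nonneg) simp
  ultimately show ?thesis
    using assms(2) unfolding pd_qform
    by (auto simp: madd_mats ctr_madd ctr_gram qform_madd intro!: add_pos_nonneg)
qed

text \<open>A sum of squared norms is positive as soon as one term is nonzero, so definiteness of a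
  Gram matrix becomes triviality of a kernel. This serves triangular factors, whose kernel is
  trivial by inversion, and rectangular matrices, whose kernel is trivial almost everywhere.\<close>

lemma pd_gram_iff:
  assumes "\<beta> \<in> {1,2,4}" "B \<in> mats \<beta> n m"
  shows "pd \<beta> m (mmul n (ctr B) B) \<longleftrightarrow>
    (\<forall>x. (\<forall>i<m. in_alg \<beta> (x i)) \<and> (\<forall>l<n. mvec m B x l = 0) \<longrightarrow> (\<forall>i<m. x i = 0))"
proof -
  have "0 < (\<Sum>l<n. qnsq (mvec m B x l)) \<longleftrightarrow> \<not> (\<forall>l<n. mvec m B x l = 0)" for x
    by (subst less_le) (auto simp: sum_nonneg_eq_0_iff sum_nonneg)
  moreover have "mmul n (ctr B) B \<in> mats \<beta> m m"
    using assms by (intro mmul_mats ctr_mats) auto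
  ultimately show ?thesis
    unfolding pd_qform qform_gram ctr_gram by blast
qed

section \<open>Triangular matrices, their inverses and Cholesky elimination\<close>

definition dg :: "qmat \<Rightarrow> nat \<Rightarrow> real" where
  "dg T i = qre (T i i)"

lemma upper_posD:
  assumes "upper_pos \<beta> m T"
  shows "T \<in> mats \<beta> m m" "j < i \<Longrightarrow> T i j = 0" "i < m \<Longrightarrow> T i i = qof_real (dg T i)" "i < m \<Longrightarrow> 0 < dg T i"
  using assms by (auto simp: upper_pos_def dg_def)

lemma upper_posI:
  assumes "T \<in> mats \<beta> m m" "\<And>i j. j < i \<Longrightarrow> T i j = 0" "\<And>i. i < m \<Longrightarrow> T i i = qof_real (d i)" "\<And>i. i < m \<Longrightarrow> 0 < d i"
  shows "upper_pos \<beta> m T"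
  using assms by (auto simp: upper_pos_def)

text \<open>On the diagonal only the term \<open>l = i\<close> survives, and it is a product of two
  reals. The second claim is the source of the multiplicativity of the power functions in spite of
  noncommuting entries.\<close>

lemma upper_pos_mmul:
  assumes "\<beta> \<in> {1,2,4}" "upper_pos \<beta> m S" "upper_pos \<beta> m T"
  shows "upper_pos \<beta> m (mmul m S T)" "i < m \<Longrightarrow> dg (mmul m S T) i = dg S i * dg T i"
proof -
  note S = upper_posD[OF assms(2)] and T = upper_posD[OF assms(3)]
  have diag: "mmul m S T i i = qof_real (dg S i * dg T i)" if "i < m" for i
  proof -
    have "mmul m S T i i = (\<Sum>l<m. if l = i then qof_real (dg S i * dg T i) else 0)"
      unfolding mmul_def
    proof (rule sum.cong[OF refl])
      fix l
      consider "l < i" | "l = i" | "i < l" by linarith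
      then show "qmul (S i l) (T l i) = (if l = i then qof_real (dg S i * dg T i) else 0)"
        using that S(2)[of l i] T(2)[of i l] S(3)[of i] T(3)[of i]
        by cases (auto simp: qmul.zero_left qmul.zero_right mult.commute)
    qed
    with that show ?thesis by simp
  qed
  show "upper_pos \<beta> m (mmul m S T)"
  proof (rule upper_posI[where d = "\<lambda>i. dg S i * dg T i"])
    fix i j :: nat assume "j < i"
    then show "mmul m S T i j = 0"
      unfolding mmul_def
      by (intro sum.neutral ballI) (metis S(2) T(2) linorder_not_less order_less_le_trans qmul.zero_left qmul.zero_right)
  qed (use assms S T diag in \<open>auto intro: mmul_mats\<close>)
  show "dg (mmul m S T) i = dg S i * dg T i" if "i < m"
    unfolding dg_def[of "mmul m S T"] diag[OF that] by simp
qed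

text \<open>Forward substitution for the row equation \<open>x T = y\<close>: column
  \<open>j\<close> involves only \<open>x l\<close> with \<open>l \<le> j\<close>, and the real
  diagonal entry is divided out as a scalar. The explicit recursion later gives measurability in
  \<open>T\<close> and \<open>y\<close>.\<close>

function rsolve :: "qmat \<Rightarrow> (nat \<Rightarrow> quat) \<Rightarrow> nat \<Rightarrow> quat" where
  "rsolve T y j = (1 / dg T j) *\<^sub>R (y j - (\<Sum>l<j. qmul (rsolve T y l) (T l j)))"
  by auto
termination by (relation "Wellfounded.measure (\<lambda>(T, y, j). j)") auto

declare rsolve.simps [simp del]

definition mrsolve :: "nat \<Rightarrow> nat \<Rightarrow> qmat \<Rightarrow> qmat \<Rightarrow> qmat" where
  "mrsolve n m X T = (\<lambda>i j. if i < n \<and> j < m then rsolve T (X i) j else 0)"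

lemma in_alg_rsolve:
  assumes "\<beta> \<in> {1,2,4}" "T \<in> mats \<beta> m m" "\<And>j. in_alg \<beta> (y j)"
  shows "in_alg \<beta> (rsolve T y j)"
proof (induction j rule: less_induct)
  case (less j)
  show ?case
    unfolding rsolve.simps[of T y j] using assms less
    by (intro in_alg_scaleR in_alg_diff in_alg_sum in_alg_qmul) auto
qed

lemma mrsolve_mats:
  "\<beta> \<in> {1,2,4} \<Longrightarrow> T \<in> mats \<beta> m m \<Longrightarrow> X \<in> mats \<beta> n m \<Longrightarrow> mrsolve n m X T \<in> mats \<beta> n m"
  unfolding mrsolve_def by (rule matsI) (auto intro!: in_alg_rsolve)

lemma sum_upper_split:
  fixes f :: "nat \<Rightarrow> quat"
  assumes "j < m" "\<And>l. j < l \<Longrightarrow> f l = 0"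
  shows "(\<Sum>l<m. f l) = (\<Sum>l<j. f l) + f j"
proof -
  have "(\<Sum>l<m. f l) = (\<Sum>l<Suc j. f l)"
    by (rule sum.mono_neutral_right) (use assms in auto)
  then show ?thesis by simp
qed

lemma mmul_upper_nth:
  assumes "upper_pos \<beta> m T" "j < m"
  shows "mmul m R T i j = (\<Sum>l<j. qmul (R i l) (T l j)) + dg T j *\<^sub>R R i j"
  unfolding mmul_def
  by (subst sum_upper_split[OF assms(2)]) (auto simp: upper_posD[OF assms(1)] assms qmul.zero_right)

lemma mmul_mrsolve:
  assumes "\<beta> \<in> {1,2,4}" "upper_pos \<beta> m T" "X \<in> mats \<beta> n m"
  shows "mmul m (mrsolve n m X T) T = X"
proof (rule mats_eqI[of _ \<beta> n m])
  show "mmul m (mrsolve n m X T) T \<in> mats \<beta> n m"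
    using assms by (intro mmul_mats mrsolve_mats) (auto dest: upper_posD)
  fix i j assume ij: "i < n" "j < m"
  have "dg T j *\<^sub>R rsolve T (X i) j = X i j - (\<Sum>l<j. qmul (rsolve T (X i) l) (T l j))"
    using upper_posD(4)[OF assms(2) ij(2)] by (subst rsolve.simps) simp
  then show "mmul m (mrsolve n m X T) T i j = X i j"
    using ij by (simp add: mmul_upper_nth[OF assms(2)] mrsolve_def)
qed fact

text \<open>Solving against the rows of the identity gives a left inverse directly; it replaces
  \<open>minv\<close> on triangular matrices.\<close>

definition uinv :: "nat \<Rightarrow> qmat \<Rightarrow> qmat" where
  "uinv m T = mrsolve m m (idm m) T"

lemma upper_pos_uinv:
  assumes "\<beta> \<in> {1,2,4}" "upper_pos \<beta> m T"
  shows "upper_pos \<beta> m (uinv m T)"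
proof -
  have lower: "rsolve T (idm m i) j = 0" if "j < i" for i j
    using that
  proof (induction j rule: less_induct)
    case (less j)
    then show ?case
      by (subst rsolve.simps) (auto simp: idm_def qmul.zero_left)
  qed
  have diag: "rsolve T (idm m i) i = qof_real (1 / dg T i)" if "i < m" for i
  proof -
    have "(\<Sum>l<i. qmul (rsolve T (idm m i) l) (T l i)) = 0"
      by (rule sum.neutral) (simp add: lower qmul.zero_left)
    moreover have "idm m i i = qof_real 1" using that by (simp add: idm_def)
    ultimately show ?thesis by (subst rsolve.simps) simp
  qed
  show ?thesis
    by (rule upper_posI[where d = "\<lambda>i. 1 / dg T i"])
      (use assms lower diag upper_posD[OF assms(2)] in \<open>auto simp: uinv_def idm_mats intro!: mrsolve_mats\<close>,
        auto simp: mrsolve_def)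
qed

lemma uinv_left:
  assumes "\<beta> \<in> {1,2,4}" "upper_pos \<beta> m T"
  shows "mmul m (uinv m T) T = idm m"
  unfolding uinv_def by (rule mmul_mrsolve[OF assms idm_mats])

text \<open>The left inverse \<open>?S\<close> is again upper triangular with positive diagonal,
  hence has a left inverse \<open>?R\<close> of its own; associativity forces
  \<open>?R = T\<close>.\<close>

lemma uinv_right:
  assumes "\<beta> \<in> {1,2,4}" "upper_pos \<beta> m T"
  shows "mmul m T (uinv m T) = idm m"
proof -
  let ?S = "uinv m T" let ?R = "uinv m (uinv m T)"
  note S = upper_pos_uinv[OF assms] and R = upper_pos_uinv[OF assms(1) upper_pos_uinv[OF assms]]
  have "?R = mmul m ?R (mmul m ?S T)"
    using mmul_idm_right[OF upper_posD(1)[OF R]] uinv_left[OF assms] by simp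
  also have "\<dots> = T"
    using mmul_idm_left[OF upper_posD(1)[OF assms(2)]] uinv_left[OF assms(1) S]
    by (simp flip: mmul_assoc)
  finally show ?thesis using uinv_left[OF assms(1) S] by simp
qed

lemma minv_upper:
  assumes "\<beta> \<in> {1,2,4}" "upper_pos \<beta> m T"
  shows "minv \<beta> m T = uinv m T"
  unfolding minv_def
proof (rule the_equality)
  show "uinv m T \<in> mats \<beta> m m \<and> mmul m T (uinv m T) = idm m \<and> mmul m (uinv m T) T = idm m"
    using uinv_left[OF assms] uinv_right[OF assms] upper_posD(1)[OF upper_pos_uinv[OF assms]] by simp
next
  fix B assume B: "B \<in> mats \<beta> m m \<and> mmul m T B = idm m \<and> mmul m B T = idm m"
  have "B = mmul m (mmul m (uinv m T) T) B"
    using B uinv_left[OF assms] mmul_idm_left[of B \<beta> m m] by simp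
  also have "\<dots> = uinv m T"
    using B mmul_idm_right[OF upper_posD(1)[OF upper_pos_uinv[OF assms]]] by (simp add: mmul_assoc)
  finally show "B = uinv m T" .
qed

lemma mmul_uinv_cancel:
  assumes "\<beta> \<in> {1,2,4}" "upper_pos \<beta> m T" "X \<in> mats \<beta> n m"
  shows "mmul m (mmul m X T) (uinv m T) = X" "mmul m (mmul m X (uinv m T)) T = X"
  using mmul_idm_right[OF assms(3)] by (simp_all add: mmul_assoc uinv_left[OF assms(1,2)] uinv_right[OF assms(1,2)])

lemma pd_upper:
  assumes "\<beta> \<in> {1,2,4}" "upper_pos \<beta> m T"
  shows "pd \<beta> m (mmul m (ctr T) T)"
proof (subst pd_gram_iff[OF assms(1) upper_posD(1)[OF assms(2)]], safe)
  fix x i assume x: "\<forall>l<m. mvec m T x l = 0" and i: "i < m"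
  have "x i = mvec m (mmul m (uinv m T) T) x i"
    using i by (simp add: uinv_left[OF assms] mvec_idm)
  also have "\<dots> = 0"
    using x by (simp add: mvec_mmul) (simp add: mvec_def qmul.zero_right)
  finally show "x i = 0" .
qed

text \<open>Row \<open>i\<close> of the factor is row \<open>i\<close> of the Schur complement left
  after \<open>i\<close> elimination steps (the local \<open>s\<close>), divided by the root of its
  diagonal entry. The recursion is total: for matrices that are not positive definite its values
  carry no meaning but still depend measurably on \<open>A\<close>.\<close>

function cfac :: "qmat \<Rightarrow> nat \<Rightarrow> nat \<Rightarrow> quat" where
  "cfac A i j =
    (let s = (\<lambda>j. A i j - (\<Sum>k<i. qmul (qcnj (cfac A k i)) (cfac A k j))); d = sqrt (qre (s i))
     in if j < i then 0 else if j = i then qof_real d else (1 / d) *\<^sub>R s j)"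
  by auto
termination by (relation "Wellfounded.measure (\<lambda>(A, i, j). i)") auto

declare cfac.simps [simp del]

text \<open>The diagonal entry of the Schur complement after eliminating the first \<open>i\<close>
  rows; for \<open>A = T* T\<close> with triangular \<open>T\<close> it is the square of the
  diagonal entry of \<open>T\<close>.\<close>

definition pivot :: "qmat \<Rightarrow> nat \<Rightarrow> real" where
  "pivot A i = qre (A i i - (\<Sum>k<i. qmul (qcnj (cfac A k i)) (cfac A k i)))"

lemma pivot_eq: "pivot A i = qre (A i i) - (\<Sum>k<i. qnsq (cfac A k i))"
  by (simp add: pivot_def qre_linear)

lemma cfac_lower: "j < i \<Longrightarrow> cfac A i j = 0"
  by (subst cfac.simps) simp

lemma cfac_diag: "cfac A i i = qof_real (sqrt (pivot A i))"
  by (subst cfac.simps) (simp add: pivot_def)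

lemma cfac_upper: "i < j \<Longrightarrow>
    cfac A i j = (1 / sqrt (pivot A i)) *\<^sub>R (A i j - (\<Sum>k<i. qmul (qcnj (cfac A k i)) (cfac A k j)))"
  by (subst cfac.simps) (simp add: pivot_def)

text \<open>The size \<open>m\<close> is independent of the size of \<open>A\<close>, so the same
  recursion also factors leading blocks; \<open>pd_imp_pivot\<close> uses it with size
  \<open>i\<close>.\<close>

definition cholf :: "nat \<Rightarrow> qmat \<Rightarrow> qmat" where
  "cholf m A = (\<lambda>i j. if i < m \<and> j < m then cfac A i j else 0)"

lemma in_alg_cfac:
  assumes "\<beta> \<in> {1,2,4}" "A \<in> mats \<beta> m m"
  shows "in_alg \<beta> (cfac A i j)"
proof (induction i arbitrary: j rule: less_induct)
  case (less i)
  consider "j < i" | "j = i" | "i < j" by linarith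
  then show ?case
  proof cases
    case 3
    then show ?thesis
      unfolding cfac_upper[OF 3] using assms less
      by (intro in_alg_scaleR in_alg_diff in_alg_sum in_alg_qmul in_alg_qcnj) auto
  qed (auto simp: cfac_lower cfac_diag)
qed

lemma cholf_mats:
  assumes "\<beta> \<in> {1,2,4}" "A \<in> mats \<beta> r r"
  shows "cholf m A \<in> mats \<beta> m m"
  unfolding cholf_def using in_alg_cfac[OF assms] by (intro matsI) auto

text \<open>For \<open>k \<le> j\<close> the terms after \<open>l = k\<close> vanish by
  triangularity, and the term \<open>l = k\<close> puts back the residual of \<open>A k j\<close>
  that was divided by the root of the pivot. The case \<open>j < k\<close> follows by conjugation.
  Only the pivots below \<open>i\<close> enter, which is what the induction in
  \<open>pd_imp_pivot\<close> has available.\<close>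

lemma cfac_gram:
  assumes herm: "ctr A = A" and piv: "\<And>l. l < i \<Longrightarrow> 0 < pivot A l" and kj: "k < i \<or> j < i"
  shows "(\<Sum>l<i. qmul (qcnj (cfac A l k)) (cfac A l j)) = A k j"
proof -
  have A: "qcnj (A a b) = A b a" for a b
    using fun_cong[OF fun_cong[OF herm], of b a] by (simp add: ctr_def)
  have real: "A a a = qof_real (qre (A a a))" for a
    using A[of a a] by (auto simp: quat_eq_iff qre_def)
  have *: "(\<Sum>l<i. qmul (qcnj (cfac A l k)) (cfac A l j)) = A k j" if "k < i" "k \<le> j" for k j
  proof -
    have "(\<Sum>l<i. qmul (qcnj (cfac A l k)) (cfac A l j))
        = (\<Sum>l<k. qmul (qcnj (cfac A l k)) (cfac A l j)) + sqrt (pivot A k) *\<^sub>R cfac A k j"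
      by (subst sum_upper_split[OF that(1)]) (auto simp: cfac_lower cfac_diag qcnj_linear qmul.zero_left)
    also have "\<dots> = A k j"
    proof (cases "k = j")
      case True
      then show ?thesis
        using piv[OF that(1)]
        by (subst (2) True [symmetric], subst real)
          (simp add: cfac_diag pivot_eq flip: qof_real_sum qof_real_add)
    next
      case False
      then have "k < j" using that by simp
      then show ?thesis
        using piv[OF that(1)] by (simp add: cfac_upper[of k j])
    qed
    finally show ?thesis .
  qed
  show ?thesis
  proof (cases "k \<le> j")
    case True
    with kj show ?thesis by (intro *) auto
  next
    case False
    have "(\<Sum>l<i. qmul (qcnj (cfac A l k)) (cfac A l j)) = qcnj (\<Sum>l<i. qmul (qcnj (cfac A l j)) (cfac A l k))"
      by (simp add: qcnj_linear qcnj_qmul)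
    also have "\<dots> = A k j"
      using False kj by (subst *) (auto simp: A)
    finally show ?thesis .
  qed
qed

lemma upper_pos_cholf:
  assumes "\<beta> \<in> {1,2,4}" "A \<in> mats \<beta> m m" and piv: "\<And>l. l < m \<Longrightarrow> 0 < pivot A l"
  shows "upper_pos \<beta> m (cholf m A)"
proof (rule upper_posI[where d = "\<lambda>i. sqrt (pivot A i)"])
  show "cholf m A \<in> mats \<beta> m m"
    by (rule cholf_mats[OF assms(1,2)])
qed (use piv in \<open>auto simp: cholf_def cfac_lower cfac_diag\<close>)

lemma cholf_gram:
  assumes "\<beta> \<in> {1,2,4}" "A \<in> mats \<beta> m m" "ctr A = A" and piv: "\<And>l. l < m \<Longrightarrow> 0 < pivot A l"
  shows "mmul m (ctr (cholf m A)) (cholf m A) = A"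
proof (rule mats_eqI[of _ \<beta> m m])
  show "mmul m (ctr (cholf m A)) (cholf m A) \<in> mats \<beta> m m"
    using assms by (intro mmul_mats ctr_mats upper_posD(1)[OF upper_pos_cholf]) auto
  fix i j assume ij: "i < m" "j < m"
  then show "mmul m (ctr (cholf m A)) (cholf m A) i j = A i j"
    using cfac_gram[OF assms(3) piv, of m i j] by (simp add: mmul_def ctr_def cholf_def)
qed fact

text \<open>Uniqueness of the factorization: once the earlier rows agree, what remains of row
  \<open>i\<close> of \<open>T* T\<close> is \<open>dg T i\<close> times row \<open>i\<close> of
  \<open>T\<close>. Its diagonal entry gives the pivot, and dividing by the positive root recovers
  the row.\<close>

lemma upper_pos_gram_cfac:
  assumes T: "upper_pos \<beta> m T" and i: "i < m"
  shows "T i j = cfac (mmul m (ctr T) T) i j \<and> pivot (mmul m (ctr T) T) i = (dg T i)\<^sup>2"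
  using i
proof (induction i arbitrary: j rule: less_induct)
  case (less i)
  let ?A = "mmul m (ctr T) T"
  note T' = upper_posD[OF T]
  have row: "?A i j - (\<Sum>k<i. qmul (qcnj (cfac ?A k i)) (cfac ?A k j)) = dg T i *\<^sub>R T i j" for j
  proof -
    have "?A i j = (\<Sum>k<i. qmul (qcnj (T k i)) (T k j)) + dg T i *\<^sub>R T i j"
      unfolding mmul_def ctr_def
      by (subst sum_upper_split[OF less.prems]) (use less.prems in \<open>auto simp: T' qcnj_linear qmul.zero_left\<close>)
    moreover have "(\<Sum>k<i. qmul (qcnj (T k i)) (T k j)) = (\<Sum>k<i. qmul (qcnj (cfac ?A k i)) (cfac ?A k j))"
    proof (rule sum.cong[OF refl])
      fix k assume "k \<in> {..<i}"
      then have "T k j = cfac ?A k j" for j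
        using less.IH[of k] less.prems by auto
      then show "qmul (qcnj (T k i)) (T k j) = qmul (qcnj (cfac ?A k i)) (cfac ?A k j)" by metis
    qed
    ultimately show ?thesis by simp
  qed
  have piv: "pivot ?A i = (dg T i)\<^sup>2"
    unfolding pivot_def row using T'(3)[OF less.prems] by (simp add: power2_eq_square)
  have pos: "0 < dg T i" using T'(4) less.prems .
  consider "j < i" | "j = i" | "i < j" by linarith
  then have "T i j = cfac ?A i j"
    by cases (use less.prems pos in \<open>auto simp: T'(2,3) cfac_lower cfac_diag cfac_upper[of i j] piv row\<close>)
  with piv show ?case by simp
qed

text \<open>The pivot is the value of the quadratic form at a test vector with 1 in position
  \<open>i\<close>, zeros after it, and earlier entries chosen so that the first \<open>i\<close>
  rows of the factor annihilate it.\<close>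

lemma pd_imp_pivot:
  assumes beta: "\<beta> \<in> {1,2,4}" and A: "pd \<beta> m A" and i: "i < m"
  shows "0 < pivot A i"
  using i
proof (induction i rule: less_induct)
  case (less i)
  have Am: "A \<in> mats \<beta> m m" and herm: "ctr A = A" using A by (auto simp: pd_def)
  have piv: "0 < pivot A l" if "l < i" for l using less that by simp
  define T where "T = cholf i A"
  define E where "E = (\<lambda>k j. \<Sum>l<i. qmul (qcnj (cfac A l k)) (cfac A l j))"
  have T: "upper_pos \<beta> i T"
    unfolding T_def
    by (rule upper_posI[where d = "\<lambda>i. sqrt (pivot A i)"])
      (use piv cholf_mats[OF beta Am, of i] in \<open>auto simp: cholf_def cfac_lower cfac_diag\<close>)
  \<comment> \<open>Solves \<open>T y = - c\<close>, where \<open>c\<close> is the part of column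
    \<open>i\<close> of the factor lying in the rows before \<open>i\<close>.\<close>
  define y where "y = mvec i (uinv i T) (\<lambda>l. - cfac A l i)"
  define x where "x = (\<lambda>k. if k < i then y k else if k = i then qof_real 1 else 0)"
  have alg_y: "in_alg \<beta> (y k)" for k
    unfolding y_def mvec_def using beta upper_posD(1)[OF upper_pos_uinv[OF beta T]] in_alg_cfac[OF beta Am]
    by (intro in_alg_sum in_alg_qmul in_alg_minus) auto
  have Ty: "(\<Sum>j<i. qmul (cfac A l j) (y j)) = - cfac A l i" if "l < i" for l
  proof -
    have "(\<Sum>j<i. qmul (cfac A l j) (y j)) = mvec i T y l"
      unfolding mvec_def T_def cholf_def using that by simp
    also have "\<dots> = mvec i (mmul i T (uinv i T)) (\<lambda>l. - cfac A l i) l"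
      by (simp add: y_def mvec_mmul)
    also have "\<dots> = - cfac A l i"
      using that by (simp add: uinv_right[OF beta T] mvec_idm)
    finally show ?thesis .
  qed
  have Cx: "mvec m (cfac A) x l = 0" if "l < i" for l
  proof -
    have "mvec m (cfac A) x l = (\<Sum>j<i. qmul (cfac A l j) (x j)) + qmul (cfac A l i) (x i)"
      unfolding mvec_def using less.prems by (intro sum_upper_split) (auto simp: x_def qmul.zero_right)
    then show ?thesis using Ty[OF that] by (simp add: x_def)
  qed
  have E_eq: "E k j = A k j" if "k < i \<or> j < i" for k j
    unfolding E_def by (rule cfac_gram[OF herm piv that])
  \<comment> \<open>The form of the Gram part \<open>E\<close> vanishes at \<open>x\<close>. The
    remainder \<open>A - E\<close> is zero wherever an index below \<open>i\<close> occurs, so on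
    the support of \<open>x\<close> only its entry \<open>(i, i)\<close> is left, and its real part
    is the pivot.\<close>
  have "qform m A x = qform m (madd (msub A E) E) x"
    by (simp add: madd_def msub_def)
  also have "\<dots> = qform m (msub A E) x + qform m E x"
    by (rule qform_madd)
  also have "qform m E x = 0"
  proof -
    have "E = mmul i (ctr (cfac A)) (cfac A)"
      by (intro ext) (simp add: E_def mmul_def ctr_def)
    then show ?thesis by (simp add: qform_gram Cx)
  qed
  also have "qform m (msub A E) x = pivot A i"
  proof -
    have entry: "qmul (qcnj (x k)) (qmul (msub A E k j) (x j))
        = (if j = i then if k = i then A i i - E i i else 0 else 0)" for k j
      using E_eq[of k j]
      by (cases "k < i \<or> j < i")
        (auto simp: msub_def x_def qmul.zero_left qmul.zero_right qcnj_linear)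
    show ?thesis
      unfolding qform_def entry using less.prems by (simp add: pivot_def E_def)
  qed
  finally have "qform m A x = pivot A i" by simp
  moreover have "0 < qform m A x"
  proof -
    have "\<forall>k<m. in_alg \<beta> (x k)" "x i \<noteq> 0" using alg_y by (auto simp: x_def)
    then show ?thesis using A less.prems unfolding pd_qform by blast
  qed
  ultimately show ?case by simp
qed

lemma pd_iff_pivot:
  assumes "\<beta> \<in> {1,2,4}"
  shows "pd \<beta> m A \<longleftrightarrow> A \<in> mats \<beta> m m \<and> ctr A = A \<and> (\<forall>i<m. 0 < pivot A i)"
proof
  assume "pd \<beta> m A" then show "A \<in> mats \<beta> m m \<and> ctr A = A \<and> (\<forall>i<m. 0 < pivot A i)"
    using pd_imp_pivot[OF assms] by (auto simp: pd_def)
next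
  assume A: "A \<in> mats \<beta> m m \<and> ctr A = A \<and> (\<forall>i<m. 0 < pivot A i)"
  then have "upper_pos \<beta> m (cholf m A)" "mmul m (ctr (cholf m A)) (cholf m A) = A"
    using upper_pos_cholf[OF assms] cholf_gram[OF assms] by auto
  then show "pd \<beta> m A" using pd_upper[OF assms] by metis
qed

lemma chol_gram:
  assumes "upper_pos \<beta> m T"
  shows "chol \<beta> m (mmul m (ctr T) T) = T"
  unfolding chol_def
proof (rule the_equality)
  fix S assume S: "upper_pos \<beta> m S \<and> mmul m (ctr S) S = mmul m (ctr T) T"
  show "S = T"
    by (rule mats_eqI[of _ \<beta> m m])
      (use S assms upper_pos_gram_cfac[of \<beta> m S] upper_pos_gram_cfac[of \<beta> m T] in \<open>auto dest: upper_posD\<close>)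
qed (use assms in simp)

lemma chol_pd:
  assumes "\<beta> \<in> {1,2,4}" "pd \<beta> m A"
  shows "upper_pos \<beta> m (chol \<beta> m A)" "mmul m (ctr (chol \<beta> m A)) (chol \<beta> m A) = A" "chol \<beta> m A = cholf m A"
proof -
  have *: "upper_pos \<beta> m (cholf m A)" "mmul m (ctr (cholf m A)) (cholf m A) = A"
    using assms upper_pos_cholf[OF assms(1)] cholf_gram[OF assms(1)] by (auto simp: pd_iff_pivot)
  show "chol \<beta> m A = cholf m A" using chol_gram[OF *(1)] *(2) by simp
  with * show "upper_pos \<beta> m (chol \<beta> m A)" "mmul m (ctr (chol \<beta> m A)) (chol \<beta> m A) = A" by auto
qed

text \<open>When no factor exists, the definite description is one and the same unspecified matrix
  for all arguments. This constant value is what makes \<open>chol\<close> measurable by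
  cases.\<close>

lemma chol_not_pd:
  assumes "\<beta> \<in> {1,2,4}" "\<not> pd \<beta> m A"
  shows "chol \<beta> m A = (THE T. False)"
proof -
  have "(upper_pos \<beta> m T \<and> mmul m (ctr T) T = A) = False" for T
    using pd_upper[OF assms(1), of m T] assms(2) by auto
  then show ?thesis unfolding chol_def by (simp only:)
qed

text \<open>If \<open>D = T* T\<close>, the congruence is the Gram matrix of \<open>T L\<close>,
  again triangular with positive diagonal; uniqueness of the Cholesky factor identifies it.\<close>

lemma pd_congruence:
  assumes beta: "\<beta> \<in> {1,2,4}" and L: "upper_pos \<beta> m L" and D: "pd \<beta> m D"
  shows "pd \<beta> m (mmul m (ctr L) (mmul m D L))"
    "chol \<beta> m (mmul m (ctr L) (mmul m D L)) = mmul m (chol \<beta> m D) L"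
proof -
  let ?T = "chol \<beta> m D"
  have TL: "upper_pos \<beta> m (mmul m ?T L)"
    by (rule upper_pos_mmul[OF beta chol_pd(1)[OF beta D] L])
  have "mmul m (ctr L) (mmul m D L) = mmul m (ctr L) (mmul m (mmul m (ctr ?T) ?T) L)"
    using chol_pd(2)[OF beta D] by simp
  also have "\<dots> = mmul m (ctr (mmul m ?T L)) (mmul m ?T L)"
    by (simp add: ctr_mmul mmul_assoc)
  finally have *: "mmul m (ctr L) (mmul m D L) = mmul m (ctr (mmul m ?T L)) (mmul m ?T L)" .
  show "pd \<beta> m (mmul m (ctr L) (mmul m D L))"
    unfolding * by (rule pd_upper[OF beta TL])
  show "chol \<beta> m (mmul m (ctr L) (mmul m D L)) = mmul m ?T L"
    unfolding * by (rule chol_gram[OF TL])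
qed

text \<open>The converse direction undoes the congruence with the inverse of
  \<open>L\<close>.\<close>

lemma pd_congruence_iff:
  assumes beta: "\<beta> \<in> {1,2,4}" and L: "upper_pos \<beta> m L" and D: "D \<in> mats \<beta> m m"
  shows "pd \<beta> m (mmul m (ctr L) (mmul m D L)) \<longleftrightarrow> pd \<beta> m D"
proof
  let ?K = "uinv m L"
  assume "pd \<beta> m (mmul m (ctr L) (mmul m D L))"
  then have "pd \<beta> m (mmul m (ctr ?K) (mmul m (mmul m (ctr L) (mmul m D L)) ?K))"
    by (rule pd_congruence(1)[OF beta upper_pos_uinv[OF beta L]])
  also have "mmul m (ctr ?K) (mmul m (mmul m (ctr L) (mmul m D L)) ?K)
      = mmul m (mmul m (ctr ?K) (ctr L)) (mmul m D (mmul m L ?K))"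
    by (simp add: mmul_assoc)
  also have "mmul m (ctr ?K) (ctr L) = idm m"
    using uinv_right[OF beta L] by (simp flip: ctr_mmul)
  also have "mmul m L ?K = idm m" by (rule uinv_right[OF beta L])
  finally show "pd \<beta> m D"
    by (simp add: mmul_idm_right[OF D] mmul_idm_left[OF D])
qed (rule pd_congruence(1)[OF beta L])

section \<open>Triangular affine substitutions\<close>

text \<open>Points of a product over \<open>I\<close> are \<open>undefined\<close> outside
  \<open>I\<close>, so the remaining coordinates are constant. The decoding maps can therefore be
  shown measurable once, on the product over all indices.\<close>

lemma measurable_PiM_UNIV:
  "(\<lambda>x. x) \<in> (\<Pi>\<^sub>M i\<in>I. (lborel :: real measure)) \<rightarrow>\<^sub>M (\<Pi>\<^sub>M i\<in>UNIV. borel)"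
proof (rule measurable_PiM_single')
  fix i
  show "(\<lambda>x. x i) \<in> borel_measurable (\<Pi>\<^sub>M i\<in>I. (lborel :: real measure))"
  proof (cases "i \<in> I")
    case True
    then show ?thesis using measurable_component_singleton[of i I "\<lambda>_. lborel :: real measure"] by simp
  next
    case False
    then have "x i = undefined" if "x \<in> space (\<Pi>\<^sub>M i\<in>I. (lborel :: real measure))" for x
      using that by (auto simp: space_PiM PiE_def extensional_def)
    then show ?thesis
      by (subst measurable_cong[where g = "\<lambda>_. undefined"]) auto
  qed
qed simp

lemmas measurable_PiM_UNIV_compose = measurable_compose[OF measurable_PiM_UNIV]

text \<open>\<open>K\<close> vanishes outside the image of \<open>D\<close>, so the indicator
  changes nothing. It records the admissible range, such as positivity of a diagonal entry, on which
  the scales of later coordinates rely.\<close>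

lemma nn_integral_affine_image:
  fixes K :: "real \<Rightarrow> ennreal"
  assumes K: "K \<in> borel_measurable borel" and a: "0 < a"
    and img: "\<And>v. K v \<noteq> 0 \<Longrightarrow> \<exists>t\<in>D. v = a * t + b"
  shows "(\<integral>\<^sup>+v. K v \<partial>lborel) = (\<integral>\<^sup>+t. (ennreal a * indicator D t) * K (a * t + b) \<partial>lborel)"
proof -
  have "(\<integral>\<^sup>+v. K v \<partial>lborel) = ennreal a * (\<integral>\<^sup>+t. K (b + a * t) \<partial>lborel)"
    using nn_integral_real_affine[OF K, of a b] a by simp
  also have "\<dots> = (\<integral>\<^sup>+t. ennreal a * K (b + a * t) \<partial>lborel)"
    by (rule nn_integral_cmult[symmetric]) (use K in measurable)
  also have "\<dots> = (\<integral>\<^sup>+t. (ennreal a * indicator D t) * K (a * t + b) \<partial>lborel)"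
  proof (rule nn_integral_cong)
    fix t
    show "ennreal a * K (b + a * t) = (ennreal a * indicator D t) * K (a * t + b)"
    proof (cases "K (b + a * t) = 0")
      case False
      from img[OF this] a have "t \<in> D" by auto
      then show ?thesis by (simp add: add.commute)
    qed (simp add: add.commute)
  qed
  finally show ?thesis .
qed

text \<open>The coordinates are substituted one at a time in the order of increasing rank, so only
  one-dimensional affine substitutions and Tonelli's theorem are needed.\<close>

lemma nn_integral_triangular_affine:
  fixes s c :: "'i \<Rightarrow> ('i \<Rightarrow> real) \<Rightarrow> real" and rk :: "'i \<Rightarrow> nat" and F :: "('i \<Rightarrow> real) \<Rightarrow> ennreal"
  assumes "finite I"
    and "\<And>i. i \<in> I \<Longrightarrow> s i \<in> borel_measurable (\<Pi>\<^sub>M i\<in>UNIV. borel)"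
    and "\<And>i. i \<in> I \<Longrightarrow> c i \<in> borel_measurable (\<Pi>\<^sub>M i\<in>UNIV. borel)"
    and "\<And>i. i \<in> I \<Longrightarrow> D i \<in> sets borel"
    and "\<And>i x x'. i \<in> I \<Longrightarrow> (\<And>k. k \<in> I \<Longrightarrow> rk k < rk i \<Longrightarrow> x k = x' k) \<Longrightarrow> s i x = s i x' \<and> c i x = c i x'"
    and "\<And>i x. i \<in> I \<Longrightarrow> (\<And>k. k \<in> I \<Longrightarrow> rk k < rk i \<Longrightarrow> x k \<in> D k) \<Longrightarrow> 0 < s i x"
    and "F \<in> borel_measurable (\<Pi>\<^sub>M i\<in>UNIV. borel)"
    and "\<And>y. F y \<noteq> 0 \<Longrightarrow> \<exists>x. \<forall>i\<in>I. x i \<in> D i \<and> y i = s i x * x i + c i x"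
  shows "(\<integral>\<^sup>+y. F y \<partial>(\<Pi>\<^sub>M i\<in>I. lborel)) =
    (\<integral>\<^sup>+x. F (\<lambda>i. if i \<in> I then s i x * x i + c i x else undefined)
          * (\<Prod>i\<in>I. ennreal (s i x) * indicator (D i) (x i)) \<partial>(\<Pi>\<^sub>M i\<in>I. lborel))"
  using assms
proof (induction "card I" arbitrary: I s c F rule: less_induct)
  case less
  note fin = less.prems(1) and s_meas = less.prems(2) and c_meas = less.prems(3)
    and D_meas = less.prems(4) and dep = less.prems(5) and pos = less.prems(6)
    and F_meas = less.prems(7) and img = less.prems(8)
  interpret product_sigma_finite "\<lambda>_::'i. lborel :: real measure" ..
  show ?case
  proof (cases "I = {}")
    case True
    show ?thesis unfolding True PiM_empty by (simp add: nn_integral_count_space_finite)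
  next
    case False
    \<comment> \<open>A coordinate of least rank depends on no other one, so its scale and shift are
      constants \<open>a\<close> and \<open>b\<close>; it is integrated outermost.\<close>
    define i where "i = arg_min_on rk I"
    have i: "i \<in> I" and min: "\<And>k. k \<in> I \<Longrightarrow> \<not> rk k < rk i"
      using arg_min_if_finite[OF fin False, of rk] by (auto simp: i_def)
    define J where "J = I - {i}"
    have I: "I = insert i J" "i \<notin> J" "finite J" using i fin by (auto simp: J_def)
    obtain a b where ab: "\<And>x. s i x = a" "\<And>x. c i x = b"
      using dep[OF i] min by metis
    have a: "0 < a" using pos[OF i] min ab by metis
    let ?N = "\<Pi>\<^sub>M i\<in>UNIV :: 'i set. (borel :: real measure)"
    let ?P = "\<lambda>I::'i set. \<Pi>\<^sub>M i\<in>I. (lborel :: real measure)"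
    interpret J: sigma_finite_measure "?P J" using I(3) by (rule sigma_finite)
    have upd: "(\<lambda>x. x(i := t)) \<in> ?N \<rightarrow>\<^sub>M ?N" for t :: real
      by (rule measurable_fun_upd[where J = UNIV]) auto
    have upd2: "(\<lambda>(t, x). x(i := t)) \<in> (borel \<Otimes>\<^sub>M ?P J) \<rightarrow>\<^sub>M ?N"
      unfolding case_prod_beta
      by (rule measurable_fun_upd[where J = UNIV])
        (auto intro: measurable_compose[OF measurable_snd measurable_PiM_UNIV])
    define \<Phi> where "\<Phi> = (\<lambda>x k. if k \<in> I then s k x * x k + c k x else undefined)"
    have coord: "(\<lambda>x. x k) \<in> borel_measurable ?N" for k
      by (rule measurable_component_singleton) simp
    have \<Phi>_meas: "\<Phi> \<in> ?N \<rightarrow>\<^sub>M ?N"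
      unfolding \<Phi>_def
    proof (rule measurable_PiM_single')
      fix k
      show "(\<lambda>x. if k \<in> I then s k x * x k + c k x else undefined) \<in> borel_measurable ?N"
        using s_meas[of k] c_meas[of k] coord[of k] by (cases "k \<in> I") simp_all
    qed simp
    define W where "W = (\<lambda>x. \<Prod>k\<in>J. ennreal (s k x) * indicator (D k) (x k))"
    have W_meas: "W \<in> borel_measurable ?N"
      unfolding W_def
    proof (rule borel_measurable_prod_ennreal)
      fix k assume "k \<in> J"
      then have "k \<in> I" by (simp add: I)
      note [measurable] = s_meas[OF this] D_meas[OF this] coord[of k]
      show "(\<lambda>x. ennreal (s k x) * indicator (D k) (x k)) \<in> borel_measurable ?N"
        by measurable
    qed
    define K where "K = (\<lambda>v. \<integral>\<^sup>+y. F (y(i := v)) \<partial>?P J)"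
    have K_meas: "K \<in> borel_measurable borel"
      unfolding K_def
      by (rule J.borel_measurable_nn_integral)
        (use measurable_compose[OF upd2 F_meas] in \<open>simp add: case_prod_beta\<close>)
    have K_img: "\<exists>t\<in>D i. v = a * t + b" if "K v \<noteq> 0" for v
    proof -
      from that obtain y where "F (y(i := v)) \<noteq> 0"
        unfolding K_def by fastforce
      from img[OF this] show ?thesis using i ab by (metis fun_upd_same)
    qed
    \<comment> \<open>With coordinate \<open>i\<close> frozen at \<open>t\<close>, the remaining
      substitution satisfies the same hypotheses; \<open>t \<in> D i\<close> is what keeps the later
      scales positive.\<close>
    have step: "K (a * t + b) = (\<integral>\<^sup>+x. F (\<Phi> (x(i := t))) * W (x(i := t)) \<partial>?P J)" if t: "t \<in> D i" for t
    proof -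
      let ?s = "\<lambda>k x. s k (x(i := t))" and ?c = "\<lambda>k x. c k (x(i := t))"
        and ?F = "\<lambda>y. F (y(i := a * t + b))"
      have "K (a * t + b) = (\<integral>\<^sup>+x. ?F (\<lambda>k. if k \<in> J then ?s k x * x k + ?c k x else undefined)
          * (\<Prod>k\<in>J. ennreal (?s k x) * indicator (D k) (x k)) \<partial>?P J)"
        unfolding K_def
      proof (rule less.hyps)
        show "card J < card I" using I by simp
        show "finite J" by fact
        show "?s k \<in> borel_measurable ?N" "?c k \<in> borel_measurable ?N" "D k \<in> sets borel" if "k \<in> J" for k
          using that by (auto simp: I intro!: measurable_compose[OF upd] s_meas c_meas D_meas)
        show "?F \<in> borel_measurable ?N" by (rule measurable_compose[OF upd F_meas])
        show "?s k x = ?s k x' \<and> ?c k x = ?c k x'"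
          if "k \<in> J" "\<And>l. l \<in> J \<Longrightarrow> rk l < rk k \<Longrightarrow> x l = x' l" for k x x'
          using that by (intro dep) (auto simp: I)
        show "0 < ?s k x" if "k \<in> J" "\<And>l. l \<in> J \<Longrightarrow> rk l < rk k \<Longrightarrow> x l \<in> D l" for k x
          using that t by (intro pos) (auto simp: I)
        show "\<exists>x. \<forall>k\<in>J. x k \<in> D k \<and> y k = ?s k x * x k + ?c k x" if "?F y \<noteq> 0" for y
        proof -
          from img[OF that] obtain x
            where x: "\<And>k. k \<in> I \<Longrightarrow> x k \<in> D k \<and> (y(i := a * t + b)) k = s k x * x k + c k x" by blast
          \<comment> \<open>A preimage of a point with coordinate \<open>a * t + b\<close> has
            \<open>t\<close> in place \<open>i\<close>, because \<open>a\<close> is nonzero; so the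
            preimage is compatible with the freezing.\<close>
          from x[OF i] a have "x i = t" by (simp add: ab)
          then have "x(i := t) = x" by auto
          then show ?thesis using x I(1,2) by (intro exI[of _ x]) (metis fun_upd_other insertCI)
        qed
      qed
      also have "\<dots> = (\<integral>\<^sup>+x. F (\<Phi> (x(i := t))) * W (x(i := t)) \<partial>?P J)"
      proof (rule nn_integral_cong)
        fix x :: "'i \<Rightarrow> real"
        have "(\<lambda>k. if k \<in> J then ?s k x * x k + ?c k x else undefined)(i := a * t + b) = \<Phi> (x(i := t))"
          by (rule ext) (auto simp: \<Phi>_def I ab)
        moreover have "(\<Prod>k\<in>J. ennreal (?s k x) * indicator (D k) (x k)) = W (x(i := t))"
          unfolding W_def using I(2) by (intro prod.cong) auto
        ultimately show "?F (\<lambda>k. if k \<in> J then ?s k x * x k + ?c k x else undefined)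
            * (\<Prod>k\<in>J. ennreal (?s k x) * indicator (D k) (x k)) = F (\<Phi> (x(i := t))) * W (x(i := t))"
          by simp
      qed
      finally show ?thesis .
    qed
    have G_meas: "(\<lambda>x. F (\<Phi> x) * W x) \<in> borel_measurable ?N"
      using measurable_compose[OF \<Phi>_meas F_meas] W_meas by measurable
    have "(\<integral>\<^sup>+y. F y \<partial>?P I) = (\<integral>\<^sup>+v. K v \<partial>lborel)"
      unfolding I(1) K_def
      by (rule product_nn_integral_insert_rev[OF I(3,2)]) (rule measurable_PiM_UNIV_compose[OF F_meas])
    also have "\<dots> = (\<integral>\<^sup>+t. (ennreal a * indicator (D i) t) * K (a * t + b) \<partial>lborel)"
      by (rule nn_integral_affine_image[OF K_meas a K_img])
    also have "\<dots> = (\<integral>\<^sup>+t. \<integral>\<^sup>+x. (ennreal a * indicator (D i) t) * (F (\<Phi> (x(i := t))) * W (x(i := t))) \<partial>?P J \<partial>lborel)"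
    proof (rule nn_integral_cong)
      fix t :: real
      have "(\<lambda>x. F (\<Phi> (x(i := t))) * W (x(i := t))) \<in> borel_measurable (?P J)"
        by (rule measurable_PiM_UNIV_compose[OF measurable_compose[OF upd G_meas]])
      then show "(ennreal a * indicator (D i) t) * K (a * t + b)
          = (\<integral>\<^sup>+x. (ennreal a * indicator (D i) t) * (F (\<Phi> (x(i := t))) * W (x(i := t))) \<partial>?P J)"
        by (subst nn_integral_cmult) (use step in \<open>auto simp: indicator_def\<close>)
    qed
    also have "\<dots> = (\<integral>\<^sup>+t. \<integral>\<^sup>+x. F (\<Phi> (x(i := t))) * (\<Prod>k\<in>I. ennreal (s k (x(i := t))) * indicator (D k) ((x(i := t)) k))
        \<partial>?P J \<partial>lborel)"
      unfolding I(1) using I(2,3) by (simp add: W_def ab mult_ac)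
    also have "\<dots> = (\<integral>\<^sup>+x. F (\<Phi> x) * (\<Prod>k\<in>I. ennreal (s k x) * indicator (D k) (x k)) \<partial>?P I)"
      unfolding I(1)
    proof (rule product_nn_integral_insert_rev[OF I(3,2), symmetric])
      have "(\<lambda>x. indicator (D i) (x i) * (ennreal a * (F (\<Phi> x) * W x))) \<in> borel_measurable ?N"
        using G_meas coord[of i] D_meas[OF i] by measurable
      from measurable_PiM_UNIV_compose[OF this]
      show "(\<lambda>x. F (\<Phi> x) * (\<Prod>k\<in>insert i J. ennreal (s k x) * indicator (D k) (x k))) \<in> borel_measurable (?P (insert i J))"
        using I(2,3) by (simp add: W_def ab mult_ac)
    qed
    finally show ?thesis by (simp add: \<Phi>_def)
  qed
qed

section \<open>Lebesgue measure on matrices in real coordinates\<close>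

lemma space_mat_space [simp]: "space mat_space = UNIV"
  by (auto simp: mat_space_def space_PiM)

lemma measurable_mat_spaceI:
  "(\<And>i j. (\<lambda>w. f w i j) \<in> borel_measurable M) \<Longrightarrow> f \<in> M \<rightarrow>\<^sub>M mat_space"
  unfolding mat_space_def
  by (rule measurable_PiM_single', rule measurable_PiM_single') (auto simp: space_PiM)

lemma measurable_mat_entry [measurable (raw)]:
  assumes "f \<in> M \<rightarrow>\<^sub>M mat_space"
  shows "(\<lambda>w. f w i j) \<in> borel_measurable M"
proof -
  have "(\<lambda>A. A i j) \<in> mat_space \<rightarrow>\<^sub>M borel"
    unfolding mat_space_def
    by (rule measurable_compose[where g = "\<lambda>x. x j", OF measurable_component_singleton[of i UNIV]])
      (auto intro: measurable_component_singleton)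
  from measurable_compose[OF assms this] show ?thesis .
qed

lemma measurable_coord_entry:
  "(\<lambda>x. coord_entry \<beta> x i j) \<in> borel_measurable (\<Pi>\<^sub>M i\<in>UNIV. borel)"
  unfolding coord_entry_def
  by (intro borel_measurable_qmk) auto

lemma measurable_mat_decode: "mat_decode \<beta> n m \<in> (\<Pi>\<^sub>M i\<in>UNIV. borel) \<rightarrow>\<^sub>M mat_space"
proof (rule measurable_mat_spaceI)
  fix i j
  show "(\<lambda>x. mat_decode \<beta> n m x i j) \<in> borel_measurable (\<Pi>\<^sub>M i\<in>UNIV. borel)"
    using measurable_coord_entry[of \<beta> i j] by (cases "i < n \<and> j < m") (auto simp: mat_decode_def)
qed

lemma measurable_herm_decode: "herm_decode \<beta> m \<in> (\<Pi>\<^sub>M i\<in>UNIV. borel) \<rightarrow>\<^sub>M mat_space"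
proof (rule measurable_mat_spaceI)
  fix i j
  show "(\<lambda>x. herm_decode \<beta> m x i j) \<in> borel_measurable (\<Pi>\<^sub>M i\<in>UNIV. borel)"
    using measurable_coord_entry[of \<beta> i j] borel_measurable_qcnj[OF measurable_coord_entry[of \<beta> j i]]
    by (cases "i < m \<and> j < m"; cases "i = j"; cases "i < j")
      (auto simp: herm_decode_def intro!: borel_measurable_qof_real)
qed

lemma nn_integral_lebM:
  "F \<in> borel_measurable mat_space \<Longrightarrow>
    (\<integral>\<^sup>+A. F A \<partial>lebM \<beta> n m) = (\<integral>\<^sup>+x. F (mat_decode \<beta> n m x) \<partial>(\<Pi>\<^sub>M i\<in>mat_idx \<beta> n m. lborel))"
  unfolding lebM_def
  by (intro nn_integral_distr measurable_PiM_UNIV_compose[OF measurable_mat_decode]) simp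

lemma nn_integral_lebH:
  "F \<in> borel_measurable mat_space \<Longrightarrow>
    (\<integral>\<^sup>+A. F A \<partial>lebH \<beta> m) = (\<integral>\<^sup>+x. F (herm_decode \<beta> m x) \<partial>(\<Pi>\<^sub>M i\<in>herm_idx \<beta> m. lborel))"
  unfolding lebH_def
  by (intro nn_integral_distr measurable_PiM_UNIV_compose[OF measurable_herm_decode]) simp

lemma mat_idx_eq: "mat_idx \<beta> n m = {..<n} \<times> {..<m} \<times> {..<\<beta>}"
  by (auto simp: mat_idx_def)

lemma finite_mat_idx [simp]: "finite (mat_idx \<beta> n m)"
  by (simp add: mat_idx_eq)

lemma finite_herm_idx [simp]: "finite (herm_idx \<beta> m)"
proof (rule finite_subset)
  show "herm_idx \<beta> m \<subseteq> {..<m} \<times> {..<m} \<times> {..max \<beta> 1}" by (auto simp: herm_idx_def)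
qed simp

lemma mat_decode_mats: "\<beta> \<in> {1,2,4} \<Longrightarrow> mat_decode \<beta> n m x \<in> mats \<beta> n m"
  by (rule matsI) (auto simp: mat_decode_def in_alg_coord_entry)

lemma herm_decode_mats: "\<beta> \<in> {1,2,4} \<Longrightarrow> herm_decode \<beta> m x \<in> mats \<beta> m m"
  by (rule matsI) (simp_all add: herm_decode_def in_alg_coord_entry in_alg_qcnj, auto)

lemma ctr_herm_decode: "ctr (herm_decode \<beta> m x) = herm_decode \<beta> m x"
  by (intro ext) (auto simp: herm_decode_def ctr_def qcnj_linear)

lemma coord_entry_eqI:
  assumes "\<beta> \<in> {1,2,4}" "in_alg \<beta> q" "\<And>c. c < \<beta> \<Longrightarrow> x (i, j, c) = qcomp c q"
  shows "coord_entry \<beta> x i j = q"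
proof (rule qcomp_eqI)
  fix c :: nat assume "c < 4"
  with assms show "qcomp c (coord_entry \<beta> x i j) = qcomp c q"
    by (subst qcomp_coord_entry) (auto simp: in_alg_iff[OF assms(1)])
qed

lemma mat_decode_eqI:
  assumes "\<beta> \<in> {1,2,4}" "A \<in> mats \<beta> n m" "\<And>i j c. (i, j, c) \<in> mat_idx \<beta> n m \<Longrightarrow> x (i, j, c) = qcomp c (A i j)"
  shows "mat_decode \<beta> n m x = A"
  by (rule mats_eqI[OF mat_decode_mats[OF assms(1)] assms(2)])
    (use assms in \<open>auto simp: mat_decode_def mat_idx_def intro!: coord_entry_eqI mats_in_alg\<close>)

lemma hermitian_entry: "ctr A = A \<Longrightarrow> qcnj (A i j) = A j i"
  by (metis ctr_def)

lemma hermitian_diag: "ctr A = A \<Longrightarrow> A i i = qof_real (qre (A i i))"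
  using hermitian_entry[of A i i] by (auto simp: quat_eq_iff qre_def)

lemma herm_decode_eqI:
  assumes "\<beta> \<in> {1,2,4}" "A \<in> mats \<beta> m m" "ctr A = A"
    "\<And>i j c. (i, j, c) \<in> herm_idx \<beta> m \<Longrightarrow> x (i, j, c) = qcomp c (A i j)"
  shows "herm_decode \<beta> m x = A"
proof (rule mats_eqI[OF herm_decode_mats[OF assms(1)] assms(2)])
  fix i j assume ij: "i < m" "j < m"
  have upper: "coord_entry \<beta> x i j = A i j" if "i < j" "j < m" for i j
    using that by (intro coord_entry_eqI[OF assms(1)] mats_in_alg[OF assms(2)] assms(4)) (auto simp: herm_idx_def)
  have diag: "qof_real (x (i, i, 0)) = A i i"
  proof -
    have "x (i, i, 0) = qre (A i i)"
      using assms(4)[of i i 0] ij by (simp add: herm_idx_def qcomp_def qre_def)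
    then show ?thesis using hermitian_diag[OF assms(3), of i] by simp
  qed
  consider "i < j" | "i = j" | "j < i" by linarith
  then show "herm_decode \<beta> m x i j = A i j"
    by cases (use ij upper[of i j] upper[of j i] diag hermitian_entry[OF assms(3), of j i] in
      \<open>auto simp: herm_decode_def\<close>)
qed

lemma qcomp_mat_decode:
  "\<beta> \<in> {1,2,4} \<Longrightarrow> (i, j, c) \<in> mat_idx \<beta> n m \<Longrightarrow> qcomp c (mat_decode \<beta> n m x i j) = x (i, j, c)"
  by (auto simp: mat_decode_def mat_idx_def qcomp_coord_entry)

lemma qcomp_herm_decode:
  "\<beta> \<in> {1,2,4} \<Longrightarrow> (i, j, c) \<in> herm_idx \<beta> m \<Longrightarrow> qcomp c (herm_decode \<beta> m x i j) = x (i, j, c)"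
  by (auto simp: herm_decode_def herm_idx_def qcomp_coord_entry) (simp_all add: qcomp_def)

lemma mat_decode_cong:
  assumes "\<And>c. c < \<beta> \<Longrightarrow> x (i, j, c) = x' (i, j, c)" "\<beta> \<in> {1,2,4}"
  shows "mat_decode \<beta> n m x i j = mat_decode \<beta> n m x' i j"
  using assms by (auto simp: mat_decode_def coord_entry_def)

text \<open>In coordinates all scales are 1 and all shifts are constants, so the triangular rule
  applies with a single rank.\<close>

lemma nn_integral_lebH_translate:
  assumes beta: "\<beta> \<in> {1,2,4}" and S: "S \<in> mats \<beta> m m" "ctr S = S" and F: "F \<in> borel_measurable mat_space"
  shows "(\<integral>\<^sup>+V. F V \<partial>lebH \<beta> m) = (\<integral>\<^sup>+V. F (madd V S) \<partial>lebH \<beta> m)"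
proof -
  define b where "b = (\<lambda>(i, j, c). qcomp c (S i j))"
  let ?I = "herm_idx \<beta> m"
  have "(\<integral>\<^sup>+V. F V \<partial>lebH \<beta> m) = (\<integral>\<^sup>+x. F (herm_decode \<beta> m (\<lambda>i. if i \<in> ?I then 1 * x i + b i else undefined))
      * (\<Prod>i\<in>?I. ennreal 1 * indicator UNIV (x i)) \<partial>(\<Pi>\<^sub>M i\<in>?I. lborel))"
    unfolding nn_integral_lebH[OF F]
  proof (rule nn_integral_triangular_affine[where rk = "\<lambda>_. 0"])
    fix y :: "nat \<times> nat \<times> nat \<Rightarrow> real"
    show "\<exists>x. \<forall>i\<in>?I. x i \<in> UNIV \<and> y i = 1 * x i + b i"
      by (intro exI[of _ "\<lambda>i. y i - b i"]) simp
  qed (auto intro: measurable_compose[OF measurable_herm_decode F])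
  also have "\<dots> = (\<integral>\<^sup>+x. F (madd (herm_decode \<beta> m x) S) \<partial>(\<Pi>\<^sub>M i\<in>?I. lborel))"
  proof (rule nn_integral_cong)
    fix x :: "nat \<times> nat \<times> nat \<Rightarrow> real"
    have "herm_decode \<beta> m (\<lambda>i. if i \<in> ?I then 1 * x i + b i else undefined) = madd (herm_decode \<beta> m x) S"
    proof (rule herm_decode_eqI[OF beta])
      show "madd (herm_decode \<beta> m x) S \<in> mats \<beta> m m"
        by (intro madd_mats herm_decode_mats[OF beta] S)
      show "ctr (madd (herm_decode \<beta> m x) S) = madd (herm_decode \<beta> m x) S"
        by (simp add: ctr_madd ctr_herm_decode S)
    qed (simp add: qcomp_herm_decode[OF beta] madd_def qcomp_linear b_def)
    then show "F (herm_decode \<beta> m (\<lambda>i. if i \<in> ?I then 1 * x i + b i else undefined))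
        * (\<Prod>i\<in>?I. ennreal 1 * indicator UNIV (x i)) = F (madd (herm_decode \<beta> m x) S)"
      by simp
  qed
  also have "\<dots> = (\<integral>\<^sup>+V. F (madd V S) \<partial>lebH \<beta> m)"
  proof (rule nn_integral_lebH[symmetric])
    have "(\<lambda>V. madd V S) \<in> mat_space \<rightarrow>\<^sub>M mat_space"
      unfolding madd_def by (rule measurable_mat_spaceI) measurable
    then show "(\<lambda>V. F (madd V S)) \<in> borel_measurable mat_space"
      by (rule measurable_compose[OF _ F])
  qed
  finally show ?thesis .
qed

lemma measurable_mmul [measurable (raw)]:
  "f \<in> M \<rightarrow>\<^sub>M mat_space \<Longrightarrow> g \<in> M \<rightarrow>\<^sub>M mat_space \<Longrightarrow> (\<lambda>w. mmul k (f w) (g w)) \<in> M \<rightarrow>\<^sub>M mat_space"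
  unfolding mmul_def
  by (rule measurable_mat_spaceI)
    (intro borel_measurable_sum borel_measurable_qmul measurable_mat_entry, assumption+)

lemma measurable_ctr [measurable (raw)]:
  "f \<in> M \<rightarrow>\<^sub>M mat_space \<Longrightarrow> (\<lambda>w. ctr (f w)) \<in> M \<rightarrow>\<^sub>M mat_space"
  unfolding ctr_def
  by (rule measurable_mat_spaceI) (intro borel_measurable_qcnj measurable_mat_entry, assumption)

lemma measurable_madd [measurable (raw)]:
  "f \<in> M \<rightarrow>\<^sub>M mat_space \<Longrightarrow> g \<in> M \<rightarrow>\<^sub>M mat_space \<Longrightarrow> (\<lambda>w. madd (f w) (g w)) \<in> M \<rightarrow>\<^sub>M mat_space"
  unfolding madd_def
  by (rule measurable_mat_spaceI) (intro borel_measurable_add measurable_mat_entry, assumption+)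

lemma measurable_msub [measurable (raw)]:
  "f \<in> M \<rightarrow>\<^sub>M mat_space \<Longrightarrow> g \<in> M \<rightarrow>\<^sub>M mat_space \<Longrightarrow> (\<lambda>w. msub (f w) (g w)) \<in> M \<rightarrow>\<^sub>M mat_space"
  unfolding msub_def
  by (rule measurable_mat_spaceI) (intro borel_measurable_diff measurable_mat_entry, assumption+)

text \<open>Column \<open>j\<close> of \<open>R L\<close> is \<open>dg L j\<close> times column
  \<open>j\<close> of \<open>R\<close> plus a combination of earlier columns, so the column index
  serves as rank. Each column has \<open>n * \<beta>\<close> real coordinates, whence the
  exponent.\<close>

lemma nn_integral_lebM_right_mult:
  assumes beta: "\<beta> \<in> {1,2,4}" and L: "upper_pos \<beta> m L" and F: "F \<in> borel_measurable mat_space"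
  shows "(\<integral>\<^sup>+X. F X \<partial>lebM \<beta> n m) = (\<Prod>j<m. ennreal (dg L j ^ (n * \<beta>))) * (\<integral>\<^sup>+R. F (mmul m R L) \<partial>lebM \<beta> n m)"
proof -
  let ?I = "mat_idx \<beta> n m" and ?d = "mat_decode \<beta> n m"
  note L' = upper_posD[OF L]
  define s where "s = (\<lambda>(i::nat, j, c::nat). dg L j)"
  define b where "b = (\<lambda>(i, j, c) x. qcomp c (\<Sum>l<j. qmul (?d x i l) (L l j)))"
  have eq: "s (i, j, c) * x (i, j, c) + b (i, j, c) x = qcomp c (mmul m (?d x) L i j)"
    if "(i, j, c) \<in> ?I" for i j c x
    using that qcomp_mat_decode[OF beta that]
    by (subst mmul_upper_nth[OF L]) (auto simp: s_def b_def qcomp_linear mat_idx_def)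
  have decode: "?d (\<lambda>i. if i \<in> ?I then s i * x i + b i x else undefined) = mmul m (?d x) L" for x
    using eq by (intro mat_decode_eqI[OF beta] mmul_mats[OF beta mat_decode_mats[OF beta] L'(1)]) auto
  have FL: "(\<lambda>R. F (mmul m R L)) \<in> borel_measurable mat_space"
    by (rule measurable_compose[OF _ F]) measurable
  have "(\<integral>\<^sup>+X. F X \<partial>lebM \<beta> n m) = (\<integral>\<^sup>+x. F (?d (\<lambda>i. if i \<in> ?I then s i * x i + b i x else undefined))
      * (\<Prod>i\<in>?I. ennreal (s i) * indicator UNIV (x i)) \<partial>(\<Pi>\<^sub>M i\<in>?I. lborel))"
    unfolding nn_integral_lebM[OF F]
  proof (rule nn_integral_triangular_affine[where rk = "\<lambda>(i, j, c). j"])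
    fix k assume k: "k \<in> ?I"
    obtain i j c where k': "k = (i, j, c)" by (cases k)
    show "b k \<in> borel_measurable (\<Pi>\<^sub>M i\<in>UNIV. borel)"
      unfolding k' b_def prod.case
      by (intro borel_measurable_qcomp borel_measurable_sum borel_measurable_qmul
          measurable_mat_entry measurable_mat_decode) simp
    show "0 < s k" using k L'(4) by (auto simp: s_def mat_idx_def)
    fix x x' :: "nat \<times> nat \<times> nat \<Rightarrow> real"
    assume x: "\<And>l. l \<in> ?I \<Longrightarrow> (case l of (i, j, c) \<Rightarrow> j) < (case k of (i, j, c) \<Rightarrow> j) \<Longrightarrow> x l = x' l"
    have "?d x i l = ?d x' i l" if "l < j" for l
      using x k that unfolding k' by (intro mat_decode_cong[OF _ beta]) (auto simp: mat_idx_def)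
    then show "s k = s k \<and> b k x = b k x'"
      by (simp add: b_def k')
  next
    fix y
    define x where "x = (\<lambda>(i, j, c). qcomp c (mmul m (?d y) (uinv m L) i j))"
    have "?d x = mmul m (?d y) (uinv m L)"
      by (rule mat_decode_eqI[OF beta mmul_mats[OF beta mat_decode_mats[OF beta] upper_posD(1)[OF upper_pos_uinv[OF beta L]]]])
        (simp add: x_def)
    then have "mmul m (?d x) L = ?d y"
      using mmul_uinv_cancel(2)[OF beta L mat_decode_mats[OF beta]] by simp
    then show "\<exists>x. \<forall>i\<in>?I. x i \<in> UNIV \<and> y i = s i * x i + b i x"
      using eq qcomp_mat_decode[OF beta] by (intro exI[of _ x]) auto
  qed (auto intro: measurable_compose[OF measurable_mat_decode F])
  also have "\<dots> = (\<integral>\<^sup>+x. (\<Prod>i\<in>?I. ennreal (s i)) * F (mmul m (?d x) L) \<partial>(\<Pi>\<^sub>M i\<in>?I. lborel))"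
    by (simp add: decode mult.commute)
  also have "\<dots> = (\<Prod>i\<in>?I. ennreal (s i)) * (\<integral>\<^sup>+R. F (mmul m R L) \<partial>lebM \<beta> n m)"
    unfolding nn_integral_lebM[OF FL]
    by (rule nn_integral_cmult) (rule measurable_PiM_UNIV_compose[OF measurable_compose[OF measurable_mat_decode FL]])
  also have "(\<Prod>i\<in>?I. ennreal (s i)) = (\<Prod>j<m. ennreal (dg L j ^ (n * \<beta>)))"
  proof -
    have "(\<Prod>i\<in>?I. ennreal (s i)) = (\<Prod>i<n. \<Prod>j<m. \<Prod>c<\<beta>. ennreal (dg L j))"
      unfolding mat_idx_eq s_def by (simp only: prod.cartesian_product) (simp add: case_prod_beta)
    also have "\<dots> = (\<Prod>j<m. ennreal (dg L j) ^ (n * \<beta>))"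
      by (simp add: prod_power_distrib power_mult mult.commute)
    also have "\<dots> = (\<Prod>j<m. ennreal (dg L j ^ (n * \<beta>)))"
      using L'(4) by (intro prod.cong refl ennreal_power) (auto intro: less_imp_le)
    finally show ?thesis .
  qed
  finally show ?thesis .
qed

section \<open>The gamma integral over positive definite matrices\<close>

lemma measurable_cfac:
  assumes "f \<in> M \<rightarrow>\<^sub>M mat_space"
  shows "(\<lambda>w. cfac (f w) i j) \<in> borel_measurable M"
proof (induction i arbitrary: j rule: less_induct)
  case (less i)
  note entry = measurable_mat_entry[OF assms]
  have s: "(\<lambda>w. f w i j - (\<Sum>k<i. qmul (qcnj (cfac (f w) k i)) (cfac (f w) k j))) \<in> borel_measurable M" for j
    by (intro borel_measurable_diff borel_measurable_sum borel_measurable_qmul borel_measurable_qcnj entry less)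
      simp_all
  have piv: "(\<lambda>w. pivot (f w) i) \<in> borel_measurable M"
    unfolding pivot_def by (intro borel_measurable_qre s)
  consider "j < i" | "j = i" | "i < j" by linarith
  then show ?case
  proof cases
    case 3
    show ?thesis unfolding cfac_upper[OF 3] using piv s by measurable
  next
    case 2
    then show ?thesis using piv by (simp add: cfac_diag borel_measurable_qof_real)
  qed (simp add: cfac_lower)
qed

lemma measurable_pivot:
  assumes "f \<in> M \<rightarrow>\<^sub>M mat_space"
  shows "(\<lambda>w. pivot (f w) i) \<in> borel_measurable M"
  unfolding pivot_eq
  by (intro borel_measurable_diff borel_measurable_sum borel_measurable_qnsq borel_measurable_qre
      measurable_cfac measurable_mat_entry[OF assms] assms)

lemma measurable_cholf: "f \<in> M \<rightarrow>\<^sub>M mat_space \<Longrightarrow> (\<lambda>w. cholf m (f w)) \<in> M \<rightarrow>\<^sub>M mat_space"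
  unfolding cholf_def
proof (rule measurable_mat_spaceI)
  fix i j assume "f \<in> M \<rightarrow>\<^sub>M mat_space"
  then show "(\<lambda>w. if i < m \<and> j < m then cfac (f w) i j else 0) \<in> borel_measurable M"
    using measurable_cfac[of f M i j] by (cases "i < m \<and> j < m") auto
qed

text \<open>Membership is a countable conjunction of equations between components.\<close>

lemma pred_mats:
  assumes beta: "\<beta> \<in> {1,2,4}" and f: "f \<in> M \<rightarrow>\<^sub>M mat_space"
  shows "Measurable.pred M (\<lambda>w. f w \<in> mats \<beta> r c)"
proof -
  have [measurable]: "(\<lambda>w. qcomp c (f w i j)) \<in> borel_measurable M" for c i j
    by (intro borel_measurable_qcomp measurable_mat_entry[OF f])
  have zero: "q = 0 \<longleftrightarrow> (\<forall>c. c < 4 \<longrightarrow> qcomp c q = 0)" for q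
    by (auto simp: qcomp_linear intro!: qcomp_eqI)
  have "(f w \<in> mats \<beta> r c) \<longleftrightarrow>
      (\<forall>i j d. d < 4 \<longrightarrow> (\<beta> \<le> d \<or> \<not> (i < r \<and> j < c)) \<longrightarrow> qcomp d (f w i j) = 0)" for w
    unfolding mats_def mem_Collect_eq in_alg_iff[OF beta] zero by blast
  then show ?thesis by simp
qed

text \<open>The defining condition ranges over uncountably many vectors; the pivot criterion
  replaces it by finitely many measurable inequalities next to the shape and symmetry
  conditions.\<close>

lemma pred_pd:
  assumes beta: "\<beta> \<in> {1,2,4}" and f: "f \<in> M \<rightarrow>\<^sub>M mat_space"
  shows "Measurable.pred M (\<lambda>w. pd \<beta> m (f w))"
proof -
  have "ctr A = A \<longleftrightarrow> (\<forall>i j. qcnj (A j i) = A i j)" for A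
    by (auto simp: ctr_def fun_eq_iff)
  moreover have [measurable]: "Measurable.pred M (\<lambda>w. qcnj (f w j i) = f w i j)" for i j
    unfolding pred_def
    by (intro measurable_equality_set borel_measurable_qcnj measurable_mat_entry[OF f])
  note [measurable] = measurable_pivot[OF f] pred_mats[OF beta f]
  ultimately show ?thesis
    unfolding pd_iff_pivot[OF beta] by simp measurable
qed

lemma measurable_chol:
  assumes beta: "\<beta> \<in> {1,2,4}" and f: "f \<in> M \<rightarrow>\<^sub>M mat_space"
  shows "(\<lambda>w. chol \<beta> m (f w)) \<in> M \<rightarrow>\<^sub>M mat_space"
proof -
  have "chol \<beta> m (f w) = (if pd \<beta> m (f w) then cholf m (f w) else (THE T. False))" for w
    using chol_pd(3)[OF beta] chol_not_pd[OF beta] by simp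
  then show ?thesis
    using pred_pd[OF beta f] measurable_cholf[OF f] by (simp only:) (rule measurable_If, auto)
qed

text \<open>Coordinate \<open>(i, i, 0)\<close> stores the square of the diagonal entry of
  \<open>T\<close>. With this choice each coordinate of \<open>T* T\<close> is affine in the
  matching coordinate of \<open>T\<close>, with slope 1 on the diagonal and slope
  \<open>dg T i\<close> to the right of it, so the triangular rule applies and no powers of two
  arise in the Jacobian.\<close>

definition tri_decode :: "nat \<Rightarrow> nat \<Rightarrow> (nat \<times> nat \<times> nat \<Rightarrow> real) \<Rightarrow> qmat" where
  "tri_decode \<beta> m x = (\<lambda>i j. if i < m \<and> j < m then
      (if i = j then qof_real (sqrt (x (i, i, 0))) else if i < j then coord_entry \<beta> x i j else 0)
     else 0)"

lemma tri_decode_lower: "j < i \<Longrightarrow> tri_decode \<beta> m x i j = 0"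
  by (simp add: tri_decode_def)

lemma tri_decode_diag: "i < m \<Longrightarrow> tri_decode \<beta> m x i i = qof_real (sqrt (x (i, i, 0)))"
  by (simp add: tri_decode_def)

lemma tri_decode_mats: "\<beta> \<in> {1,2,4} \<Longrightarrow> tri_decode \<beta> m x \<in> mats \<beta> m m"
  by (rule matsI) (auto simp: tri_decode_def in_alg_coord_entry)

lemma measurable_tri_decode: "tri_decode \<beta> m \<in> (\<Pi>\<^sub>M i\<in>UNIV. borel) \<rightarrow>\<^sub>M mat_space"
proof (rule measurable_mat_spaceI)
  fix i j :: nat
  have "(\<lambda>x. qof_real (sqrt (x (i, i, 0 :: nat)))) \<in> borel_measurable (\<Pi>\<^sub>M i\<in>UNIV. (borel :: real measure))"
    by (intro borel_measurable_qof_real) measurable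
  then show "(\<lambda>x. tri_decode \<beta> m x i j) \<in> borel_measurable (\<Pi>\<^sub>M i\<in>UNIV. borel)"
    using measurable_coord_entry[of \<beta> i j]
    by (cases "i < m \<and> j < m"; cases "i = j"; cases "i < j") (auto simp: tri_decode_def)
qed

lemma upper_pos_tri_decode:
  assumes "\<beta> \<in> {1,2,4}" "\<And>i. i < m \<Longrightarrow> 0 < x (i, i, 0)"
  shows "upper_pos \<beta> m (tri_decode \<beta> m x)"
  by (rule upper_posI[OF tri_decode_mats[OF assms(1)] tri_decode_lower tri_decode_diag])
    (use assms in auto)

lemma dg_tri_decode: "i < m \<Longrightarrow> dg (tri_decode \<beta> m x) i = sqrt (x (i, i, 0))"
  by (simp add: dg_def tri_decode_diag)

definition herm_scale :: "nat \<times> nat \<times> nat \<Rightarrow> (nat \<times> nat \<times> nat \<Rightarrow> real) \<Rightarrow> real" where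
  "herm_scale = (\<lambda>(i, j, c) x. if i = j then 1 else sqrt (x (i, i, 0)))"

definition herm_dom :: "nat \<times> nat \<times> nat \<Rightarrow> real set" where
  "herm_dom = (\<lambda>(i, j, c). if i = j then {0<..} else UNIV)"

text \<open>For \<open>i \<le> j\<close>, entry \<open>(i, j)\<close> of \<open>T* T\<close> is
  \<open>dg T i\<close> times entry \<open>(i, j)\<close> of \<open>T\<close> plus terms from the
  rows before \<open>i\<close>, so the substitution is triangular row by row. The support hypothesis
  provides a preimage of every relevant point, namely its Cholesky factor.\<close>

lemma nn_integral_lebH_cholesky:
  assumes beta: "\<beta> \<in> {1,2,4}" and F: "F \<in> borel_measurable mat_space"
    and supp: "\<And>A. F A \<noteq> 0 \<Longrightarrow> pd \<beta> m A"
  shows "(\<integral>\<^sup>+V. F V \<partial>lebH \<beta> m) =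
    (\<integral>\<^sup>+x. F (mmul m (ctr (tri_decode \<beta> m x)) (tri_decode \<beta> m x))
      * (\<Prod>k\<in>herm_idx \<beta> m. ennreal (herm_scale k x) * indicator (herm_dom k) (x k))
     \<partial>(\<Pi>\<^sub>M i\<in>herm_idx \<beta> m. lborel))"
proof -
  let ?I = "herm_idx \<beta> m" and ?t = "tri_decode \<beta> m"
  define b where "b = (\<lambda>(i, j, c) x. qcomp c (\<Sum>k<i. qmul (qcnj (?t x k i)) (?t x k j)))"
  have entry: "mmul m (ctr T) T i j = (\<Sum>k<i. qmul (qcnj (T k i)) (T k j)) + dg T i *\<^sub>R T i j"
    if "upper_pos \<beta> m T" "i < m" for T i j
    unfolding mmul_def ctr_def
    by (subst sum_upper_split[OF that(2)])
      (use that(2) in \<open>auto simp: upper_posD[OF that(1)] qcnj_linear qmul.zero_left\<close>)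
  have eq: "herm_scale (i, j, c) x * x (i, j, c) + b (i, j, c) x = qcomp c (mmul m (ctr (?t x)) (?t x) i j)"
    if "(i, j, c) \<in> ?I" "\<And>k. k \<in> ?I \<Longrightarrow> x k \<in> herm_dom k" for i j c x
  proof -
    have pos: "0 < x (i, i, 0)" if "i < m" for i
      using \<open>\<And>k. k \<in> ?I \<Longrightarrow> x k \<in> herm_dom k\<close>[of "(i, i, 0)"] that by (auto simp: herm_idx_def herm_dom_def)
    have i: "i < m" and j: "j < m" using that(1) by (auto simp: herm_idx_def)
    have "qcomp c (dg (?t x) i *\<^sub>R ?t x i j) = herm_scale (i, j, c) x * x (i, j, c)"
    proof (cases "i = j")
      case True
      then have "c = 0" using that(1) by (auto simp: herm_idx_def)
      with True i pos[OF i] show ?thesis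
        by (simp add: dg_tri_decode tri_decode_diag herm_scale_def qcomp_def)
    next
      case False
      then have "i < j" "c < \<beta>" using that(1) by (auto simp: herm_idx_def)
      with i j beta show ?thesis
        unfolding dg_tri_decode[OF i] by (auto simp: herm_scale_def qcomp_linear tri_decode_def qcomp_coord_entry)
    qed
    moreover have "mmul m (ctr (?t x)) (?t x) i j = (\<Sum>k<i. qmul (qcnj (?t x k i)) (?t x k j)) + dg (?t x) i *\<^sub>R ?t x i j"
      by (rule entry[OF upper_pos_tri_decode[of \<beta> m x, OF beta pos] i])
    ultimately show ?thesis
      by (simp add: b_def linear_add[OF bounded_linear.linear[OF bounded_linear_qcomp]])
  qed
  have decode: "herm_decode \<beta> m (\<lambda>i. if i \<in> ?I then herm_scale i x * x i + b i x else undefined)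
      = mmul m (ctr (?t x)) (?t x)" if "\<And>k. k \<in> ?I \<Longrightarrow> x k \<in> herm_dom k" for x
    using eq[of _ _ _ x] that
    by (intro herm_decode_eqI[OF beta] mmul_mats ctr_mats tri_decode_mats ctr_gram beta) auto
  have "(\<integral>\<^sup>+V. F V \<partial>lebH \<beta> m) = (\<integral>\<^sup>+x. F (herm_decode \<beta> m (\<lambda>i. if i \<in> ?I then herm_scale i x * x i + b i x else undefined))
      * (\<Prod>k\<in>?I. ennreal (herm_scale k x) * indicator (herm_dom k) (x k)) \<partial>(\<Pi>\<^sub>M i\<in>?I. lborel))"
    unfolding nn_integral_lebH[OF F]
  \<comment> \<open>Within row \<open>i\<close> the diagonal coordinate must precede the others,
    since its root is their scale; hence the ranks \<open>2 * i\<close> and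
    \<open>2 * i + 1\<close>.\<close>
  proof (rule nn_integral_triangular_affine[where rk = "\<lambda>(i, j, c). if i = j then 2 * i else 2 * i + 1"])
    fix k assume k: "k \<in> ?I"
    obtain i j c where k': "k = (i, j, c)" by (cases k)
    show "herm_scale k \<in> borel_measurable (\<Pi>\<^sub>M i\<in>UNIV. borel)"
      unfolding k' herm_scale_def by (cases "i = j") auto
    show "b k \<in> borel_measurable (\<Pi>\<^sub>M i\<in>UNIV. borel)"
      unfolding k' b_def prod.case
      by (intro borel_measurable_qcomp borel_measurable_sum borel_measurable_qmul borel_measurable_qcnj
          measurable_mat_entry[OF measurable_tri_decode])
    show "herm_dom k \<in> sets borel" by (simp add: k' herm_dom_def)
    let ?rk = "\<lambda>(i :: nat, j :: nat, c :: nat). if i = j then 2 * i else 2 * i + 1"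
    show "0 < herm_scale k x" if "\<And>l. l \<in> ?I \<Longrightarrow> ?rk l < ?rk k \<Longrightarrow> x l \<in> herm_dom l" for x
      using k that[of "(i, i, 0)"] by (auto simp: k' herm_scale_def herm_idx_def herm_dom_def)
    fix x x' :: "nat \<times> nat \<times> nat \<Rightarrow> real"
    assume x: "\<And>l. l \<in> ?I \<Longrightarrow> ?rk l < ?rk k \<Longrightarrow> x l = x' l"
    have "?t x l a = ?t x' l a" if "l < i" for l a
      using that k beta x[of "(l, l, 0)"] x[of "(l, a, 0)"] x[of "(l, a, 1)"] x[of "(l, a, 2)"] x[of "(l, a, 3)"]
      by (auto simp: tri_decode_def coord_entry_def k' herm_idx_def)
    moreover have "herm_scale k x = herm_scale k x'"
      using k x[of "(i, i, 0)"] by (auto simp: k' herm_scale_def herm_idx_def)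
    ultimately show "herm_scale k x = herm_scale k x' \<and> b k x = b k x'"
      by (simp add: b_def k')
  next
    fix y assume "F (herm_decode \<beta> m y) \<noteq> 0"
    then have A: "pd \<beta> m (herm_decode \<beta> m y)" by (rule supp)
    define T where "T = chol \<beta> m (herm_decode \<beta> m y)"
    have T: "upper_pos \<beta> m T" and TT: "mmul m (ctr T) T = herm_decode \<beta> m y"
      using chol_pd[OF beta A] by (auto simp: T_def)
    note T' = upper_posD[OF T]
    define x where "x = (\<lambda>(i, j, c). if i = j then (dg T i)\<^sup>2 else qcomp c (T i j))"
    have x_T: "?t x = T"
    proof (rule mats_eqI[OF tri_decode_mats[OF beta] T'(1)])
      fix i j assume ij: "i < m" "j < m"
      have "coord_entry \<beta> x i j = T i j" if "i < j"
        using that by (intro coord_entry_eqI[OF beta] mats_in_alg[OF T'(1)]) (auto simp: x_def)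
      moreover have "sqrt (x (i, i, 0)) = dg T i"
        using T'(4)[OF ij(1)] by (simp add: x_def)
      ultimately show "?t x i j = T i j"
        using ij T'(2)[of j i] T'(3)[of i] by (auto simp: tri_decode_def)
    qed
    have x_dom: "x k \<in> herm_dom k" if "k \<in> ?I" for k
      using that T'(4) by (fastforce simp: herm_idx_def herm_dom_def x_def)
    show "\<exists>x. \<forall>k\<in>?I. x k \<in> herm_dom k \<and> y k = herm_scale k x * x k + b k x"
    proof (intro exI[of _ x] ballI conjI)
      fix k assume k: "k \<in> ?I"
      then show "x k \<in> herm_dom k" by (rule x_dom)
      obtain i j c where k': "k = (i, j, c)" by (cases k)
      show "y k = herm_scale k x * x k + b k x"
        using eq[of i j c x] k x_dom qcomp_herm_decode[OF beta, of i j c m y]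
        unfolding k' x_T TT by simp
    qed
  qed (use F in \<open>auto intro: measurable_compose[OF measurable_herm_decode]\<close>)
  also have "\<dots> = (\<integral>\<^sup>+x. F (mmul m (ctr (?t x)) (?t x))
      * (\<Prod>k\<in>?I. ennreal (herm_scale k x) * indicator (herm_dom k) (x k)) \<partial>(\<Pi>\<^sub>M i\<in>?I. lborel))"
  proof (rule nn_integral_cong)
    fix x :: "nat \<times> nat \<times> nat \<Rightarrow> real"
    show "F (herm_decode \<beta> m (\<lambda>i. if i \<in> ?I then herm_scale i x * x i + b i x else undefined))
        * (\<Prod>k\<in>?I. ennreal (herm_scale k x) * indicator (herm_dom k) (x k))
      = F (mmul m (ctr (?t x)) (?t x)) * (\<Prod>k\<in>?I. ennreal (herm_scale k x) * indicator (herm_dom k) (x k))"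
    proof (cases "\<forall>k\<in>?I. x k \<in> herm_dom k")
      case True
      then show ?thesis using decode[of x] by simp
    next
      case False
      then have "(\<Prod>k\<in>?I. ennreal (herm_scale k x) * indicator (herm_dom k) (x k)) = 0"
        by (intro prod_zero) (auto simp: indicator_def)
      then show ?thesis by (simp only: mult_zero_right)
    qed
  qed
  finally show ?thesis .
qed

section \<open>One-dimensional gamma and Gaussian integrals\<close>

lemma nn_integral_gamma_density:
  fixes a b :: real
  assumes "0 < a" "0 < b"
  shows "(\<integral>\<^sup>+t. ennreal (exp (- b * t) * t powr (a - 1)) * indicator {0<..} t \<partial>lborel) = ennreal (Gamma a / b powr a)"
proof -
  let ?f = "\<lambda>t. ennreal (exp (- b * t) * t powr (a - 1)) * indicator {0<..} t"
  have "ennreal (Gamma a) = ennreal b * (\<integral>\<^sup>+t. ennreal (indicat_real {0..} (b * t) * (b * t) powr (a - 1) / exp (b * t)) \<partial>lborel)"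
    unfolding Gamma_conv_nn_integral_real[OF assms(1)]
    using assms by (subst nn_integral_real_affine[where c = b and t = 0]) auto
  also have "(\<integral>\<^sup>+t. ennreal (indicat_real {0..} (b * t) * (b * t) powr (a - 1) / exp (b * t)) \<partial>lborel)
      = (\<integral>\<^sup>+t. ennreal (b powr (a - 1)) * ?f t \<partial>lborel)"
  proof (rule nn_integral_cong)
    fix t :: real
    have "0 \<le> b * t \<longleftrightarrow> 0 \<le> t" using assms by (simp add: zero_le_mult_iff)
    then show "ennreal (indicat_real {0..} (b * t) * (b * t) powr (a - 1) / exp (b * t)) = ennreal (b powr (a - 1)) * ?f t"
      using assms by (cases "t = 0")
        (auto simp: indicator_def powr_mult exp_minus field_simps simp flip: ennreal_mult)
  qed
  also have "ennreal b * \<dots> = ennreal (b powr a) * (\<integral>\<^sup>+t. ?f t \<partial>lborel)"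
  proof -
    have "b * b powr (a - 1) = b powr a" using assms by (simp add: powr_mult_base)
    then show ?thesis
      using assms by (subst nn_integral_cmult) (auto simp flip: mult.assoc ennreal_mult)
  qed
  finally have *: "ennreal (Gamma a) = ennreal (b powr a) * (\<integral>\<^sup>+t. ?f t \<partial>lborel)" .
  have "(\<integral>\<^sup>+t. ?f t \<partial>lborel) = ennreal (inverse (b powr a)) * (ennreal (b powr a) * (\<integral>\<^sup>+t. ?f t \<partial>lborel))"
    using assms by (simp flip: mult.assoc ennreal_mult)
  also have "\<dots> = ennreal (Gamma a / b powr a)"
    using assms unfolding * [symmetric] by (simp add: divide_inverse mult.commute flip: ennreal_mult')
  finally show ?thesis .
qed

text \<open>On the interval from 0 to 1 the integrand dominates \<open>exp (- b) / t\<close>, whose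
  integral grows logarithmically without bound near 0.\<close>

lemma nn_integral_gamma_density_diverges:
  fixes a b :: real
  assumes "a \<le> 0" "0 < b"
  shows "(\<integral>\<^sup>+t. ennreal (exp (- b * t) * t powr (a - 1)) * indicator {0<..} t \<partial>lborel) = \<infinity>"
proof -
  let ?f = "\<lambda>t. ennreal (exp (- b * t) * t powr (a - 1)) * indicator {0<..} t"
  have "ennreal (real B) \<le> (\<integral>\<^sup>+t. ?f t \<partial>lborel)" for B :: nat
  proof -
    \<comment> \<open>The lower limit \<open>?c\<close> is chosen so that the comparison integral
      over \<open>{?c..1}\<close> equals \<open>B\<close> exactly.\<close>
    let ?F = "\<lambda>t. exp (- b) * ln t" and ?c = "exp (- (exp b * real B))"
    have c: "0 < ?c" "?c \<le> 1" by auto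
    have "(\<integral>\<^sup>+t. ennreal (exp (- b) * inverse t) * indicator {?c..1} t \<partial>lborel) = ennreal (?F 1 - ?F ?c)"
    proof (rule nn_integral_FTC_Icc)
      show "(\<lambda>t. exp (- b) * inverse t) \<in> borel_measurable borel" by measurable
      fix t :: real assume "t \<in> {?c..1}"
      then have "0 < t" using less_le_trans[OF c(1)] by simp
      then show "DERIV ?F t :> exp (- b) * inverse t" "0 \<le> exp (- b) * inverse t"
        by (auto intro!: derivative_eq_intros simp: divide_inverse)
    qed (use c in auto)
    also have "?F 1 - ?F ?c = real B" by (simp flip: mult.assoc exp_add)
    finally have "ennreal (real B) = (\<integral>\<^sup>+t. ennreal (exp (- b) * inverse t) * indicator {?c..1} t \<partial>lborel)" ..
    also have "\<dots> \<le> (\<integral>\<^sup>+t. ?f t \<partial>lborel)"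
    proof (rule nn_integral_mono)
      fix t :: real
      show "ennreal (exp (- b) * inverse t) * indicator {?c..1} t \<le> ?f t"
      proof (cases "t \<in> {?c..1}")
        case True
        then have t: "0 < t" "t \<le> 1" using less_le_trans[OF c(1)] by simp_all
        have "inverse t = t powr (- 1)" using t by (simp add: powr_minus)
        also have "\<dots> \<le> t powr (a - 1)"
          using t assms by (intro powr_mono') auto
        finally have "exp (- b) * inverse t \<le> exp (- b * t) * t powr (a - 1)"
          using t assms by (intro mult_mono) auto
        with True t show ?thesis by (simp add: ennreal_leI)
      qed simp
    qed
    finally show ?thesis .
  qed
  then show ?thesis
    by (metis (no_types, lifting) ennreal_Ex_less_of_nat ennreal_of_nat_eq_real_of_nat infinity_ennreal_def
        less_top linorder_not_less)
qed

lemma nn_integral_gaussian: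
  fixes b :: real
  assumes "0 < b"
  shows "(\<integral>\<^sup>+t. ennreal (exp (- b * t\<^sup>2)) \<partial>lborel) = ennreal (sqrt (pi / b))"
proof -
  \<comment> \<open>The standard deviation for which the exponent of the normal density is
    \<open>- b * t\<^sup>2\<close>.\<close>
  define \<sigma> where "\<sigma> = sqrt (1 / (2 * b))"
  have \<sigma>: "0 < \<sigma>" "2 * \<sigma>\<^sup>2 = 1 / b" using assms by (auto simp: \<sigma>_def)
  have "sqrt (2 * pi * \<sigma>\<^sup>2) = sqrt (pi / b)"
    using \<sigma>(2) by (metis mult.commute mult.left_commute times_divide_eq_right mult.right_neutral)
  then have eq: "exp (- b * t\<^sup>2) = sqrt (pi / b) * normal_density 0 \<sigma> t" for t
    unfolding normal_density_def using assms \<sigma>(2) by (simp add: mult.commute)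
  have "(\<integral>\<^sup>+t. ennreal (exp (- b * t\<^sup>2)) \<partial>lborel) = (\<integral>\<^sup>+t. ennreal (sqrt (pi / b)) * ennreal (normal_density 0 \<sigma> t) \<partial>lborel)"
    unfolding eq using assms by (simp add: ennreal_mult)
  also have "\<dots> = ennreal (sqrt (pi / b)) * (\<integral>\<^sup>+t. ennreal (normal_density 0 \<sigma> t) \<partial>lborel)"
    by (rule nn_integral_cmult) simp
  also have "(\<integral>\<^sup>+t. ennreal (normal_density 0 \<sigma> t) \<partial>lborel) = 1"
    using integrable_normal_density[OF \<sigma>(1)] integral_normal_density[OF \<sigma>(1)]
    by (subst nn_integral_eq_integral) auto
  finally show ?thesis by simp
qed

section \<open>The unnormalised Riesz density and its integral\<close>

lemma prod_herm_idx:
  "(\<Prod>k\<in>herm_idx \<beta> m. f k) = (\<Prod>i<m. f (i, i, 0)) * (\<Prod>i<m. \<Prod>j\<in>{i<..<m}. \<Prod>c<\<beta>. f (i, j, c))"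
proof -
  let ?d = "(\<lambda>i. (i, i, 0 :: nat)) ` {..<m}" and ?o = "Sigma {..<m} (\<lambda>i. {i<..<m} \<times> {..<\<beta>})"
  have "herm_idx \<beta> m = ?d \<union> ?o" by (auto simp: herm_idx_def)
  then have "(\<Prod>k\<in>herm_idx \<beta> m. f k) = (\<Prod>k\<in>?d. f k) * (\<Prod>k\<in>?o. f k)"
    by (simp only:) (rule prod.union_disjoint, auto)
  also have "(\<Prod>k\<in>?d. f k) = (\<Prod>i<m. f (i, i, 0))"
    by (subst prod.reindex) (auto simp: inj_on_def)
  also have "(\<Prod>k\<in>?o. f k) = (\<Prod>i<m. \<Prod>jc\<in>{i<..<m} \<times> {..<\<beta>}. f (i, jc))"
    by (subst prod.Sigma) (auto simp: case_prod_beta)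
  also have "\<dots> = (\<Prod>i<m. \<Prod>j\<in>{i<..<m}. \<Prod>c<\<beta>. f (i, j, c))"
    by (subst prod.cartesian_product) (simp add: case_prod_beta)
  finally show ?thesis .
qed

text \<open>The Riesz density without its constant. The determinant power and the power function are
  both products of powers of the Cholesky diagonal, so one exponent per index suffices. Evaluated at
  \<open>X* X\<close> it also gives the Kotz-Riesz density.\<close>

definition riesz_kernel :: "nat \<Rightarrow> nat \<Rightarrow> (nat \<Rightarrow> real) \<Rightarrow> qmat \<Rightarrow> real" where
  "riesz_kernel \<beta> m e A = (if pd \<beta> m A
     then exp (- real \<beta> * mtr m A) * (\<Prod>i<m. dg (chol \<beta> m A) i powr (2 * e i)) else 0)"

lemma borel_measurable_mtr:
  "f \<in> M \<rightarrow>\<^sub>M mat_space \<Longrightarrow> (\<lambda>w. mtr m (f w)) \<in> borel_measurable M"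
  unfolding mtr_def by (intro borel_measurable_sum borel_measurable_qre measurable_mat_entry)

lemma borel_measurable_dg_chol:
  assumes "\<beta> \<in> {1,2,4}" "f \<in> M \<rightarrow>\<^sub>M mat_space"
  shows "(\<lambda>w. dg (chol \<beta> m (f w)) i) \<in> borel_measurable M"
  unfolding dg_def by (intro borel_measurable_qre measurable_mat_entry[OF measurable_chol[OF assms]])

lemma borel_measurable_riesz_kernel:
  assumes "\<beta> \<in> {1,2,4}" "f \<in> M \<rightarrow>\<^sub>M mat_space"
  shows "(\<lambda>w. riesz_kernel \<beta> m e (f w)) \<in> borel_measurable M"
proof -
  note [measurable] = pred_pd[OF assms] borel_measurable_mtr[OF assms(2)] borel_measurable_dg_chol[OF assms]
  show ?thesis unfolding riesz_kernel_def by measurable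
qed

lemma mtr_gram: "mtr m (mmul n (ctr T) T) = (\<Sum>k<n. \<Sum>j<m. qnsq (T k j))"
  unfolding mtr_def mmul_def ctr_def by (simp add: qre_linear sum.swap[of _ "{..<n}"])

text \<open>At \<open>T* T\<close> the trace is the sum of the squared norms of the entries of
  \<open>T\<close>, so the integrand factors over coordinates. Each of the \<open>m - Suc i\<close>
  entries to the right of the diagonal contributes \<open>\<beta>\<close> slopes
  \<open>dg T i\<close>, which adds \<open>\<beta> * (m - Suc i) / 2\<close> to the exponent of the
  squared diagonal coordinate. The identity includes infinite values; this is how divergence is
  detected later.\<close>

lemma nn_integral_riesz_kernel_prod:
  assumes beta: "\<beta> \<in> {1,2,4}"
  shows "(\<integral>\<^sup>+A. ennreal (riesz_kernel \<beta> m e A) \<partial>lebH \<beta> m) =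
    (\<Prod>i<m. \<integral>\<^sup>+t. ennreal (exp (- real \<beta> * t) * t powr (e i + real \<beta> * real (m - Suc i) / 2)) * indicator {0<..} t \<partial>lborel)
    * (\<Prod>i<m. \<Prod>j\<in>{i<..<m}. \<Prod>c<\<beta>. \<integral>\<^sup>+t. ennreal (exp (- real \<beta> * t\<^sup>2)) \<partial>lborel)"
proof -
  let ?I = "herm_idx \<beta> m" and ?t = "tri_decode \<beta> m"
  define r where "r i = real \<beta> * real (m - Suc i) / 2" for i
  define h where "h = (\<lambda>(i, j, c :: nat) t. if i = j then exp (- real \<beta> * t) * t powr (e i + r i)
    else exp (- real \<beta> * t\<^sup>2))"
  define g where "g = (\<lambda>k t. ennreal (h k t) * indicator (herm_dom k) t)"
  have g_meas: "g k \<in> borel_measurable borel" for k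
    by (cases k) (auto simp: g_def h_def herm_dom_def)
  interpret product_sigma_finite "\<lambda>_::nat \<times> nat \<times> nat. lborel :: real measure" ..
  have ptw: "ennreal (riesz_kernel \<beta> m e (mmul m (ctr (?t x)) (?t x)))
      * (\<Prod>k\<in>?I. ennreal (herm_scale k x) * indicator (herm_dom k) (x k)) = (\<Prod>k\<in>?I. g k (x k))" for x
  proof (cases "\<forall>k\<in>?I. x k \<in> herm_dom k")
    case True
    have x: "0 < x (i, i, 0)" if "i < m" for i
      using bspec[OF True, of "(i, i, 0)"] that by (auto simp: herm_idx_def herm_dom_def)
    have T: "upper_pos \<beta> m (?t x)" by (rule upper_pos_tri_decode[of \<beta> m x, OF beta x])
    have row: "(\<Sum>j<m. qnsq (?t x k j)) = x (k, k, 0) + (\<Sum>j\<in>{k<..<m}. \<Sum>c<\<beta>. (x (k, j, c))\<^sup>2)" if k: "k < m" for k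
    proof -
      have "(\<Sum>j<m. qnsq (?t x k j)) = (\<Sum>j<Suc k. qnsq (?t x k j)) + (\<Sum>j\<in>{k<..<m}. qnsq (?t x k j))"
        unfolding lessThan_atLeast0 atLeastSucLessThan_greaterThanLessThan [symmetric]
        by (rule sum.atLeastLessThan_concat [symmetric]) (use k in auto)
      then have "(\<Sum>j<m. qnsq (?t x k j)) = (\<Sum>j<k. qnsq (?t x k j)) + (qnsq (?t x k k) + (\<Sum>j\<in>{k<..<m}. qnsq (?t x k j)))"
        by simp
      moreover have "(\<Sum>j<k. qnsq (?t x k j)) = 0" by (simp add: tri_decode_lower)
      moreover have "qnsq (?t x k k) = x (k, k, 0)" using x[OF k] k by (simp add: tri_decode_diag)
      moreover have "(\<Sum>j\<in>{k<..<m}. qnsq (?t x k j)) = (\<Sum>j\<in>{k<..<m}. \<Sum>c<\<beta>. (x (k, j, c))\<^sup>2)"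
        by (intro sum.cong refl) (simp add: tri_decode_def qnsq_coord_entry[OF beta])
      ultimately show ?thesis by simp
    qed
    have exp: "exp (- real \<beta> * mtr m (mmul m (ctr (?t x)) (?t x)))
        = (\<Prod>k<m. exp (- real \<beta> * x (k, k, 0)) * (\<Prod>j\<in>{k<..<m}. \<Prod>c<\<beta>. exp (- real \<beta> * (x (k, j, c))\<^sup>2)))"
    proof -
      have "- real \<beta> * mtr m (mmul m (ctr (?t x)) (?t x))
          = (\<Sum>k<m. - real \<beta> * x (k, k, 0) + (\<Sum>j\<in>{k<..<m}. \<Sum>c<\<beta>. - real \<beta> * (x (k, j, c))\<^sup>2))"
        by (simp add: mtr_gram row distrib_left sum_distrib_left sum.distrib sum_negf sum_subtractf)
      then show ?thesis
        by (simp only: exp_sum exp_add finite_lessThan finite_greaterThanLessThan)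
    qed
    have pw: "dg (?t x) i powr (2 * e i) = x (i, i, 0) powr e i" if "i < m" for i
      using x[OF that] by (simp add: dg_tri_decode[OF that] powr_powr flip: powr_half_sqrt)
    have scale: "(\<Prod>k\<in>?I. herm_scale k x) = (\<Prod>i<m. x (i, i, 0) powr r i)"
    proof -
      have "(\<Prod>j\<in>{i<..<m}. \<Prod>c<\<beta>. herm_scale (i, j, c) x) = x (i, i, 0) powr r i" if "i < m" for i
      proof -
        have "(\<Prod>j\<in>{i<..<m}. \<Prod>c<\<beta>. herm_scale (i, j, c) x) = (\<Prod>j\<in>{i<..<m}. \<Prod>c<\<beta>. sqrt (x (i, i, 0)))"
          by (intro prod.cong refl) (auto simp: herm_scale_def)
        also have "\<dots> = sqrt (x (i, i, 0)) ^ (\<beta> * (m - Suc i))"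
          by (simp add: power_mult)
        also have "\<dots> = x (i, i, 0) powr r i"
          using x[OF that] by (simp add: r_def powr_powr flip: powr_half_sqrt powr_realpow)
        finally show ?thesis .
      qed
      moreover have "herm_scale (i, i, 0) x = 1" for i by (simp add: herm_scale_def)
      ultimately show ?thesis by (simp add: prod_herm_idx cong: prod.cong_simp)
    qed
    have "riesz_kernel \<beta> m e (mmul m (ctr (?t x)) (?t x)) * (\<Prod>k\<in>?I. herm_scale k x)
        = (\<Prod>k\<in>?I. h k (x k))"
    proof -
      have "riesz_kernel \<beta> m e (mmul m (ctr (?t x)) (?t x))
          = exp (- real \<beta> * mtr m (mmul m (ctr (?t x)) (?t x))) * (\<Prod>i<m. x (i, i, 0) powr e i)"
        using pd_upper[OF beta T] by (simp add: riesz_kernel_def chol_gram[OF T] pw cong: prod.cong_simp)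
      moreover have "(\<Prod>k\<in>?I. h k (x k)) = (\<Prod>i<m. exp (- real \<beta> * x (i, i, 0)) * x (i, i, 0) powr (e i + r i))
          * (\<Prod>i<m. \<Prod>j\<in>{i<..<m}. \<Prod>c<\<beta>. exp (- real \<beta> * (x (i, j, c))\<^sup>2))"
        unfolding prod_herm_idx by (intro arg_cong2[where f = "(*)"] prod.cong refl) (auto simp: h_def)
      ultimately show ?thesis
        unfolding scale exp by (simp only: prod.distrib powr_add mult_ac)
    qed
    moreover have "0 \<le> herm_scale k x" if "k \<in> ?I" for k
      using x that by (auto simp: herm_scale_def herm_idx_def intro!: less_imp_le)
    moreover have "0 \<le> h k t" for k t by (cases k) (simp add: h_def)
    moreover have "0 \<le> riesz_kernel \<beta> m e A" for A
      by (simp add: riesz_kernel_def prod_nonneg)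
    ultimately show ?thesis
      using True by (simp add: g_def prod_ennreal prod_nonneg flip: ennreal_mult)
  next
    case False
    then have "(\<Prod>k\<in>?I. ennreal (herm_scale k x) * indicator (herm_dom k) (x k)) = 0" "(\<Prod>k\<in>?I. g k (x k)) = 0"
      by (intro prod_zero; auto simp: indicator_def g_def)+
    then show ?thesis by (simp only: mult_zero_right)
  qed
  have "(\<integral>\<^sup>+A. ennreal (riesz_kernel \<beta> m e A) \<partial>lebH \<beta> m) = (\<integral>\<^sup>+x. (\<Prod>k\<in>?I. g k (x k)) \<partial>(\<Pi>\<^sub>M i\<in>?I. lborel))"
    unfolding ptw [symmetric]
  proof (rule nn_integral_lebH_cholesky[OF beta])
    show "(\<lambda>A. ennreal (riesz_kernel \<beta> m e A)) \<in> borel_measurable mat_space"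
      using borel_measurable_riesz_kernel[OF beta, of "\<lambda>A. A" mat_space] by simp
    show "pd \<beta> m A" if "ennreal (riesz_kernel \<beta> m e A) \<noteq> 0" for A
      using that by (simp add: riesz_kernel_def split: if_splits)
  qed
  also have "\<dots> = (\<Prod>k\<in>?I. integral\<^sup>N lborel (g k))"
    by (rule product_nn_integral_prod) (simp_all add: g_meas)
  also have "\<dots> = (\<Prod>i<m. integral\<^sup>N lborel (g (i, i, 0))) * (\<Prod>i<m. \<Prod>j\<in>{i<..<m}. \<Prod>c<\<beta>. integral\<^sup>N lborel (g (i, j, c)))"
    by (rule prod_herm_idx)
  finally show ?thesis
    by (simp add: g_def h_def herm_dom_def r_def cong: prod.cong_simp)
qed

lemma sum_lessThan_real: "(\<Sum>i<m. real i) = real m * (real m - 1) / 2"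
  by (induction m) (auto simp: field_simps)

text \<open>The diagonal coordinates give gamma integrals. \<open>N\<close> is half the number of
  real coordinates above the diagonal, each of which contributes \<open>sqrt (pi / \<beta>)\<close>.
  The powers of \<open>\<beta>\<close> combine because \<open>N\<close> is also the sum of the
  shifts \<open>i * \<beta> / 2\<close>.\<close>

lemma nn_integral_riesz_kernel:
  assumes beta: "\<beta> \<in> {1,2,4}" and pos: "\<And>i. i < m \<Longrightarrow> 0 < a + \<kappa> i - real i * real \<beta> / 2"
  shows "(\<integral>\<^sup>+A. ennreal (riesz_kernel \<beta> m (\<lambda>i. a - (real m - 1) * real \<beta> / 2 - 1 + \<kappa> i) A) \<partial>lebH \<beta> m) =
    ennreal (gammam \<beta> m a \<kappa> / real \<beta> powr (a * real m + (\<Sum>i<m. \<kappa> i)))"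
proof -
  define \<alpha> where "\<alpha> i = a + \<kappa> i - real i * real \<beta> / 2" for i
  have b: "0 < real \<beta>" using beta by auto
  \<comment> \<open>The Jacobian exponent turns the common shift
    \<open>(m - 1) * \<beta> / 2\<close> into \<open>i * \<beta> / 2\<close>, the shift in the gamma
    factor of index \<open>i\<close>.\<close>
  have e: "a - (real m - 1) * real \<beta> / 2 - 1 + \<kappa> i + real \<beta> * real (m - Suc i) / 2 = \<alpha> i - 1" if "i < m" for i
    using that by (simp add: \<alpha>_def of_nat_diff field_simps)
  have \<alpha>: "0 < \<alpha> i" if "i < m" for i using pos[OF that] by (simp add: \<alpha>_def)
  define N where "N = real m * (real m - 1) * real \<beta> / 4"
  have gauss: "(\<Prod>i<m. \<Prod>j\<in>{i<..<m}. \<Prod>c<\<beta>. ennreal (sqrt (pi / real \<beta>))) = ennreal ((pi / real \<beta>) powr N)"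
  proof -
    have "(\<Prod>i<m. \<Prod>j\<in>{i<..<m}. \<Prod>c<\<beta>. sqrt (pi / real \<beta>)) = sqrt (pi / real \<beta>) ^ (\<Sum>i<m. \<beta> * (m - Suc i))"
      by (simp add: power_mult power_sum)
    also have "\<dots> = (pi / real \<beta>) powr (real (\<Sum>i<m. \<beta> * (m - Suc i)) / 2)"
      using b by (simp add: powr_powr flip: powr_half_sqrt powr_realpow)
    also have "real (\<Sum>i<m. \<beta> * (m - Suc i)) = real \<beta> * (\<Sum>i<m. real i)"
      using sum.nat_diff_reindex[of real m] by (simp flip: sum_distrib_left)
    finally have "(\<Prod>i<m. \<Prod>j\<in>{i<..<m}. \<Prod>c<\<beta>. sqrt (pi / real \<beta>)) = (pi / real \<beta>) powr N"
      by (simp add: sum_lessThan_real N_def mult_ac)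
    moreover have "(\<Prod>i<m. \<Prod>j\<in>{i<..<m}. \<Prod>c<\<beta>. ennreal (sqrt (pi / real \<beta>)))
        = ennreal (\<Prod>i<m. \<Prod>j\<in>{i<..<m}. \<Prod>c<\<beta>. sqrt (pi / real \<beta>))"
      by (simp add: prod_ennreal prod_nonneg del: prod_constant)
    ultimately show ?thesis by (simp only:)
  qed
  have "(\<integral>\<^sup>+A. ennreal (riesz_kernel \<beta> m (\<lambda>i. a - (real m - 1) * real \<beta> / 2 - 1 + \<kappa> i) A) \<partial>lebH \<beta> m)
      = (\<Prod>i<m. ennreal (Gamma (\<alpha> i) / real \<beta> powr \<alpha> i)) * ennreal ((pi / real \<beta>) powr N)"
    unfolding nn_integral_riesz_kernel_prod[OF beta] nn_integral_gaussian[OF b] gauss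
    using \<alpha> b by (intro arg_cong2[where f = "(*)"] prod.cong refl)
      (simp only: e lessThan_iff nn_integral_gamma_density)
  also have "\<dots> = ennreal ((\<Prod>i<m. Gamma (\<alpha> i) / real \<beta> powr \<alpha> i) * (pi / real \<beta>) powr N)"
    using \<alpha> by (subst prod_ennreal, simp add: Gamma_real_pos less_imp_le, subst ennreal_mult)
      (auto intro!: prod_nonneg simp: Gamma_real_pos less_imp_le)
  also have "(\<Prod>i<m. Gamma (\<alpha> i) / real \<beta> powr \<alpha> i) * (pi / real \<beta>) powr N
      = pi powr N * (\<Prod>i<m. Gamma (\<alpha> i)) / (real \<beta> powr (\<Sum>i<m. \<alpha> i) * real \<beta> powr N)"
    using b by (simp add: prod_dividef powr_divide powr_sum)
  also have "real \<beta> powr (\<Sum>i<m. \<alpha> i) * real \<beta> powr N = real \<beta> powr (a * real m + (\<Sum>i<m. \<kappa> i))"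
  proof -
    have "(\<Sum>i<m. \<alpha> i) = a * real m + (\<Sum>i<m. \<kappa> i) - (\<Sum>i<m. real i) * (real \<beta> / 2)"
      by (simp add: \<alpha>_def sum.distrib sum_subtractf sum_distrib_right)
    then have "(\<Sum>i<m. \<alpha> i) + N = a * real m + (\<Sum>i<m. \<kappa> i)"
      by (simp add: sum_lessThan_real N_def field_simps)
    then show ?thesis by (simp flip: powr_add)
  qed
  also have "pi powr N * (\<Prod>i<m. Gamma (\<alpha> i)) = gammam \<beta> m a \<kappa>"
    by (simp add: gammam_def N_def \<alpha>_def)
  finally show ?thesis .
qed

text \<open>In the product formula a nonpositive parameter makes one factor infinite, and no other
  factor vanishes, so the whole integral diverges.\<close>

lemma nn_integral_riesz_kernel_finite_imp:
  assumes beta: "\<beta> \<in> {1,2,4}"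
    and fin: "(\<integral>\<^sup>+A. ennreal (riesz_kernel \<beta> m (\<lambda>i. a - (real m - 1) * real \<beta> / 2 - 1 + \<kappa> i) A) \<partial>lebH \<beta> m) < \<infinity>"
    and i: "i < m"
  shows "0 < a + \<kappa> i - real i * real \<beta> / 2"
proof (rule ccontr)
  define \<alpha> where "\<alpha> i = a + \<kappa> i - real i * real \<beta> / 2" for i
  define J where "J \<alpha> = (\<integral>\<^sup>+t. ennreal (exp (- real \<beta> * t) * t powr (\<alpha> - 1)) * indicator {0<..} t \<partial>lborel)" for \<alpha>
  have b: "0 < real \<beta>" using beta by auto
  have e: "a - (real m - 1) * real \<beta> / 2 - 1 + \<kappa> i + real \<beta> * real (m - Suc i) / 2 = \<alpha> i - 1" if "i < m" for i
    using that by (simp add: \<alpha>_def of_nat_diff field_simps)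
  \<comment> \<open>Rules out the convention that zero times infinity is zero.\<close>
  have J: "J \<alpha> \<noteq> 0" for \<alpha>
    using nn_integral_gamma_density[of \<alpha>, OF _ b] nn_integral_gamma_density_diverges[of \<alpha>, OF _ b] b
    by (cases "0 < \<alpha>") (auto simp: J_def Gamma_real_pos ennreal_eq_0_iff not_le)
  assume "\<not> 0 < a + \<kappa> i - real i * real \<beta> / 2"
  then have "J (\<alpha> i) = \<infinity>"
    unfolding J_def \<alpha>_def by (intro nn_integral_gamma_density_diverges b) simp
  then have "(\<Prod>i<m. J (\<alpha> i)) = \<infinity>"
    using i J by (subst prod.remove[of _ i]) (auto simp: ennreal_top_mult)
  moreover have "(\<integral>\<^sup>+A. ennreal (riesz_kernel \<beta> m (\<lambda>i. a - (real m - 1) * real \<beta> / 2 - 1 + \<kappa> i) A) \<partial>lebH \<beta> m)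
      = (\<Prod>i<m. J (\<alpha> i)) * (\<Prod>i<m. \<Prod>j\<in>{i<..<m}. \<Prod>c<\<beta>. ennreal (sqrt (pi / real \<beta>)))"
    unfolding nn_integral_riesz_kernel_prod[OF beta] nn_integral_gaussian[OF b] J_def
    by (intro arg_cong2[where f = "(*)"] prod.cong refl) (simp only: e lessThan_iff)
  moreover have "(\<Prod>i<m. \<Prod>j\<in>{i<..<m}. \<Prod>c<\<beta>. ennreal (sqrt (pi / real \<beta>))) \<noteq> 0"
    using b by (simp add: prod_zero_iff ennreal_eq_0_iff not_le)
  ultimately show False
    using fin b by (simp only: infinity_ennreal_def ennreal_top_mult if_False less_irrefl)
qed

section \<open>Gram matrices are almost everywhere positive definite\<close>

lemma sets_lebM [simp, measurable_cong]: "sets (lebM \<beta> n m) = sets mat_space"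
  and sets_lebH [simp, measurable_cong]: "sets (lebH \<beta> m) = sets mat_space"
  and space_lebM [simp]: "space (lebM \<beta> n m) = UNIV"
  and space_lebH [simp]: "space (lebH \<beta> m) = UNIV"
  by (simp_all add: lebM_def lebH_def)

lemma AE_lebM_iff:
  assumes "Measurable.pred mat_space P"
  shows "(AE X in lebM \<beta> n m. P X) \<longleftrightarrow> (AE x in (\<Pi>\<^sub>M i\<in>mat_idx \<beta> n m. lborel). P (mat_decode \<beta> n m x))"
  unfolding lebM_def
  using assms by (intro AE_distr_iff measurable_PiM_UNIV_compose[OF measurable_mat_decode]) (simp add: pred_def)

lemma AE_lebM_mats: "\<beta> \<in> {1,2,4} \<Longrightarrow> AE X in lebM \<beta> n m. X \<in> mats \<beta> n m"
  by (subst AE_lebM_iff) (rule pred_mats, assumption, rule measurable_ident_sets, rule refl, intro AE_I2 mat_decode_mats)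

definition lead_block :: "nat \<Rightarrow> qmat \<Rightarrow> qmat" where
  "lead_block r A = (\<lambda>i j. if i < r \<and> j < r then A i j else 0)"

text \<open>Singularity is expressed by right kernels over the algebra instead of a determinant,
  which suits noncommuting entries: multiplying a kernel vector from the right by a scalar of the
  algebra leaves it in the kernel.\<close>

definition singular_block :: "nat \<Rightarrow> nat \<Rightarrow> qmat \<Rightarrow> bool" where
  "singular_block \<beta> r A \<longleftrightarrow> (\<exists>x. (\<forall>l. in_alg \<beta> (x l)) \<and> (\<forall>i<r. (\<Sum>l<r. qmul (A i l) (x l)) = 0) \<and> (\<exists>l<r. x l \<noteq> 0))"

text \<open>Reduces singularity to definiteness of a Gram matrix, for which measurability is already
  available.\<close>

lemma singular_block_iff:
  assumes beta: "\<beta> \<in> {1,2,4}" and A: "A \<in> mats \<beta> n m"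
  shows "singular_block \<beta> r A \<longleftrightarrow> \<not> pd \<beta> r (mmul r (ctr (lead_block r A)) (lead_block r A))"
proof -
  have L: "lead_block r A \<in> mats \<beta> r r"
    using A by (intro matsI) (auto simp: lead_block_def)
  have *: "mvec r (lead_block r A) x i = (\<Sum>l<r. qmul (A i l) (x l))" if "i < r" for x i
    using that by (simp add: mvec_def lead_block_def)
  have "singular_block \<beta> r A \<longleftrightarrow> (\<exists>x. (\<forall>l<r. in_alg \<beta> (x l)) \<and> (\<forall>i<r. (\<Sum>l<r. qmul (A i l) (x l)) = 0) \<and> (\<exists>l<r. x l \<noteq> 0))"
  proof
    assume "\<exists>x. (\<forall>l<r. in_alg \<beta> (x l)) \<and> (\<forall>i<r. (\<Sum>l<r. qmul (A i l) (x l)) = 0) \<and> (\<exists>l<r. x l \<noteq> 0)"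
    then obtain x where "\<forall>l<r. in_alg \<beta> (x l)" "\<forall>i<r. (\<Sum>l<r. qmul (A i l) (x l)) = 0" "\<exists>l<r. x l \<noteq> 0" by blast
    then show "singular_block \<beta> r A"
      unfolding singular_block_def by (intro exI[of _ "\<lambda>l. if l < r then x l else 0"]) auto
  qed (auto simp: singular_block_def)
  then show ?thesis
    unfolding pd_gram_iff[OF beta L] by (auto simp: *)
qed

text \<open>A kernel vector of the larger block with last entry zero would be one of the smaller
  block. So the last entry is invertible, and multiplication by its inverse from the right, which
  commutes with the action of \<open>A\<close>, makes it 1.\<close>

lemma singular_block_normalized:
  assumes beta: "\<beta> \<in> {1,2,4}" and s: "singular_block \<beta> (Suc r) A" "\<not> singular_block \<beta> r A"
  obtains y where "\<And>l. in_alg \<beta> (y l)" "\<And>i. i \<le> r \<Longrightarrow> (\<Sum>l<r. qmul (A i l) (y l)) = - A i r"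
proof -
  from s(1) obtain x where x: "\<And>l. in_alg \<beta> (x l)" "\<And>i. i < Suc r \<Longrightarrow> (\<Sum>l<Suc r. qmul (A i l) (x l)) = 0"
    "\<exists>l<Suc r. x l \<noteq> 0" unfolding singular_block_def by blast
  have xr: "x r \<noteq> 0"
  proof
    assume "x r = 0"
    then have "(\<Sum>l<r. qmul (A i l) (x l)) = 0" if "i < r" for i
      using x(2)[of i] that by (simp add: qmul.zero_right)
    moreover have "\<exists>l<r. x l \<noteq> 0" using x(3) \<open>x r = 0\<close> by (metis less_Suc_eq)
    ultimately show False using s(2) x(1) unfolding singular_block_def by blast
  qed
  define q where "q = (1 / qnsq (x r)) *\<^sub>R qcnj (x r)"
  have q: "qmul (x r) q = qof_real 1"
    using xr by (simp add: q_def qmul.scaleR_right)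
  show thesis
  proof (rule that[of "\<lambda>l. qmul (x l) q"])
    show "in_alg \<beta> (qmul (x l) q)" for l
      unfolding q_def by (intro in_alg_qmul[OF beta] in_alg_scaleR in_alg_qcnj x(1))
    fix i assume "i \<le> r"
    then have "(\<Sum>l<r. qmul (A i l) (x l)) = - qmul (A i r) (x r)"
      using x(2)[of i] by (simp add: eq_neg_iff_add_eq_0)
    then have "qmul (\<Sum>l<r. qmul (A i l) (x l)) q = - qmul (qmul (A i r) (x r)) q"
      by (simp add: qmul.minus_left)
    then show "(\<Sum>l<r. qmul (A i l) (qmul (x l) q)) = - A i r"
      by (simp add: qmul.sum_left qmul_assoc q)
  qed
qed

text \<open>If the leading \<open>r\<close>-block is regular, singularity of the next one determines its last diagonal
  entry, so the exceptional set is null by Tonelli's theorem in that coordinate.\<close>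

lemma singular_block_diag_unique:
  assumes beta: "\<beta> \<in> {1,2,4}"
    and A: "singular_block \<beta> (Suc r) A" "\<not> singular_block \<beta> r A"
    and B: "singular_block \<beta> (Suc r) B"
    and eq: "\<And>i j. i \<le> r \<Longrightarrow> j \<le> r \<Longrightarrow> (i, j) \<noteq> (r, r) \<Longrightarrow> A i j = B i j"
  shows "A r r = B r r"
proof -
  have "singular_block \<beta> r A \<longleftrightarrow> singular_block \<beta> r B"
    unfolding singular_block_def using eq by simp
  then have "\<not> singular_block \<beta> r B" using A by simp
  then obtain z where z: "\<And>l. in_alg \<beta> (z l)" "\<And>i. i \<le> r \<Longrightarrow> (\<Sum>l<r. qmul (B i l) (z l)) = - B i r"
    using singular_block_normalized[OF beta B] by blast
  obtain y where y: "\<And>l. in_alg \<beta> (y l)" "\<And>i. i \<le> r \<Longrightarrow> (\<Sum>l<r. qmul (A i l) (y l)) = - A i r"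
    using singular_block_normalized[OF beta A] by blast
  have B_A: "(\<Sum>l<r. qmul (B i l) (z l)) = (\<Sum>l<r. qmul (A i l) (z l))" if "i \<le> r" for i
    using that eq by (intro sum.cong) auto
  \<comment> \<open>The rows before \<open>r\<close> agree in \<open>A\<close> and \<open>B\<close>,
    so the difference of the two normalised vectors lies in the kernel of the regular block and
    vanishes. Row \<open>r\<close> then expresses both diagonal entries by the same sum.\<close>
  have ker: "(\<Sum>l<r. qmul (A i l) (y l - z l)) = 0" if "i < r" for i
    using that y(2)[of i] z(2)[of i] B_A[of i] eq[of i r] by (simp add: qmul.diff_right sum_subtractf)
  have alg: "in_alg \<beta> (y l - z l)" for l by (intro in_alg_diff y z)
  have "y l - z l = 0" if "l < r" for l
  proof (rule ccontr)
    assume "y l - z l \<noteq> 0"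
    then have "singular_block \<beta> r A"
      unfolding singular_block_def using that ker alg
      by (intro exI[of _ "\<lambda>l. y l - z l"]) auto
    with A(2) show False by simp
  qed
  then have "(\<Sum>l<r. qmul (A r l) (y l)) = (\<Sum>l<r. qmul (A r l) (z l))"
    by (intro sum.cong) auto
  then show ?thesis using y(2)[of r] z(2)[of r] B_A[of r] by simp
qed

lemma AE_lebM_regular_block:
  assumes beta: "\<beta> \<in> {1,2,4}" and r: "r \<le> n" "r \<le> m"
  shows "AE x in (\<Pi>\<^sub>M i\<in>mat_idx \<beta> n m. lborel). \<not> singular_block \<beta> r (mat_decode \<beta> n m x)"
  using r
proof (induction r)
  case 0
  then show ?case by (simp add: singular_block_def)
next
  case (Suc r)
  let ?d = "mat_decode \<beta> n m" and ?k = "(r, r, 0 :: nat)"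
  define J where "J = mat_idx \<beta> n m - {?k}"
  have J: "mat_idx \<beta> n m = insert ?k J" "?k \<notin> J" "finite J"
    using Suc.prems beta by (auto simp: J_def mat_idx_def)
  let ?P = "\<lambda>I. \<Pi>\<^sub>M i\<in>I. (lborel :: real measure)"
  interpret product_sigma_finite "\<lambda>_::nat \<times> nat \<times> nat. lborel :: real measure" ..
  have block: "(\<lambda>A. lead_block r A) \<in> mat_space \<rightarrow>\<^sub>M mat_space" for r
  proof (rule measurable_mat_spaceI)
    fix i j
    show "(\<lambda>A. lead_block r A i j) \<in> borel_measurable mat_space"
      using measurable_mat_entry[of "\<lambda>A. A" mat_space i j]
      by (cases "i < r \<and> j < r") (auto simp: lead_block_def)
  qed
  have gram: "(\<lambda>A. mmul r (ctr (lead_block r A)) (lead_block r A)) \<in> mat_space \<rightarrow>\<^sub>M mat_space" for r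
    by (intro measurable_mmul measurable_ctr block)
  have sing [measurable]: "Measurable.pred (?P (mat_idx \<beta> n m)) (\<lambda>x. singular_block \<beta> r (?d x))" for r
    unfolding singular_block_iff[OF beta mat_decode_mats[OF beta]]
    by (intro pred_intros_logic pred_pd[OF beta]
        measurable_compose[OF measurable_PiM_UNIV_compose[OF measurable_mat_decode] gram])
  let ?E = "\<lambda>x. singular_block \<beta> (Suc r) (?d x) \<and> \<not> singular_block \<beta> r (?d x)"
  define E where "E = {x \<in> space (?P (mat_idx \<beta> n m)). ?E x}"
  have E: "E \<in> sets (?P (mat_idx \<beta> n m))" unfolding E_def by measurable
  have "emeasure (?P (mat_idx \<beta> n m)) E = (\<integral>\<^sup>+x. indicator E x \<partial>?P (insert ?k J))"
    using E by (simp add: J)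
  also have "\<dots> = (\<integral>\<^sup>+x. \<integral>\<^sup>+t. indicator E (x(?k := t)) \<partial>lborel \<partial>?P J)"
    by (rule product_nn_integral_insert[OF J(3,2)]) (use E in \<open>simp add: J\<close>)
  also have "\<dots> = (\<integral>\<^sup>+x. 0 \<partial>?P J)"
  proof (rule nn_integral_cong)
    fix x :: "nat \<times> nat \<times> nat \<Rightarrow> real"
    \<comment> \<open>Along this fibre only the real part of entry \<open>(r, r)\<close> varies, so
      uniqueness of that entry leaves at most one point.\<close>
    have unique: "t = t'" if "x(?k := t) \<in> E" "x(?k := t') \<in> E" for t t'
    proof -
      have "?d (x(?k := t)) r r = ?d (x(?k := t')) r r"
      proof (rule singular_block_diag_unique[where A = "?d (x(?k := t))" and B = "?d (x(?k := t'))", OF beta])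
        show "singular_block \<beta> (Suc r) (?d (x(?k := t)))" "\<not> singular_block \<beta> r (?d (x(?k := t)))"
          "singular_block \<beta> (Suc r) (?d (x(?k := t')))"
          using that unfolding E_def by blast+
        show "?d (x(?k := t)) i j = ?d (x(?k := t')) i j" if "(i, j) \<noteq> (r, r)" for i j
          using that by (intro mat_decode_cong[OF _ beta]) auto
      qed
      then have "?d (x(?k := t)) r r $ 0 = ?d (x(?k := t')) r r $ 0" by simp
      then show ?thesis using Suc.prems by (simp add: mat_decode_def coord_entry_def)
    qed
    show "(\<integral>\<^sup>+t. indicator E (x(?k := t)) \<partial>lborel) = 0"
    proof (cases "\<exists>t. x(?k := t) \<in> E")
      case True
      then obtain t0 where t0: "x(?k := t0) \<in> E" by blast
      have "(\<integral>\<^sup>+t. indicator E (x(?k := t)) \<partial>lborel) \<le> (\<integral>\<^sup>+t. indicator {t0} t \<partial>lborel)"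
        using unique[OF t0] by (intro nn_integral_mono) (auto simp: indicator_def)
      also have "\<dots> = 0" by simp
      finally show ?thesis by simp
    qed (simp add: indicator_def)
  qed
  finally have "AE x in ?P (mat_idx \<beta> n m). \<not> ?E x"
    using E by (subst AE_iff_measurable[OF E]) (auto simp: E_def)
  with Suc show ?case by auto
qed

text \<open>Regularity of the block formed by the first \<open>m\<close> rows, present because
  \<open>m \<le> n\<close>, already makes the kernel of the whole matrix trivial.\<close>

lemma AE_lebM_gram_pd:
  assumes beta: "\<beta> \<in> {1,2,4}" and mn: "m \<le> n"
  shows "AE R in lebM \<beta> n m. pd \<beta> m (mmul n (ctr R) R)"
proof (subst AE_lebM_iff)
  show "Measurable.pred mat_space (\<lambda>R. pd \<beta> m (mmul n (ctr R) R))"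
    by (intro pred_pd[OF beta] measurable_mmul measurable_ctr) auto
  have "pd \<beta> m (mmul n (ctr A) A)" if A: "A \<in> mats \<beta> n m" "\<not> singular_block \<beta> m A" for A
    unfolding pd_gram_iff[OF beta A(1)]
  proof (intro allI impI; elim conjE)
    fix x i assume x: "\<forall>i<m. in_alg \<beta> (x i)" "\<forall>l<n. mvec m A x l = 0" and i: "i < m"
    show "x i = 0"
    proof (rule ccontr)
      assume "x i \<noteq> 0"
      with i x mn have "singular_block \<beta> m A"
        unfolding singular_block_def mvec_def
        by (intro exI[of _ "\<lambda>l. if l < m then x l else 0"]) auto
      with A(2) show False by simp
    qed
  qed
  then show "AE x in (\<Pi>\<^sub>M i\<in>mat_idx \<beta> n m. lborel). pd \<beta> m (mmul n (ctr (mat_decode \<beta> n m x)) (mat_decode \<beta> n m x))"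
    using AE_lebM_regular_block[OF beta mn order.refl] mat_decode_mats[OF beta] by (auto elim!: eventually_mono)
qed

text \<open>Both measures are images of finite products of one-dimensional Lebesgue measure.
  Sigma-finiteness holds for these products, so Tonelli's theorem is applied to the
  coordinates.\<close>

lemma nn_integral_lebH_lebM_swap:
  assumes G: "(\<lambda>(V, X). G V X) \<in> borel_measurable (mat_space \<Otimes>\<^sub>M mat_space)"
  shows "(\<integral>\<^sup>+V. \<integral>\<^sup>+X. G V X \<partial>lebM \<beta> n m \<partial>lebH \<beta>' m') = (\<integral>\<^sup>+X. \<integral>\<^sup>+V. G V X \<partial>lebH \<beta>' m' \<partial>lebM \<beta> n m)"
proof -
  let ?H = "\<Pi>\<^sub>M i\<in>herm_idx \<beta>' m'. (lborel :: real measure)" and ?J = "\<Pi>\<^sub>M i\<in>mat_idx \<beta> n m. (lborel :: real measure)"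
  let ?h = "herm_decode \<beta>' m'" and ?d = "mat_decode \<beta> n m"
  interpret product_sigma_finite "\<lambda>_::nat \<times> nat \<times> nat. lborel :: real measure" ..
  interpret H: sigma_finite_measure ?H by (rule sigma_finite) simp
  interpret J: sigma_finite_measure ?J by (rule sigma_finite) simp
  interpret HJ: pair_sigma_finite ?H ?J ..
  have h: "?h \<in> ?H \<rightarrow>\<^sub>M mat_space" and d: "?d \<in> ?J \<rightarrow>\<^sub>M mat_space"
    by (rule measurable_PiM_UNIV_compose[OF measurable_herm_decode] measurable_PiM_UNIV_compose[OF measurable_mat_decode])+
  have G1: "G V \<in> borel_measurable mat_space" for V
    using measurable_compose[OF measurable_Pair1' G, of V] by simp
  have G2: "(\<lambda>V. G V X) \<in> borel_measurable mat_space" for X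
    using measurable_compose[OF measurable_Pair2' G, of X] by simp
  have "(\<lambda>(V, x). G V (?d x)) \<in> borel_measurable (mat_space \<Otimes>\<^sub>M ?J)"
    using measurable_compose[OF measurable_Pair[OF measurable_fst measurable_compose[OF measurable_snd d]] G]
    by (simp add: case_prod_beta)
  then have G3: "(\<lambda>V. \<integral>\<^sup>+x. G V (?d x) \<partial>?J) \<in> borel_measurable mat_space"
    by (rule J.borel_measurable_nn_integral)
  have "(\<lambda>(X, x). G (?h x) X) \<in> borel_measurable (mat_space \<Otimes>\<^sub>M ?H)"
    using measurable_compose[OF measurable_Pair[OF measurable_compose[OF measurable_snd h] measurable_fst] G]
    by (simp add: case_prod_beta)
  then have G4: "(\<lambda>X. \<integral>\<^sup>+x. G (?h x) X \<partial>?H) \<in> borel_measurable mat_space"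
    by (rule H.borel_measurable_nn_integral)
  have G5: "(\<lambda>(x, y). G (?h x) (?d y)) \<in> borel_measurable (?H \<Otimes>\<^sub>M ?J)"
    using measurable_compose[OF measurable_Pair[OF measurable_compose[OF measurable_fst h] measurable_compose[OF measurable_snd d]] G]
    by (simp add: case_prod_beta)
  show ?thesis
    unfolding nn_integral_lebM[OF G1] nn_integral_lebH[OF G2] nn_integral_lebH[OF G3] nn_integral_lebM[OF G4]
    by (rule HJ.Fubini'[OF G5, symmetric])
qed

section \<open>Joint distribution\<close>

lemma borel_measurable_rsolve:
  assumes T: "T \<in> M \<rightarrow>\<^sub>M mat_space" and y: "\<And>j. (\<lambda>w. y w j) \<in> borel_measurable M"
  shows "(\<lambda>w. rsolve (T w) (y w) j) \<in> borel_measurable M"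
proof (induction j rule: less_induct)
  case (less j)
  have "(\<lambda>w. dg (T w) j) \<in> borel_measurable M"
    unfolding dg_def by (intro borel_measurable_qre measurable_mat_entry[OF T])
  moreover have "(\<lambda>w. \<Sum>l<j. qmul (rsolve (T w) (y w) l) (T w l j)) \<in> borel_measurable M"
    by (intro borel_measurable_sum borel_measurable_qmul less measurable_mat_entry[OF T]) simp
  ultimately show ?case
    unfolding rsolve.simps[of _ _ j] using y[of j] by measurable
qed

lemma measurable_uinv:
  assumes "T \<in> M \<rightarrow>\<^sub>M mat_space"
  shows "(\<lambda>w. uinv m (T w)) \<in> M \<rightarrow>\<^sub>M mat_space"
proof (rule measurable_mat_spaceI)
  fix i j
  show "(\<lambda>w. uinv m (T w) i j) \<in> borel_measurable M"
    using borel_measurable_rsolve[OF assms, of "\<lambda>_. idm m i" j]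
    by (cases "i < m \<and> j < m") (auto simp: uinv_def mrsolve_def)
qed

lemma measurable_minv_chol:
  assumes beta: "\<beta> \<in> {1,2,4}" and f: "f \<in> M \<rightarrow>\<^sub>M mat_space"
  shows "(\<lambda>w. minv \<beta> m (chol \<beta> m (f w))) \<in> M \<rightarrow>\<^sub>M mat_space"
proof -
  have "minv \<beta> m (chol \<beta> m (f w)) = (if pd \<beta> m (f w) then uinv m (chol \<beta> m (f w)) else minv \<beta> m (THE T. False))" for w
    using minv_upper[OF beta chol_pd(1)[OF beta]] chol_not_pd[OF beta] by simp
  then show ?thesis
    using pred_pd[OF beta f] measurable_uinv[OF measurable_chol[OF beta f]]
    by (simp only:) (rule measurable_If, auto)
qed

section \<open>Densities as powers of the Cholesky diagonal\<close>

lemma qpow_dg: "qpow \<beta> m \<kappa> A = (\<Prod>i<m. dg (chol \<beta> m A) i powr (2 * \<kappa> i))"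
  by (simp add: qpow_def dg_def)

lemma hdet_powr_qpow:
  assumes "\<beta> \<in> {1,2,4}" "pd \<beta> m A"
  shows "hdet \<beta> m A powr p * qpow \<beta> m \<kappa> A = (\<Prod>i<m. dg (chol \<beta> m A) i powr (2 * (p + \<kappa> i)))"
proof -
  have pos: "0 < dg (chol \<beta> m A) i" if "i < m" for i
    using upper_posD(4)[OF chol_pd(1)[OF assms] that] .
  have "hdet \<beta> m A powr p = (\<Prod>i<m. ((dg (chol \<beta> m A) i)\<^sup>2) powr p)"
    unfolding hdet_def dg_def by (rule prod_powr_distrib)
  also have "\<dots> = (\<Prod>i<m. dg (chol \<beta> m A) i powr (2 * p))"
    by (intro prod.cong refl) (simp add: powr_power[symmetric] powr_powr pos less_imp_le flip: powr_numeral)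
  finally show ?thesis
    by (simp add: qpow_dg distrib_left powr_add prod.distrib)
qed

lemma riesz_pdf_eq:
  assumes "\<beta> \<in> {1,2,4}"
  shows "riesz_pdf \<beta> m a \<kappa> A = real \<beta> powr (a * real m + (\<Sum>i<m. \<kappa> i)) / gammam \<beta> m a \<kappa>
    * riesz_kernel \<beta> m (\<lambda>i. a - (real m - 1) * real \<beta> / 2 - 1 + \<kappa> i) A"
  using hdet_powr_qpow[OF assms, of m A "a - (real m - 1) * real \<beta> / 2 - 1" \<kappa>]
  by (simp add: riesz_pdf_def riesz_kernel_def mult.assoc)

lemma kotz_riesz_pdf_eq:
  "kotz_riesz_pdf \<beta> n m \<tau> X = real \<beta> powr (real m * real n * real \<beta> / 2 + (\<Sum>i<m. \<tau> i)) *
        gammam \<beta> m (real n * real \<beta> / 2) (\<lambda>_. 0) /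
        (pi powr (real m * real n * real \<beta> / 2) * gammam \<beta> m (real n * real \<beta> / 2) \<tau>)
    * riesz_kernel \<beta> m \<tau> (mmul n (ctr X) X)"
  by (simp add: kotz_riesz_pdf_def riesz_kernel_def qpow_dg Let_def mult.assoc)

text \<open>The density of \<open>R\<close> without its constant. Definiteness is required of
  \<open>I - R* R\<close> only, as in \<open>pearson_riesz_pdf\<close>; where \<open>R* R\<close> is
  singular the power function has an unspecified value, which matters only on a null set when
  \<open>m \<le> n\<close>.\<close>

definition pearson_kernel :: "nat \<Rightarrow> nat \<Rightarrow> nat \<Rightarrow> (nat \<Rightarrow> real) \<Rightarrow> (nat \<Rightarrow> real) \<Rightarrow> qmat \<Rightarrow> real" where
  "pearson_kernel \<beta> n m e \<tau> R = (let S = mmul n (ctr R) R; D = msub (idm m) S in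
    if pd \<beta> m D then (\<Prod>i<m. dg (chol \<beta> m D) i powr (2 * e i)) * qpow \<beta> m \<tau> S else 0)"

lemma pearson_riesz_pdf_eq:
  assumes "\<beta> \<in> {1,2,4}"
  shows "pearson_riesz_pdf \<beta> n m \<nu> \<kappa> \<tau> R = gammam \<beta> m (real n * real \<beta> / 2) (\<lambda>_. 0) /
        (pi powr (real m * real n * real \<beta> / 2) * cbeta \<beta> m (\<nu> * real \<beta> / 2) \<kappa> (real n * real \<beta> / 2) \<tau>)
    * pearson_kernel \<beta> n m (\<lambda>i. \<nu> * real \<beta> / 2 - (real m - 1) * real \<beta> / 2 - 1 + \<kappa> i) \<tau> R"
proof -
  let ?p = "\<nu> * real \<beta> / 2 - (real m - 1) * real \<beta> / 2 - 1" and ?D = "msub (idm m) (mmul n (ctr R) R)"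
  have e: "(\<nu> - real m + 1) * real \<beta> / 2 - 1 = ?p"
    by (simp add: field_simps)
  have *: "g * h / c * q * t = g / c * (h * q * t)" for g h c q t :: real
    by simp
  show ?thesis
    unfolding pearson_riesz_pdf_def pearson_kernel_def Let_def e *
    using hdet_powr_qpow[OF assms, of m ?D ?p \<kappa>] by (cases "pd \<beta> m ?D") (simp_all only: if_True if_False simp_thms mult_zero_right)
qed

lemma pearson_kernel_nonneg: "0 \<le> pearson_kernel \<beta> n m e \<tau> R"
  by (simp add: pearson_kernel_def Let_def qpow_dg prod_nonneg)

lemma riesz_kernel_nonneg: "0 \<le> riesz_kernel \<beta> m e A"
  by (simp add: riesz_kernel_def prod_nonneg)

lemma borel_measurable_pearson_kernel:
  assumes beta: "\<beta> \<in> {1,2,4}"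
  shows "(\<lambda>R. pearson_kernel \<beta> n m e \<tau> R) \<in> borel_measurable mat_space"
proof -
  have S: "(\<lambda>R. mmul n (ctr R) R) \<in> mat_space \<rightarrow>\<^sub>M mat_space"
    by (intro measurable_mmul measurable_ctr measurable_ident_sets refl)
  have D: "(\<lambda>R. msub (idm m) (mmul n (ctr R) R)) \<in> mat_space \<rightarrow>\<^sub>M mat_space"
    by (intro measurable_msub S) simp
  note [measurable] = pred_pd[OF beta D] borel_measurable_dg_chol[OF beta S] borel_measurable_dg_chol[OF beta D]
  show ?thesis unfolding pearson_kernel_def Let_def qpow_dg by measurable
qed

text \<open>The densities factorize since the Cholesky factor of \<open>L\<^sup>* D L\<close> is the one of \<open>D\<close> times \<open>L\<close>.\<close>

lemma riesz_kernel_factorization: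
  assumes beta: "\<beta> \<in> {1,2,4}" and U: "pd \<beta> m U" and R: "R \<in> mats \<beta> n m"
  defines "L \<equiv> chol \<beta> m U"
  defines "X \<equiv> mmul m R L"
  shows "(\<Prod>j<m. dg L j ^ (n * \<beta>)) * (riesz_kernel \<beta> m e (msub U (mmul n (ctr X) X)) * riesz_kernel \<beta> m \<tau> (mmul n (ctr X) X))
    = riesz_kernel \<beta> m (\<lambda>i. e i + \<tau> i + real n * real \<beta> / 2) U
      * (if pd \<beta> m (mmul n (ctr R) R) then pearson_kernel \<beta> n m e \<tau> R else 0)"
proof -
  define S where "S = mmul n (ctr R) R"
  define D where "D = msub (idm m) S"
  have S_mats: "S \<in> mats \<beta> m m" unfolding S_def using R by (intro mmul_mats[OF beta] ctr_mats)
  have D_mats: "D \<in> mats \<beta> m m" unfolding D_def by (intro msub_mats idm_mats S_mats)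
  have L: "upper_pos \<beta> m L" and LL: "mmul m (ctr L) L = U"
    using chol_pd[OF beta U] by (auto simp: L_def)
  have gX: "mmul n (ctr X) X = mmul m (ctr L) (mmul m S L)"
    by (simp add: X_def S_def ctr_mmul mmul_assoc)
  have UX: "msub U (mmul m (ctr L) (mmul m S L)) = mmul m (ctr L) (mmul m D L)"
    unfolding D_def by (simp add: mmul_msub_left mmul_msub_right mmul_idm_left[OF upper_posD(1)[OF L]] LL)
  note pd_iffs = pd_congruence_iff[OF beta L S_mats] pd_congruence_iff[OF beta L D_mats]
  show ?thesis
  proof (cases "pd \<beta> m S \<and> pd \<beta> m D")
    \<comment> \<open>Congruence by \<open>L\<close> preserves definiteness in both directions, so
      both sides are zero.\<close>
    case False
    then show ?thesis
      unfolding gX UX riesz_kernel_def[of _ _ e] riesz_kernel_def[of _ _ \<tau>] pd_iffs pearson_kernel_def Let_def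
        S_def [symmetric] D_def [symmetric] by auto
  next
    case True
    then have S: "pd \<beta> m S" and D: "pd \<beta> m D" by auto
    have pos: "0 < dg L i" "0 < dg (chol \<beta> m S) i" "0 < dg (chol \<beta> m D) i" if "i < m" for i
      using upper_posD(4)[OF L that] upper_posD(4)[OF chol_pd(1)[OF beta S] that]
        upper_posD(4)[OF chol_pd(1)[OF beta D] that] by auto
    have tr: "mtr m (msub U (mmul n (ctr X) X)) + mtr m (mmul n (ctr X) X) = mtr m U"
      by (simp add: mtr_def msub_def qre_linear sum_subtractf)
    have exp: "exp (- real \<beta> * mtr m (msub U (mmul n (ctr X) X))) * exp (- real \<beta> * mtr m (mmul n (ctr X) X))
        = exp (- real \<beta> * mtr m U)"
      unfolding tr [symmetric] by (simp add: distrib_left exp_add exp_diff exp_minus field_simps)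
    have chS: "dg (chol \<beta> m (mmul n (ctr X) X)) i = dg (chol \<beta> m S) i * dg L i" if "i < m" for i
      unfolding gX pd_congruence(2)[OF beta L S]
      by (rule upper_pos_mmul(2)[OF beta chol_pd(1)[OF beta S] L that])
    have chD: "dg (chol \<beta> m (msub U (mmul n (ctr X) X))) i = dg (chol \<beta> m D) i * dg L i" if "i < m" for i
      unfolding gX UX pd_congruence(2)[OF beta L D]
      by (rule upper_pos_mmul(2)[OF beta chol_pd(1)[OF beta D] L that])
    have kD: "riesz_kernel \<beta> m e (msub U (mmul n (ctr X) X)) = exp (- real \<beta> * mtr m (msub U (mmul n (ctr X) X)))
        * (\<Prod>i<m. (dg (chol \<beta> m D) i * dg L i) powr (2 * e i))"
    proof -
      have "pd \<beta> m (msub U (mmul n (ctr X) X))" unfolding gX UX pd_iffs by (rule D)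
      then show ?thesis by (simp add: riesz_kernel_def chD cong: prod.cong_simp)
    qed
    have kS: "riesz_kernel \<beta> m \<tau> (mmul n (ctr X) X) = exp (- real \<beta> * mtr m (mmul n (ctr X) X))
        * (\<Prod>i<m. (dg (chol \<beta> m S) i * dg L i) powr (2 * \<tau> i))"
    proof -
      have "pd \<beta> m (mmul n (ctr X) X)" unfolding gX pd_iffs by (rule S)
      then show ?thesis by (simp add: riesz_kernel_def chS cong: prod.cong_simp)
    qed
    have kU: "riesz_kernel \<beta> m (\<lambda>i. e i + \<tau> i + real n * real \<beta> / 2) U
        = exp (- real \<beta> * mtr m U) * (\<Prod>i<m. dg L i powr (2 * (e i + \<tau> i + real n * real \<beta> / 2)))"
      using U by (simp add: riesz_kernel_def L_def)
    have kR: "(if pd \<beta> m (mmul n (ctr R) R) then pearson_kernel \<beta> n m e \<tau> R else 0)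
        = (\<Prod>i<m. dg (chol \<beta> m D) i powr (2 * e i)) * (\<Prod>i<m. dg (chol \<beta> m S) i powr (2 * \<tau> i))"
      using S D by (simp add: pearson_kernel_def Let_def qpow_dg S_def [symmetric] D_def [symmetric])
    have "(\<Prod>j<m. dg L j ^ (n * \<beta>)) * ((\<Prod>i<m. (dg (chol \<beta> m D) i * dg L i) powr (2 * e i))
          * (\<Prod>i<m. (dg (chol \<beta> m S) i * dg L i) powr (2 * \<tau> i)))
        = (\<Prod>i<m. dg L i powr (2 * (e i + \<tau> i + real n * real \<beta> / 2)))
          * ((\<Prod>i<m. dg (chol \<beta> m D) i powr (2 * e i)) * (\<Prod>i<m. dg (chol \<beta> m S) i powr (2 * \<tau> i)))"
      unfolding prod.distrib [symmetric]
    proof (rule prod.cong[OF refl])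
      fix i assume "i \<in> {..<m}"
      then have p: "0 < dg L i" "0 < dg (chol \<beta> m S) i" "0 < dg (chol \<beta> m D) i" using pos by auto
      \<comment> \<open>Exponents of the Cholesky diagonal are doubled, so the Jacobian power
        \<open>n * \<beta>\<close> enters the kernel of \<open>U\<close> as
        \<open>n * \<beta> / 2\<close>. This is what raises the parameter from \<open>\<nu>\<close>
        to \<open>\<nu> + n\<close>.\<close>
      have "dg L i powr (2 * (e i + \<tau> i + real n * real \<beta> / 2))
          = dg L i powr (2 * e i) * dg L i powr (2 * \<tau> i) * dg L i ^ (n * \<beta>)"
        using p(1) by (simp add: distrib_left powr_add flip: powr_realpow)
      then show "dg L i ^ (n * \<beta>) * ((dg (chol \<beta> m D) i * dg L i) powr (2 * e i) * (dg (chol \<beta> m S) i * dg L i) powr (2 * \<tau> i))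
          = dg L i powr (2 * (e i + \<tau> i + real n * real \<beta> / 2)) * (dg (chol \<beta> m D) i powr (2 * e i) * dg (chol \<beta> m S) i powr (2 * \<tau> i))"
        using p by (simp add: powr_mult less_imp_le mult_ac)
    qed
    moreover have *: "p * (u * a * (v * b)) = u * v * (p * (a * b))" for p u a v b :: real
      by simp
    ultimately show ?thesis
      unfolding kD kS kU kR exp [symmetric] * by (simp only: mult.assoc)
  qed
qed

text \<open>The shift requires \<open>X\<close> to be fixed and the scaling requires
  \<open>U\<close> to be fixed, so the order of integration is exchanged before and after the shift.
  With an arbitrary \<open>F\<close> the identity contains both laws and the independence at once,
  up to constants.\<close>

lemma nn_integral_riesz_kotz_transform:
  assumes beta: "\<beta> \<in> {1,2,4}"
    and F: "(\<lambda>(U, R). F U R) \<in> borel_measurable (mat_space \<Otimes>\<^sub>M mat_space)"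
  shows "(\<integral>\<^sup>+V. \<integral>\<^sup>+X. ennreal (riesz_kernel \<beta> m e V) * ennreal (riesz_kernel \<beta> m \<tau> (mmul n (ctr X) X))
      * F (madd V (mmul n (ctr X) X)) (mmul m X (minv \<beta> m (chol \<beta> m (madd V (mmul n (ctr X) X))))) \<partial>lebM \<beta> n m \<partial>lebH \<beta> m)
    = (\<integral>\<^sup>+U. \<integral>\<^sup>+R. ennreal (riesz_kernel \<beta> m (\<lambda>i. e i + \<tau> i + real n * real \<beta> / 2) U)
      * ennreal (if pd \<beta> m (mmul n (ctr R) R) then pearson_kernel \<beta> n m e \<tau> R else 0) * F U R \<partial>lebM \<beta> n m \<partial>lebH \<beta> m)"
proof -
  let ?G = "\<lambda>X. mmul n (ctr X) X" and ?K = "\<lambda>U. minv \<beta> m (chol \<beta> m U)"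
  define H1 where "H1 V X = ennreal (riesz_kernel \<beta> m e V) * ennreal (riesz_kernel \<beta> m \<tau> (?G X))
      * F (madd V (?G X)) (mmul m X (?K (madd V (?G X))))" for V X
  \<comment> \<open>The same integrand after the shift, with the sum \<open>U\<close> as variable in
    place of \<open>V\<close>.\<close>
  define H2 where "H2 U X = ennreal (riesz_kernel \<beta> m e (msub U (?G X))) * ennreal (riesz_kernel \<beta> m \<tau> (?G X))
      * F U (mmul m X (?K U))" for U X
  let ?MM = "mat_space \<Otimes>\<^sub>M mat_space"
  have G: "(\<lambda>p. ?G (snd p)) \<in> ?MM \<rightarrow>\<^sub>M mat_space"
    by (intro measurable_mmul measurable_ctr measurable_snd)
  have G1: "(\<lambda>X. ?G X) \<in> mat_space \<rightarrow>\<^sub>M mat_space"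
    by (intro measurable_mmul measurable_ctr measurable_ident_sets refl)
  have H1_meas: "(\<lambda>(V, X). H1 V X) \<in> borel_measurable ?MM"
  proof -
    have U: "(\<lambda>p. madd (fst p) (?G (snd p))) \<in> ?MM \<rightarrow>\<^sub>M mat_space"
      by (intro measurable_madd measurable_fst G)
    have "(\<lambda>p. F (madd (fst p) (?G (snd p))) (mmul m (snd p) (?K (madd (fst p) (?G (snd p)))))) \<in> borel_measurable ?MM"
      using measurable_compose[OF measurable_Pair[OF U measurable_mmul[OF measurable_snd measurable_minv_chol[OF beta U]]] F]
      by simp
    then show ?thesis
      unfolding H1_def case_prod_beta
      using borel_measurable_riesz_kernel[OF beta measurable_fst[of mat_space mat_space], of m e]
        borel_measurable_riesz_kernel[OF beta G, of m \<tau>]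
      by (intro borel_measurable_times_ennreal measurable_ennreal) auto
  qed
  have H2_meas: "(\<lambda>(V, X). H2 V X) \<in> borel_measurable ?MM"
  proof -
    have U: "(\<lambda>p. msub (fst p) (?G (snd p))) \<in> ?MM \<rightarrow>\<^sub>M mat_space"
      by (intro measurable_msub measurable_fst G)
    have "(\<lambda>p. F (fst p) (mmul m (snd p) (?K (fst p)))) \<in> borel_measurable ?MM"
      using measurable_compose[OF measurable_Pair[OF measurable_fst measurable_mmul[OF measurable_snd measurable_minv_chol[OF beta measurable_fst]]] F]
      by simp
    then show ?thesis
      unfolding H2_def case_prod_beta
      using borel_measurable_riesz_kernel[OF beta U, of m e]
        borel_measurable_riesz_kernel[OF beta G, of m \<tau>]
      by (intro borel_measurable_times_ennreal measurable_ennreal) auto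
  qed
  have H2_fst: "(\<lambda>U. H2 U X) \<in> borel_measurable mat_space" for X
    using measurable_compose[OF measurable_Pair2' H2_meas, of X] by simp
  have H2_snd: "(\<lambda>X. H2 U X) \<in> borel_measurable mat_space" for U
    using measurable_compose[OF measurable_Pair1' H2_meas, of U] by simp
  have F_snd: "(\<lambda>R. F U R) \<in> borel_measurable mat_space" for U
    using measurable_compose[OF measurable_Pair1' F, of U] by simp
  have G_mats: "?G X \<in> mats \<beta> m m" if "X \<in> mats \<beta> n m" for X
    using that by (intro mmul_mats[OF beta] ctr_mats)
  have "(\<integral>\<^sup>+V. \<integral>\<^sup>+X. H1 V X \<partial>lebM \<beta> n m \<partial>lebH \<beta> m) = (\<integral>\<^sup>+X. \<integral>\<^sup>+V. H1 V X \<partial>lebH \<beta> m \<partial>lebM \<beta> n m)"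
    by (rule nn_integral_lebH_lebM_swap[OF H1_meas])
  also have "\<dots> = (\<integral>\<^sup>+X. \<integral>\<^sup>+U. H2 U X \<partial>lebH \<beta> m \<partial>lebM \<beta> n m)"
  proof (rule nn_integral_cong_AE, rule eventually_mono[OF AE_lebM_mats[OF beta]])
    fix X assume X: "X \<in> mats \<beta> n m"
    have "H2 (madd V (?G X)) X = H1 V X" for V
      by (simp add: H1_def H2_def madd_def msub_def)
    then show "(\<integral>\<^sup>+V. H1 V X \<partial>lebH \<beta> m) = (\<integral>\<^sup>+U. H2 U X \<partial>lebH \<beta> m)"
      unfolding nn_integral_lebH_translate[OF beta G_mats[OF X] ctr_gram H2_fst] by simp
  qed
  also have "\<dots> = (\<integral>\<^sup>+U. \<integral>\<^sup>+X. H2 U X \<partial>lebM \<beta> n m \<partial>lebH \<beta> m)"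
    by (rule nn_integral_lebH_lebM_swap[OF H2_meas, symmetric])
  also have "\<dots> = (\<integral>\<^sup>+U. \<integral>\<^sup>+R. ennreal (riesz_kernel \<beta> m (\<lambda>i. e i + \<tau> i + real n * real \<beta> / 2) U)
      * ennreal (if pd \<beta> m (?G R) then pearson_kernel \<beta> n m e \<tau> R else 0) * F U R \<partial>lebM \<beta> n m \<partial>lebH \<beta> m)"
  proof (rule nn_integral_cong)
    fix U
    show "(\<integral>\<^sup>+X. H2 U X \<partial>lebM \<beta> n m) = (\<integral>\<^sup>+R. ennreal (riesz_kernel \<beta> m (\<lambda>i. e i + \<tau> i + real n * real \<beta> / 2) U)
      * ennreal (if pd \<beta> m (?G R) then pearson_kernel \<beta> n m e \<tau> R else 0) * F U R \<partial>lebM \<beta> n m)" (is "_ = ?rhs")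
    proof (cases "pd \<beta> m U")
      case False
      \<comment> \<open>If \<open>U - X* X\<close> were positive definite, adding the Gram matrix
        back would make \<open>U\<close> positive definite.\<close>
      have "H2 U X = 0" if X: "X \<in> mats \<beta> n m" for X
      proof -
        have "madd (msub U (?G X)) (?G X) = U" by (simp add: madd_def msub_def)
        then have "\<not> pd \<beta> m (msub U (?G X))" using False pd_add_gram[OF beta _ X] by metis
        then show ?thesis by (simp add: H2_def riesz_kernel_def)
      qed
      then have "(\<integral>\<^sup>+X. H2 U X \<partial>lebM \<beta> n m) = (\<integral>\<^sup>+X. 0 \<partial>lebM \<beta> n m)"
        by (intro nn_integral_cong_AE eventually_mono[OF AE_lebM_mats[OF beta]])
      also have "\<dots> = ?rhs" using False by (simp add: riesz_kernel_def)
      finally show ?thesis .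
    next
      case True
      define L where "L = chol \<beta> m U"
      have L: "upper_pos \<beta> m L" using chol_pd(1)[OF beta True] by (simp add: L_def)
      have "(\<integral>\<^sup>+X. H2 U X \<partial>lebM \<beta> n m) = (\<Prod>j<m. ennreal (dg L j ^ (n * \<beta>))) * (\<integral>\<^sup>+R. H2 U (mmul m R L) \<partial>lebM \<beta> n m)"
        by (rule nn_integral_lebM_right_mult[OF beta L H2_snd])
      also have "\<dots> = (\<integral>\<^sup>+R. (\<Prod>j<m. ennreal (dg L j ^ (n * \<beta>))) * H2 U (mmul m R L) \<partial>lebM \<beta> n m)"
      proof (rule nn_integral_cmult[symmetric])
        have "(\<lambda>R. mmul m R L) \<in> mat_space \<rightarrow>\<^sub>M mat_space"
          by (intro measurable_mmul measurable_ident_sets refl) simp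
        from measurable_compose[OF this H2_snd, of U]
        show "(\<lambda>R. H2 U (mmul m R L)) \<in> borel_measurable (lebM \<beta> n m)" by simp
      qed
      also have "\<dots> = ?rhs"
      proof (rule nn_integral_cong_AE, rule eventually_mono[OF AE_lebM_mats[OF beta]])
        fix R assume R: "R \<in> mats \<beta> n m"
        have cancel: "mmul m (mmul m R L) (?K U) = R"
          unfolding L_def [symmetric] minv_upper[OF beta L] by (rule mmul_uinv_cancel(1)[OF beta L R])
        have "(\<Prod>j<m. ennreal (dg L j ^ (n * \<beta>))) = ennreal (\<Prod>j<m. dg L j ^ (n * \<beta>))"
          using upper_posD(4)[OF L] by (intro prod_ennreal zero_le_power less_imp_le) auto
        moreover have "0 \<le> (\<Prod>j<m. dg L j ^ (n * \<beta>))"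
          using upper_posD(4)[OF L] by (intro prod_nonneg zero_le_power ballI less_imp_le) auto
        ultimately have "(\<Prod>j<m. ennreal (dg L j ^ (n * \<beta>))) * (ennreal (riesz_kernel \<beta> m e (msub U (?G (mmul m R L))))
            * ennreal (riesz_kernel \<beta> m \<tau> (?G (mmul m R L))))
          = ennreal (riesz_kernel \<beta> m (\<lambda>i. e i + \<tau> i + real n * real \<beta> / 2) U)
            * ennreal (if pd \<beta> m (?G R) then pearson_kernel \<beta> n m e \<tau> R else 0)"
          using riesz_kernel_factorization[OF beta True R, of e \<tau>, folded L_def]
          by (simp add: riesz_kernel_nonneg pearson_kernel_nonneg flip: ennreal_mult)
        then show "(\<Prod>j<m. ennreal (dg L j ^ (n * \<beta>))) * H2 U (mmul m R L)
          = ennreal (riesz_kernel \<beta> m (\<lambda>i. e i + \<tau> i + real n * real \<beta> / 2) U)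
            * ennreal (if pd \<beta> m (?G R) then pearson_kernel \<beta> n m e \<tau> R else 0) * F U R"
          unfolding H2_def cancel by (simp only: mult.assoc [symmetric])
      qed
      finally show ?thesis .
    qed
  qed
  finally show ?thesis by (simp add: H1_def)
qed

text \<open>A nonpositive constant would make the density zero after the passage to
  \<open>ennreal\<close>, contradicting total mass one.\<close>

lemma distributed_const_pos:
  assumes M: "prob_space M" and X: "distributed M N X (\<lambda>x. ennreal (c * k x))" and k: "\<And>x. 0 \<le> k x"
  shows "0 < c"
proof (rule ccontr)
  interpret prob_space M by fact
  assume "\<not> 0 < c"
  then have "ennreal (c * k x) = 0" for x
    using k[of x] by (simp add: mult_nonpos_nonneg ennreal_neg)
  then have "emeasure (distr M N X) (space N) = 0"
    using X by (simp add: distributed_def emeasure_density)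
  moreover have "emeasure (distr M N X) (space N) = 1"
    using X by (intro prob_space.emeasure_space_1[OF prob_space_distr, unfolded space_distr]) (simp add: distributed_def)
  ultimately show False by simp
qed

text \<open>Densities refer to the reference measures \<open>N\<close> and \<open>N'\<close>,
  independence to \<open>S\<close> and \<open>T\<close>; these share only their sigma-algebras.
  Independence makes the joint law a product, and the densities are then inserted into the iterated
  integral.\<close>

lemma nn_integral_indep_distributed:
  assumes M: "prob_space M"
    and X: "distributed M N X f" and Y: "distributed M N' Y g"
    and S: "sets N = sets S" "sets N' = sets T"
    and indep: "prob_space.indep_var M S X T Y"
    and F: "(\<lambda>(x, y). F x y) \<in> borel_measurable (S \<Otimes>\<^sub>M T)"
  shows "(\<integral>\<^sup>+w. F (X w) (Y w) \<partial>M) = (\<integral>\<^sup>+x. \<integral>\<^sup>+y. f x * g y * F x y \<partial>N' \<partial>N)"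
proof -
  interpret prob_space M by fact
  have Xm: "X \<in> M \<rightarrow>\<^sub>M S" and Ym: "Y \<in> M \<rightarrow>\<^sub>M T"
    and pair: "distr M S X \<Otimes>\<^sub>M distr M T Y = distr M (S \<Otimes>\<^sub>M T) (\<lambda>w. (X w, Y w))"
    using indep unfolding indep_var_distribution_eq by auto
  have dX: "distr M S X = density N f" and dY: "distr M T Y = density N' g"
    using X Y distr_cong[OF refl S(1), of M X X] distr_cong[OF refl S(2), of M Y Y] by (simp_all add: distributed_def)
  have f: "f \<in> borel_measurable N" and g: "g \<in> borel_measurable N'"
    using X Y by (auto simp: distributed_def)
  interpret Y: prob_space "distr M T Y" by (rule prob_space_distr[OF Ym])
  have Fy: "(\<lambda>y. F x y) \<in> borel_measurable N'" if "x \<in> space N" for x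
  proof -
    have "x \<in> space S" using that sets_eq_imp_space_eq[OF S(1)] by simp
    from measurable_compose[OF measurable_Pair1'[OF this] F] show ?thesis
      using S(2) by (simp cong: measurable_cong_sets)
  qed
  have "(\<integral>\<^sup>+w. F (X w) (Y w) \<partial>M) = (\<integral>\<^sup>+p. (case p of (x, y) \<Rightarrow> F x y) \<partial>distr M (S \<Otimes>\<^sub>M T) (\<lambda>w. (X w, Y w)))"
    by (subst nn_integral_distr[OF measurable_Pair[OF Xm Ym]]) (use F in simp_all)
  also have "\<dots> = (\<integral>\<^sup>+p. (case p of (x, y) \<Rightarrow> F x y) \<partial>(distr M S X \<Otimes>\<^sub>M distr M T Y))"
    by (simp only: pair)
  also have "\<dots> = (\<integral>\<^sup>+x. \<integral>\<^sup>+y. F x y \<partial>distr M T Y \<partial>distr M S X)"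
  proof -
    have "(\<lambda>p. case p of (x, y) \<Rightarrow> F x y) \<in> borel_measurable (distr M S X \<Otimes>\<^sub>M distr M T Y)"
      using F by (simp cong: measurable_cong_sets sets_pair_measure_cong)
    from Y.nn_integral_fst[OF this] show ?thesis by simp
  qed
  also have "\<dots> = (\<integral>\<^sup>+x. f x * (\<integral>\<^sup>+y. F x y \<partial>distr M T Y) \<partial>N)"
    unfolding dX
  proof (rule nn_integral_density[OF f])
    have "(\<lambda>x. \<integral>\<^sup>+y. F x y \<partial>distr M T Y) \<in> borel_measurable S"
      by (rule Y.borel_measurable_nn_integral) (use F in \<open>simp cong: measurable_cong_sets sets_pair_measure_cong\<close>)
    then show "(\<lambda>x. \<integral>\<^sup>+y. F x y \<partial>distr M T Y) \<in> borel_measurable N"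
      using S(1) by (simp cong: measurable_cong_sets)
  qed
  also have "\<dots> = (\<integral>\<^sup>+x. \<integral>\<^sup>+y. f x * g y * F x y \<partial>N' \<partial>N)"
  proof (rule nn_integral_cong)
    fix x assume x: "x \<in> space N"
    have "f x * (\<integral>\<^sup>+y. F x y \<partial>distr M T Y) = f x * (\<integral>\<^sup>+y. g y * F x y \<partial>N')"
      unfolding dY by (simp add: nn_integral_density[OF g Fy[OF x]])
    also have "\<dots> = (\<integral>\<^sup>+y. f x * g y * F x y \<partial>N')"
      using g Fy[OF x] by (simp add: mult.assoc nn_integral_cmult)
    finally show "f x * (\<integral>\<^sup>+y. F x y \<partial>distr M T Y) = (\<integral>\<^sup>+y. f x * g y * F x y \<partial>N')" .
  qed
  finally show ?thesis .
qed

theorem theorem1: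
  fixes M :: "'w measure" and U1 X :: "'w \<Rightarrow> qmat"
    and \<beta> n m :: nat and \<nu> :: real and \<kappa> \<tau> :: "nat \<Rightarrow> real"
  assumes "prob_space M"
    and "\<beta> \<in> {1, 2, 4}"
    and "1 \<le> m" and "m \<le> n"
    and "\<nu> * real \<beta> / 2 > (real m - 1) * real \<beta> / 2 - \<kappa> (m - 1)"
    and "real n * real \<beta> / 2 > (real m - 1) * real \<beta> / 2 - \<tau> (m - 1)"
    and "distributed M (lebH \<beta> m) U1 (\<lambda>V. ennreal (riesz_pdf \<beta> m (\<nu> * real \<beta> / 2) \<kappa> V))"
    and "distributed M (lebM \<beta> n m) X (\<lambda>Y. ennreal (kotz_riesz_pdf \<beta> n m \<tau> Y))"
    and "prob_space.indep_var M mat_space U1 mat_space X"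
  defines "U \<equiv> (\<lambda>w. madd (U1 w) (mmul n (ctr (X w)) (X w)))"
  defines "R \<equiv> (\<lambda>w. mmul m (X w) (minv \<beta> m (chol \<beta> m (U w))))"
  shows "distributed M (lebH \<beta> m) U
           (\<lambda>V. ennreal (riesz_pdf \<beta> m ((\<nu> + real n) * real \<beta> / 2) (\<lambda>i. \<kappa> i + \<tau> i) V))
       \<and> prob_space.indep_var M mat_space U mat_space R
       \<and> distributed M (lebM \<beta> n m) R (\<lambda>S. ennreal (pearson_riesz_pdf \<beta> n m \<nu> \<kappa> \<tau> S))"
proof -
  note beta = assms(2)
  interpret prob_space M by fact
  have b: "0 < real \<beta>" using beta by auto
  let ?\<Sigma> = "\<lambda>\<kappa>. \<Sum>i<m. \<kappa> i :: real"
  define e where "e = (\<lambda>i. \<nu> * real \<beta> / 2 - (real m - 1) * real \<beta> / 2 - 1 + \<kappa> i)"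
  define e' where "e' = (\<lambda>i. (\<nu> + real n) * real \<beta> / 2 - (real m - 1) * real \<beta> / 2 - 1 + (\<kappa> i + \<tau> i))"
  have e': "(\<lambda>i. e i + \<tau> i + real n * real \<beta> / 2) = e'"
    by (rule ext) (simp add: e_def e'_def field_simps)
  define g1 where "g1 = gammam \<beta> m (\<nu> * real \<beta> / 2) \<kappa>"
  define g2 where "g2 = gammam \<beta> m (real n * real \<beta> / 2) \<tau>"
  define g12 where "g12 = gammam \<beta> m ((\<nu> + real n) * real \<beta> / 2) (\<lambda>i. \<kappa> i + \<tau> i)"
  define g0 where "g0 = gammam \<beta> m (real n * real \<beta> / 2) (\<lambda>_. 0)"
  define p where "p = pi powr (real m * real n * real \<beta> / 2)"
  define b1 where "b1 = real \<beta> powr (\<nu> * real \<beta> / 2 * real m + ?\<Sigma> \<kappa>)"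
  define b2 where "b2 = real \<beta> powr (real m * real n * real \<beta> / 2 + ?\<Sigma> \<tau>)"
  define b12 where "b12 = real \<beta> powr ((\<nu> + real n) * real \<beta> / 2 * real m + (\<Sum>i<m. \<kappa> i + \<tau> i))"
  have "(\<nu> + real n) * real \<beta> / 2 * real m + (\<Sum>i<m. \<kappa> i + \<tau> i)
      = (\<nu> * real \<beta> / 2 * real m + ?\<Sigma> \<kappa>) + (real m * real n * real \<beta> / 2 + ?\<Sigma> \<tau>)"
    by (simp add: sum.distrib field_simps)
  then have b12: "b12 = b1 * b2"
    by (simp add: b1_def b2_def b12_def powr_add)
  have bpos: "0 < b1" "0 < b2" "0 < p"
    using b by (simp_all add: b1_def b2_def p_def)
  define c1 where "c1 = b1 / g1"
  define c2 where "c2 = b2 * g0 / (p * g2)"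
  define cU where "cU = b12 / g12"
  define cR where "cR = g0 / (p * (g1 * g2 / g12))"
  have dU1: "distributed M (lebH \<beta> m) U1 (\<lambda>V. ennreal (c1 * riesz_kernel \<beta> m e V))"
    using assms(7) by (simp only: riesz_pdf_eq[OF beta] c1_def b1_def g1_def e_def)
  have dX: "distributed M (lebM \<beta> n m) X (\<lambda>Y. ennreal (c2 * riesz_kernel \<beta> m \<tau> (mmul n (ctr Y) Y)))"
    using assms(8) by (simp only: kotz_riesz_pdf_eq c2_def b2_def g0_def g2_def p_def)
  \<comment> \<open>The gamma arguments in \<open>g1\<close> and \<open>g2\<close> are not known to
    be positive at this point, so the signs come from the total mass of the given laws.\<close>
  have c1: "0 < c1" by (rule distributed_const_pos[OF assms(1) dU1 riesz_kernel_nonneg])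
  have c2: "0 < c2" by (rule distributed_const_pos[OF assms(1) dX riesz_kernel_nonneg])
  have U1m: "U1 \<in> M \<rightarrow>\<^sub>M mat_space" and Xm: "X \<in> M \<rightarrow>\<^sub>M mat_space"
    using assms(9) unfolding indep_var_distribution_eq by auto
  have Um: "U \<in> M \<rightarrow>\<^sub>M mat_space"
    unfolding U_def by (intro measurable_madd measurable_mmul measurable_ctr U1m Xm)
  have Rm: "R \<in> M \<rightarrow>\<^sub>M mat_space"
    unfolding R_def by (intro measurable_mmul measurable_minv_chol[OF beta] Um Xm)
  define hU where "hU V = ennreal (riesz_kernel \<beta> m e' V)" for V
  define hR where "hR S = ennreal (pearson_kernel \<beta> n m e \<tau> S)" for S
  have hU_meas: "hU \<in> borel_measurable mat_space"
    unfolding hU_def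
    by (rule measurable_compose[OF borel_measurable_riesz_kernel[OF beta measurable_ident_sets[OF refl]] measurable_ennreal])
  have hR_meas: "hR \<in> borel_measurable mat_space"
    unfolding hR_def by (rule measurable_compose[OF borel_measurable_pearson_kernel[OF beta] measurable_ennreal])
  define IU where "IU A = (\<integral>\<^sup>+V. hU V * indicator A V \<partial>lebH \<beta> m)" for A
  define IR where "IR B = (\<integral>\<^sup>+S. hR S * indicator B S \<partial>lebM \<beta> n m)" for B
  \<comment> \<open>Rectangles suffice: they determine both marginals and, being a generator, the
    product law.\<close>
  have joint: "emeasure M {w \<in> space M. U w \<in> A \<and> R w \<in> B} = ennreal (c1 * c2) * (IU A * IR B)"
    if A: "A \<in> sets mat_space" and B: "B \<in> sets mat_space" for A B
  proof -
    let ?F = "\<lambda>U R. indicator A U * indicator B R :: ennreal"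
    let ?G = "\<lambda>X. mmul n (ctr X) X"
    let ?U = "\<lambda>V X. madd V (?G X)" and ?R = "\<lambda>V X. mmul m X (minv \<beta> m (chol \<beta> m (madd V (?G X))))"
    have F: "(\<lambda>(U, R). ?F U R) \<in> borel_measurable (mat_space \<Otimes>\<^sub>M mat_space)"
      using A B by measurable
    have Up: "(\<lambda>p. ?U (fst p) (snd p)) \<in> (mat_space \<Otimes>\<^sub>M mat_space) \<rightarrow>\<^sub>M mat_space"
      by (intro measurable_madd measurable_mmul measurable_ctr measurable_fst measurable_snd)
    have Rp: "(\<lambda>p. ?R (fst p) (snd p)) \<in> (mat_space \<Otimes>\<^sub>M mat_space) \<rightarrow>\<^sub>M mat_space"
      by (intro measurable_mmul measurable_snd measurable_minv_chol[OF beta] Up)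
    have F': "(\<lambda>(V, X). ?F (?U V X) (?R V X)) \<in> borel_measurable (mat_space \<Otimes>\<^sub>M mat_space)"
      using measurable_compose[OF measurable_Pair[OF Up Rp] F] by (simp add: case_prod_beta)
    have "{w \<in> space M. U w \<in> A \<and> R w \<in> B} \<in> events"
    proof -
      have "{w \<in> space M. U w \<in> A \<and> R w \<in> B} = (U -` A \<inter> space M) \<inter> (R -` B \<inter> space M)" by auto
      then show ?thesis using measurable_sets[OF Um A] measurable_sets[OF Rm B] by (simp only: sets.Int)
    qed
    then have "emeasure M {w \<in> space M. U w \<in> A \<and> R w \<in> B} = (\<integral>\<^sup>+w. indicator {w \<in> space M. U w \<in> A \<and> R w \<in> B} w \<partial>M)"
      by simp
    also have "\<dots> = (\<integral>\<^sup>+w. ?F (?U (U1 w) (X w)) (?R (U1 w) (X w)) \<partial>M)"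
      by (intro nn_integral_cong) (auto simp: U_def R_def indicator_def)
    also have "\<dots> = (\<integral>\<^sup>+V. \<integral>\<^sup>+X. ennreal (c1 * riesz_kernel \<beta> m e V) * ennreal (c2 * riesz_kernel \<beta> m \<tau> (?G X))
        * ?F (?U V X) (?R V X) \<partial>lebM \<beta> n m \<partial>lebH \<beta> m)"
      by (rule nn_integral_indep_distributed[OF assms(1) dU1 dX _ _ assms(9) F']) simp_all
    also have "\<dots> = (\<integral>\<^sup>+V. \<integral>\<^sup>+X. ennreal (riesz_kernel \<beta> m e V) * ennreal (riesz_kernel \<beta> m \<tau> (?G X))
        * (ennreal (c1 * c2) * ?F (?U V X) (?R V X)) \<partial>lebM \<beta> n m \<partial>lebH \<beta> m)"
      using c1 c2 by (intro nn_integral_cong) (simp add: ennreal_mult riesz_kernel_nonneg less_imp_le mult_ac)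
    also have "\<dots> = (\<integral>\<^sup>+V. \<integral>\<^sup>+S. hU V * ennreal (if pd \<beta> m (?G S) then pearson_kernel \<beta> n m e \<tau> S else 0)
        * (ennreal (c1 * c2) * ?F V S) \<partial>lebM \<beta> n m \<partial>lebH \<beta> m)"
      unfolding hU_def e' [symmetric]
      by (rule nn_integral_riesz_kotz_transform[OF beta]) (use A B in measurable)
    also have "\<dots> = (\<integral>\<^sup>+V. \<integral>\<^sup>+S. (ennreal (c1 * c2) * (hU V * indicator A V)) * (hR S * indicator B S) \<partial>lebM \<beta> n m \<partial>lebH \<beta> m)"
    \<comment> \<open>Here the definiteness condition on \<open>S* S\<close> is dropped, since it
      holds almost everywhere.\<close>
    proof (rule nn_integral_cong, rule nn_integral_cong_AE)
      show "AE S in lebM \<beta> n m. hU V * ennreal (if pd \<beta> m (?G S) then pearson_kernel \<beta> n m e \<tau> S else 0)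
          * (ennreal (c1 * c2) * ?F V S) = (ennreal (c1 * c2) * (hU V * indicator A V)) * (hR S * indicator B S)" for V
        by (rule eventually_mono[OF AE_lebM_gram_pd[OF beta assms(4)]]) (simp add: hR_def mult_ac)
    qed
    also have "\<dots> = (\<integral>\<^sup>+V. (ennreal (c1 * c2) * (hU V * indicator A V)) * IR B \<partial>lebH \<beta> m)"
      unfolding IR_def
      by (intro nn_integral_cong nn_integral_cmult borel_measurable_times_ennreal borel_measurable_indicator)
        (use hR_meas B in \<open>simp_all cong: measurable_cong_sets\<close>)
    also have "\<dots> = (\<integral>\<^sup>+V. (ennreal (c1 * c2) * (hU V * indicator A V)) \<partial>lebH \<beta> m) * IR B"
      by (intro nn_integral_multc borel_measurable_times_ennreal borel_measurable_indicator)
        (use hU_meas A in \<open>simp_all cong: measurable_cong_sets\<close>)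
    also have "\<dots> = ennreal (c1 * c2) * IU A * IR B"
      unfolding IU_def
      by (subst nn_integral_cmult) (use hU_meas A in \<open>auto intro!: borel_measurable_times_ennreal borel_measurable_indicator cong: measurable_cong_sets\<close>)
    finally show ?thesis by (simp add: mult.assoc)
  qed
  have UNIV_sets: "UNIV \<in> sets mat_space" using sets.top[of mat_space] by simp
  have total: "ennreal (c1 * c2) * (IU UNIV * IR UNIV) = 1"
    using joint[OF UNIV_sets UNIV_sets] emeasure_space_1 by simp
  have IU_UNIV: "IU UNIV = (\<integral>\<^sup>+V. ennreal (riesz_kernel \<beta> m e' V) \<partial>lebH \<beta> m)"
    by (simp add: IU_def hU_def)
  \<comment> \<open>An infinite factor would make the product infinite, or zero if
    \<open>IR UNIV\<close> vanishes, but never 1.\<close>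
  have "IU UNIV \<noteq> \<top>"
    using total mult_pos_pos[OF c1 c2]
    by (auto simp: ennreal_top_mult ennreal_mult_top ennreal_eq_0_iff split: if_splits)
  then have pos: "0 < (\<nu> + real n) * real \<beta> / 2 + (\<kappa> i + \<tau> i) - real i * real \<beta> / 2" if "i < m" for i
    using that unfolding IU_UNIV e'_def
    by (intro nn_integral_riesz_kernel_finite_imp[OF beta]) (simp_all add: less_top)
  have IU_val: "IU UNIV = ennreal (g12 / b12)"
    unfolding IU_UNIV e'_def g12_def b12_def by (rule nn_integral_riesz_kernel[OF beta pos])
  have g12: "0 < g12"
    unfolding g12_def gammam_def using pos by (intro mult_pos_pos prod_pos) (auto intro: Gamma_real_pos)
  have cU: "0 < cU" using g12 bpos by (simp add: cU_def b12)
  \<comment> \<open>Both products equal \<open>b1 * b2 * g0 / (p * g1 * g2)\<close>: the factor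
    \<open>g12\<close> of the beta function cancels against the one in \<open>cU\<close>. The sign
    of \<open>cR\<close> then follows without examining \<open>g0\<close>, \<open>g1\<close> and
    \<open>g2\<close> separately.\<close>
  have cc: "c1 * c2 = cU * cR"
    using g12 bpos c1 c2 by (simp add: c1_def c2_def cU_def cR_def b12 field_simps)
  have cR: "0 < cR" using cc cU mult_pos_pos[OF c1 c2] zero_less_mult_pos by metis
  have totU: "ennreal cU * IU UNIV = 1"
    using g12 bpos cU unfolding IU_val by (simp add: cU_def b12 flip: ennreal_mult)
  \<comment> \<open>Distributes the joint constant so that each of the two factors becomes a
    probability measure on its own.\<close>
  have split: "ennreal (c1 * c2) * (x * y) = (ennreal cU * x) * (ennreal cR * y)" for x y
    using cU cR by (simp add: cc ennreal_mult mult_ac)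
  have totR: "ennreal cR * IR UNIV = 1"
    using total unfolding split totU by simp
  have PU: "emeasure M {w \<in> space M. U w \<in> A} = ennreal cU * IU A" if "A \<in> sets mat_space" for A
    using joint[OF that UNIV_sets] unfolding split totR by simp
  have PR: "emeasure M {w \<in> space M. R w \<in> B} = ennreal cR * IR B" if "B \<in> sets mat_space" for B
    using joint[OF UNIV_sets that] unfolding split totU by simp
  have pdfU: "ennreal (riesz_pdf \<beta> m ((\<nu> + real n) * real \<beta> / 2) (\<lambda>i. \<kappa> i + \<tau> i) V) = ennreal cU * hU V" for V
    unfolding riesz_pdf_eq[OF beta] hU_def using cU
    by (simp only: cU_def b12_def g12_def e'_def ennreal_mult riesz_kernel_nonneg less_imp_le)
  have pdfR: "ennreal (pearson_riesz_pdf \<beta> n m \<nu> \<kappa> \<tau> S) = ennreal cR * hR S" for S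
  proof -
    have "cbeta \<beta> m (\<nu> * real \<beta> / 2) \<kappa> (real n * real \<beta> / 2) \<tau> = g1 * g2 / g12"
      by (simp add: cbeta_def g1_def g2_def g12_def distrib_right add_divide_distrib)
    then have "pearson_riesz_pdf \<beta> n m \<nu> \<kappa> \<tau> S = cR * pearson_kernel \<beta> n m e \<tau> S"
      unfolding pearson_riesz_pdf_eq[OF beta] by (simp only: cR_def g0_def p_def e_def)
    then show ?thesis using cR by (simp add: hR_def ennreal_mult pearson_kernel_nonneg)
  qed
  have "distributed M (lebH \<beta> m) U (\<lambda>V. ennreal cU * hU V)"
    unfolding distributed_def
  proof (intro conjI measure_eqI)
    show "(\<lambda>V. ennreal cU * hU V) \<in> borel_measurable (lebH \<beta> m)" "U \<in> M \<rightarrow>\<^sub>M lebH \<beta> m"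
      using hU_meas Um by (auto cong: measurable_cong_sets)
    fix A assume "A \<in> sets (distr M (lebH \<beta> m) U)"
    then have A: "A \<in> sets mat_space" by simp
    have "emeasure (distr M (lebH \<beta> m) U) A = ennreal cU * IU A"
      using Um A PU[OF A] by (subst emeasure_distr) (auto simp: vimage_def Int_def conj_commute cong: measurable_cong_sets)
    also have "\<dots> = emeasure (density (lebH \<beta> m) (\<lambda>V. ennreal cU * hU V)) A"
      unfolding IU_def using hU_meas A
      by (subst emeasure_density) (auto simp: mult.assoc nn_integral_cmult cong: measurable_cong_sets)
    finally show "emeasure (distr M (lebH \<beta> m) U) A = emeasure (density (lebH \<beta> m) (\<lambda>V. ennreal cU * hU V)) A" .
  qed simp
  moreover have "distributed M (lebM \<beta> n m) R (\<lambda>S. ennreal cR * hR S)"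
    unfolding distributed_def
  proof (intro conjI measure_eqI)
    show "(\<lambda>V. ennreal cR * hR V) \<in> borel_measurable (lebM \<beta> n m)" "R \<in> M \<rightarrow>\<^sub>M lebM \<beta> n m"
      using hR_meas Rm by (auto cong: measurable_cong_sets)
    fix B assume "B \<in> sets (distr M (lebM \<beta> n m) R)"
    then have B: "B \<in> sets mat_space" by simp
    have "emeasure (distr M (lebM \<beta> n m) R) B = ennreal cR * IR B"
      using Rm B PR[OF B] by (subst emeasure_distr) (auto simp: vimage_def Int_def conj_commute cong: measurable_cong_sets)
    also have "\<dots> = emeasure (density (lebM \<beta> n m) (\<lambda>S. ennreal cR * hR S)) B"
      unfolding IR_def using hR_meas B
      by (subst emeasure_density) (auto simp: mult.assoc nn_integral_cmult cong: measurable_cong_sets)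
    finally show "emeasure (distr M (lebM \<beta> n m) R) B = emeasure (density (lebM \<beta> n m) (\<lambda>S. ennreal cR * hR S)) B" .
  qed simp
  moreover have "indep_var mat_space U mat_space R"
    unfolding indep_var_distribution_eq
  proof (intro conjI Um Rm pair_measure_eqI)
    show "sigma_finite_measure (distr M mat_space U)" "sigma_finite_measure (distr M mat_space R)"
      using prob_space_distr[OF Um] prob_space_distr[OF Rm]
      by (auto intro: prob_space_imp_sigma_finite)
    show "sets (distr M mat_space U \<Otimes>\<^sub>M distr M mat_space R)
        = sets (distr M (mat_space \<Otimes>\<^sub>M mat_space) (\<lambda>w. (U w, R w)))"
      by (simp cong: sets_pair_measure_cong)
    fix A B assume "A \<in> sets (distr M mat_space U)" "B \<in> sets (distr M mat_space R)"
    then have A: "A \<in> sets mat_space" and B: "B \<in> sets mat_space" by auto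
    have "emeasure (distr M mat_space U) A = ennreal cU * IU A" "emeasure (distr M mat_space R) B = ennreal cR * IR B"
      using PU[OF A] PR[OF B] Um Rm A B by (auto simp: emeasure_distr vimage_def Int_def conj_commute)
    moreover have "emeasure (distr M (mat_space \<Otimes>\<^sub>M mat_space) (\<lambda>w. (U w, R w))) (A \<times> B)
        = (ennreal cU * IU A) * (ennreal cR * IR B)"
      using joint[OF A B] A B unfolding split
      by (subst emeasure_distr[OF measurable_Pair[OF Um Rm]]) (auto simp: vimage_def Int_def conj_commute)
    ultimately show "emeasure (distr M mat_space U) A * emeasure (distr M mat_space R) B
        = emeasure (distr M (mat_space \<Otimes>\<^sub>M mat_space) (\<lambda>w. (U w, R w))) (A \<times> B)"
      by simp
  qed
  ultimately show ?thesis by (simp add: pdfU pdfR)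
qed

end
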